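(* Let $\Omega\subset\mathbb{R}^n$ be a smooth bounded domain, let $b(x)\ge 0$ with $0\le\underline{b}\le b(x)\le\overline{b}$ in $\Omega$ for some constants $\underline{b}$ and $\overline{b}$, let $\lambda>0$ be a parameter, and let $u$ be a positive classical stable solution of $$-\Delta u-b(x)|\nabla u|^2=\lambda e^u\ \text{ in }\Omega,\qquad u=0\ \text{ on }\partial\Omega .$$ For all positive constants $\delta$ and $\eta$ with $\delta^2+\eta^2\le1$, if $$\overline{b}-\underline{b}<\frac{\delta^2}{\eta^2}\Big(\eta^2-\frac{\overline{b}}{8}\Big)\quad\text{and}\quad n<2+4\eta^2+4\overline{b}+4\sqrt{\eta^2(\eta^2+\overline{b})-2\overline{b}(\overline{b}-\underline{b})\frac{\eta^2}{\delta^2}},$$ then $\|u\|_{L^\infty(\Omega)}\le C$, where $C$ depends only on $n$, $b$ and $\Omega$.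
   Context: Stability: a classical solution $u$ of $-\Delta u-b(x)|\nabla u|^2=\lambda g(u)$ in $\Omega$, $u=0$ on $\partial\Omega$, is called stable if there exists a function $\phi\in W^{2,p}(\Omega)$ for some $p>n$ such that $\phi>0$ in $\overline{\Omega}$ and $-\Delta\phi-2b(x)\nabla u\cdot\nabla\phi\ge\lambda g'(u)\phi$ in $\Omega$. Here $g(u)=e^u$. *)

theory Defs
  imports "HOL-Analysis.Analysis" "HOL-Probability.Essential_Supremum"
begin

definition partial :: "'n::finite \<Rightarrow> (real^'n \<Rightarrow> real) \<Rightarrow> real^'n \<Rightarrow> real" where
  "partial i f x = frechet_derivative f (at x) (axis i 1)"

definition grad :: "(real^'n::finite \<Rightarrow> real) \<Rightarrow> real^'n \<Rightarrow> real^'n" where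
  "grad f x = (\<chi> i. partial i f x)"

definition laplacian :: "(real^'n::finite \<Rightarrow> real) \<Rightarrow> real^'n \<Rightarrow> real" where
  "laplacian f x = (\<Sum>i\<in>UNIV. partial i (partial i f) x)"

text \<open>Only used for open \<open>S\<close>; there it is the usual \<open>C\<^sup>k(S)\<close>.\<close>

primrec Ck_on :: "nat \<Rightarrow> (real^'n::finite) set \<Rightarrow> (real^'n \<Rightarrow> real) \<Rightarrow> bool" where
  "Ck_on 0 S f \<longleftrightarrow> continuous_on S f"
| "Ck_on (Suc k) S f \<longleftrightarrow> f differentiable_on S \<and> (\<forall>i. Ck_on k S (partial i f))"

definition smooth_fun_on :: "(real^'n::finite) set \<Rightarrow> (real^'n \<Rightarrow> real) \<Rightarrow> bool" where
  "smooth_fun_on S f \<longleftrightarrow> (\<forall>k. Ck_on k S f)"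

text \<open>A \<open>C\<^sup>\<infinity>\<close> boundary is described by local defining functions \<open>\<rho>\<close> with nonvanishing gradient.
  Near a boundary point the domain is exactly \<open>{\<rho> < 0}\<close>, so it lies on one side of its boundary;
  \<open>\<rho> x\<^sub>0 = 0\<close> is automatic.\<close>

definition smooth_bounded_domain :: "(real^'n::finite) set \<Rightarrow> bool" where
  "smooth_bounded_domain \<Omega> \<longleftrightarrow>
     open \<Omega> \<and> connected \<Omega> \<and> \<Omega> \<noteq> {} \<and> bounded \<Omega> \<and>
     (\<forall>x\<^sub>0\<in>frontier \<Omega>. \<exists>U \<rho>. open U \<and> x\<^sub>0 \<in> U \<and> smooth_fun_on U \<rho> \<and>
        (\<forall>x\<in>U. grad \<rho> x \<noteq> 0) \<and> \<Omega> \<inter> U = {x\<in>U. \<rho> x < 0})"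

text \<open>Classical solutions belong to \<open>C\<^sup>2(\<Omega>) \<inter> C(closure \<Omega>)\<close>.\<close>

definition classical_solution ::
  "(real^'n::finite) set \<Rightarrow> (real^'n \<Rightarrow> real) \<Rightarrow> real \<Rightarrow> (real \<Rightarrow> real) \<Rightarrow> (real^'n \<Rightarrow> real) \<Rightarrow> bool" where
  "classical_solution \<Omega> b lam g u \<longleftrightarrow>
     Ck_on 2 \<Omega> u \<and> continuous_on (closure \<Omega>) u \<and>
     (\<forall>x\<in>\<Omega>. - laplacian u x - b x * (norm (grad u x))\<^sup>2 = lam * g (u x)) \<and>
     (\<forall>x\<in>frontier \<Omega>. u x = 0)"

definition test_function :: "(real^'n::finite) set \<Rightarrow> (real^'n \<Rightarrow> real) \<Rightarrow> bool" where
  "test_function \<Omega> \<psi> \<longleftrightarrow> smooth_fun_on UNIV \<psi> \<and>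
     compact (closure {x. \<psi> x \<noteq> 0}) \<and> closure {x. \<psi> x \<noteq> 0} \<subseteq> \<Omega>"

definition in_Lp :: "(real^'n::finite) set \<Rightarrow> real \<Rightarrow> (real^'n \<Rightarrow> real) \<Rightarrow> bool" where
  "in_Lp \<Omega> p f \<longleftrightarrow> f \<in> borel_measurable (lebesgue_on \<Omega>) \<and>
     integrable (lebesgue_on \<Omega>) (\<lambda>x. \<bar>f x\<bar> powr p)"

text \<open>Meaningful for locally integrable \<open>f\<close> and \<open>h\<close>; below both are always in \<open>L\<^sup>p(\<Omega>)\<close>.\<close>

definition has_weak_partial ::
  "(real^'n::finite) set \<Rightarrow> 'n \<Rightarrow> (real^'n \<Rightarrow> real) \<Rightarrow> (real^'n \<Rightarrow> real) \<Rightarrow> bool" where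
  "has_weak_partial \<Omega> i f h \<longleftrightarrow>
     (\<forall>\<psi>. test_function \<Omega> \<psi> \<longrightarrow>
        (LINT x|lebesgue_on \<Omega>. f x * partial i \<psi> x) = - (LINT x|lebesgue_on \<Omega>. h x * \<psi> x))"

text \<open>\<open>\<phi> \<in> W\<^sup>2\<^sup>,\<^sup>p(\<Omega>)\<close>, with weak gradient \<open>G\<close> and weak Hessian \<open>H\<close>.\<close>

definition W2p_with_derivs ::
  "(real^'n::finite) set \<Rightarrow> real \<Rightarrow> (real^'n \<Rightarrow> real) \<Rightarrow> (real^'n \<Rightarrow> real^'n) \<Rightarrow>
   (real^'n \<Rightarrow> real^'n^'n) \<Rightarrow> bool" where
  "W2p_with_derivs \<Omega> p \<phi> G H \<longleftrightarrow>
     in_Lp \<Omega> p \<phi> \<and>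
     (\<forall>i. in_Lp \<Omega> p (\<lambda>x. G x $ i) \<and> has_weak_partial \<Omega> i \<phi> (\<lambda>x. G x $ i)) \<and>
     (\<forall>i j. in_Lp \<Omega> p (\<lambda>x. H x $ i $ j) \<and>
        has_weak_partial \<Omega> j (\<lambda>x. G x $ i) (\<lambda>x. H x $ i $ j))"

text \<open>For \<open>p > n\<close> elements of \<open>W\<^sup>2\<^sup>,\<^sup>p(\<Omega>)\<close> are continuous up to the boundary; the
  condition \<open>\<phi> > 0\<close> on the closure refers to that representative. \<open>\<Delta>\<phi>\<close> is the trace
  of the weak Hessian, so the differential inequality is required almost everywhere.\<close>

definition stable_solution ::
  "(real^'n::finite) set \<Rightarrow> (real^'n \<Rightarrow> real) \<Rightarrow> real \<Rightarrow> (real \<Rightarrow> real) \<Rightarrow> (real^'n \<Rightarrow> real) \<Rightarrow> bool" where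
  "stable_solution \<Omega> b lam g u \<longleftrightarrow>
     classical_solution \<Omega> b lam g u \<and>
     (\<exists>p \<phi> G H. p > real CARD('n) \<and> W2p_with_derivs \<Omega> p \<phi> G H \<and>
        continuous_on (closure \<Omega>) \<phi> \<and> (\<forall>x\<in>closure \<Omega>. \<phi> x > 0) \<and>
        (AE x in lebesgue_on \<Omega>.
           - trace (H x) - 2 * b x * (grad u x \<bullet> G x) \<ge> lam * deriv g (u x) * \<phi> x))"

definition Linf_norm :: "(real^'n::finite) set \<Rightarrow> (real^'n \<Rightarrow> real) \<Rightarrow> ereal" where
  "Linf_norm \<Omega> f = esssup (lebesgue_on \<Omega>) (\<lambda>x. ereal \<bar>f x\<bar>)"

end

theory Submission
  imports Defs
begin

text \<open>
  Stability together with Young's inequality gives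
  \<open>\<integral> \<lambda> e\<^sup>u \<psi>\<^sup>2 \<le> \<integral> |\<nabla>\<psi> - b \<psi> \<nabla>u|\<^sup>2\<close> for \<open>\<psi>\<close> with compact support in \<open>\<Omega>\<close>. Testing this with
  \<open>\<psi> = F(u)\<close> and the equation with \<open>H(u)\<close>, where \<open>F \<approx> e\<^bsup>\<alpha>u\<^esup>\<close>, \<open>H \<approx> \<theta> e\<^bsup>2\<alpha>u\<^esup>\<close> and \<open>\<theta> < 1\<close>, bounds
  \<open>\<integral> e\<^bsup>(2\<alpha>+1)u\<^esup>\<close> as soon as \<open>(\<alpha> - b)\<^sup>2 < 2\<alpha> - b\<close>; the hypotheses allow such an \<open>\<alpha>\<close> with
  \<open>2\<alpha> + 1 > n/2\<close>. Moreover \<open>\<lambda>\<close> is bounded in terms of \<open>\<Omega>\<close>. Finally, for \<open>\<beta>\<close> above \<open>b\<close> the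
  function \<open>w = (e\<^bsup>\<beta>u\<^esup> - e\<^bsup>\<beta>\<^esup>)\<^sub>+\<^sup>3\<close> satisfies \<open>- \<Delta>w \<le> 3\<beta> \<lambda> e\<^bsup>(1+3\<beta>)u\<^esup>\<close>, and the Newtonian potential
  together with the \<open>L\<^sup>p\<close> bound on \<open>\<lambda> e\<^sup>u\<close>, \<open>p > n/2\<close>, yields
  \<open>max e\<^bsup>3\<beta>u\<^esup> \<le> C (max e\<^bsup>3\<beta>u\<^esup>)\<^bsup>\<vartheta>\<^esup>\<close> with \<open>\<vartheta> < 1\<close>. All test functions are functions of \<open>u\<close> that vanish
  for \<open>u \<le> 1\<close>, so the boundary plays no role.
\<close>

section \<open>Integration by parts\<close>

text \<open>The exponent condition compares two identities, cutoffs aside. Stability with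
  e^(\<alpha>u) bounds \<integral> \<lambda> e^((2\<alpha>+1)u) by \<integral> (\<alpha>-b)^2
  e^(2\<alpha>u) |\<nabla>u|^2, while the equation tested with e^(2\<alpha>u) equates \<integral>
  (2\<alpha>-b) e^(2\<alpha>u) |\<nabla>u|^2 with the same left-hand side. If (\<alpha>-b)^2 stays
  uniformly below 2\<alpha>-b, a fraction of the integral survives and pays for the cutoff. The
  factor \<lambda> cancels here but reappears on the right of the subsolution inequality, hence the
  separate bound on \<lambda>. Cutting off in u rather than in x is suggested by regularity: u is
  C^2 only inside \<Omega> and its gradient may blow up at the boundary, whereas {u \<ge> 1} is
  compact in \<Omega>. The exponential removes the gradient term: -\<Delta> e^(\<beta>u) = \<beta>
  e^(\<beta>u) (\<lambda> e^u + (b-\<beta>) |\<nabla>u|^2). Cubing the truncated function makes it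
  C^2 across the level u = 1. The exponent \<vartheta> falls below 1 because 2\<alpha>+1 strictly
  exceeds n/2, so the potential estimate can run with a smaller exponent.\<close>

lemma integrable_compact_support:
  fixes f :: "'a::euclidean_space \<Rightarrow> real"
  assumes "compact K" "continuous_on UNIV f" "\<And>x. x \<notin> K \<Longrightarrow> f x = 0"
  shows "integrable lborel f"
proof -
  have "integrable lborel (\<lambda>x. indicator K x *\<^sub>R f x)"
    using assms by (intro borel_integrable_compact continuous_on_subset[OF assms(2)]) auto
  moreover have "(\<lambda>x. indicator K x *\<^sub>R f x) = f"
    using assms(3) by (fastforce simp: indicator_def)
  ultimately show ?thesis by simp
qed

lemma directional_deriv_outside_support:
  fixes f :: "'a::real_normed_vector \<Rightarrow> real"
  assumes "open U" "x \<in> U" "\<And>y. y \<in> U \<Longrightarrow> f y = 0"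
  shows "((\<lambda>t. f (x + t *\<^sub>R e)) has_real_derivative 0) (at 0)"
proof -
  have "open ((\<lambda>t::real. x + t *\<^sub>R e) -` U)"
    by (intro open_vimage assms(1) continuous_intros)
  then show ?thesis
    by (rule has_field_derivative_transform_within_open[OF DERIV_const]) (use assms in auto)
qed

text \<open>Translation invariance makes every difference quotient of \<open>f\<close> integrate to
  zero, and dominated convergence passes to the derivative.\<close>

lemma integral_directional_deriv_zero:
  fixes f D :: "'a::euclidean_space \<Rightarrow> real"
  assumes K: "compact K" and f0: "\<And>x. x \<notin> K \<Longrightarrow> f x = 0"
    and contf: "continuous_on UNIV f"
    and der: "\<And>x. ((\<lambda>t. f (x + t *\<^sub>R e)) has_real_derivative D x) (at 0)"
    and contD: "continuous_on UNIV D"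
  shows "(LINT x|lborel. D x) = 0"
proof -
  define s where "s = (\<lambda>k x. (f (x + (1 / real (Suc k)) *\<^sub>R e) - f x) * real (Suc k))"
  have D0: "D x = 0" if "x \<notin> K" for x
  proof (rule DERIV_unique[OF der])
    show "((\<lambda>t. f (x + t *\<^sub>R e)) has_real_derivative 0) (at 0)"
      using that f0 K by (intro directional_deriv_outside_support[of "- K"])
        (auto simp: compact_imp_closed open_Compl)
  qed
  have der': "((\<lambda>t. f (x + t *\<^sub>R e)) has_real_derivative D (x + t *\<^sub>R e)) (at t)" for x t
  proof -
    have "((\<lambda>s. f (x + t *\<^sub>R e + s *\<^sub>R e)) has_real_derivative D (x + t *\<^sub>R e)) (at 0)"
      by (rule der)
    then have "((\<lambda>s. f (x + (s + t) *\<^sub>R e)) has_real_derivative D (x + t *\<^sub>R e)) (at 0)"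
      by (simp add: algebra_simps)
    then show ?thesis
      using DERIV_shift[of "\<lambda>s. f (x + s *\<^sub>R e)" "D (x + t *\<^sub>R e)" 0 t] by (simp add: add.commute)
  qed
  obtain B where B: "\<And>x. \<bar>D x\<bar> \<le> B"
  proof -
    have "compact (D ` K)"
      using K contD continuous_on_subset by (intro compact_continuous_image) auto
    then obtain B where "\<And>x. x \<in> K \<Longrightarrow> \<bar>D x\<bar> \<le> B"
      unfolding real_norm_def[symmetric] by (meson bounded_iff compact_imp_bounded image_eqI)
    then have "\<bar>D x\<bar> \<le> max B 0" for x using D0[of x] by (cases "x \<in> K") (auto simp: le_max_iff_disj)
    then show ?thesis using that by blast
  qed
  \<comment> \<open>The points from which some \<open>t *\<^sub>R e\<close> with t in [0,1] leads
    into \<open>K\<close>: a compact set carrying every difference quotient, hence the support of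
    the dominating function.\<close>
  define K2 where "K2 = (\<lambda>p. fst p - snd p *\<^sub>R e) ` (K \<times> {0..1::real})"
  have "compact K2" unfolding K2_def
    using K by (intro compact_continuous_image compact_Times continuous_intros) auto
  have s_mvt: "\<exists>\<xi>. 0 < \<xi> \<and> \<xi> < 1 / real (Suc k) \<and> s k x = D (x + \<xi> *\<^sub>R e)" for k x
  proof -
    have "\<exists>z::real. z > 0 \<and> z < 1 / real (Suc k) \<and>
        f (x + (1 / real (Suc k)) *\<^sub>R e) - f (x + 0 *\<^sub>R e) = (1 / real (Suc k) - 0) * D (x + z *\<^sub>R e)"
      by (rule MVT2) (auto intro: der')
    then obtain z :: real where z: "z > 0" "z < 1 / real (Suc k)"
      "f (x + (1 / real (Suc k)) *\<^sub>R e) - f x = (1 / real (Suc k)) * D (x + z *\<^sub>R e)"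
      by auto
    then have "s k x = D (x + z *\<^sub>R e)" unfolding s_def by simp
    with z show ?thesis by blast
  qed
  have s_bound: "norm (s k x) \<le> B * indicator K2 x" for k x
  proof -
    obtain \<xi> where x: "0 < \<xi>" "\<xi> < 1 / real (Suc k)" "s k x = D (x + \<xi> *\<^sub>R e)"
      using s_mvt by blast
    have "1 / real (Suc k) \<le> 1" by simp
    then have \<xi>1: "\<xi> \<le> 1" using x by linarith
    show ?thesis
    proof (cases "x \<in> K2")
      case True then show ?thesis using B x by simp
    next
      case False
      have "x + \<xi> *\<^sub>R e \<notin> K"
      proof
        assume "x + \<xi> *\<^sub>R e \<in> K"
        then have "(x + \<xi> *\<^sub>R e, \<xi>) \<in> K \<times> {0..1}" using x \<xi>1 by auto
        then have "x \<in> K2" unfolding K2_def by (intro image_eqI) auto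
        with False show False by simp
      qed
      then show ?thesis using D0 x False by simp
    qed
  qed
  have intf: "integrable lborel f" by (rule integrable_compact_support[OF K contf f0])
  have s0: "(LINT x|lborel. s k x) = 0" for k
  proof -
    let ?v = "(1 / real (Suc k)) *\<^sub>R e"
    have i1: "integrable lborel (\<lambda>x. f (?v + x))"
      using integrable_distr_eq[of "(+) ?v" lborel borel f] intf
      by (simp add: lborel_distr_plus borel_measurable_continuous_onI contf)
    have i2: "(LINT x|lborel. f (?v + x)) = (LINT x|lborel. f x)"
      using integral_distr[of "(+) ?v" lborel borel f]
      by (simp add: lborel_distr_plus borel_measurable_continuous_onI contf)
    have "(LINT x|lborel. (f (?v + x) - f x) * real (Suc k)) = 0"
      using i1 i2 intf by simp
    then show ?thesis unfolding s_def by (simp add: add.commute)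
  qed
  have "(\<lambda>k. LINT x|lborel. s k x) \<longlonglongrightarrow> (LINT x|lborel. D x)"
  proof (rule integral_dominated_convergence[where w = "\<lambda>x. B * indicator K2 x"])
    show "D \<in> borel_measurable lborel" using contD by (simp add: borel_measurable_continuous_onI)
    show "s k \<in> borel_measurable lborel" for k
    proof -
      have "continuous_on UNIV (s k)" unfolding s_def
        by (intro continuous_intros continuous_on_compose2[OF contf]) auto
      then show ?thesis by (simp add: borel_measurable_continuous_onI)
    qed
    show "integrable lborel (\<lambda>x. B * indicator K2 x)"
      using emeasure_bounded_finite[OF compact_imp_bounded[OF \<open>compact K2\<close>]] borel_compact[OF \<open>compact K2\<close>]
      by (intro integrable_mult_right integrable_real_indicator) auto
    show "AE x in lborel. (\<lambda>k. s k x) \<longlonglongrightarrow> D x"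
    proof (rule AE_I2)
      fix x
      have "((\<lambda>t. (f (x + t *\<^sub>R e) - f x) / t) \<longlongrightarrow> D x) (at 0)"
        using der[of x] by (simp add: has_field_derivative_iff)
      moreover have "filterlim (\<lambda>k. 1 / real (Suc k)) (at 0) sequentially"
        using LIMSEQ_inverse_real_of_nat by (intro filterlim_atI) (simp_all add: inverse_eq_divide)
      ultimately have "(\<lambda>k. (f (x + (1 / real (Suc k)) *\<^sub>R e) - f x) / (1 / real (Suc k))) \<longlonglongrightarrow> D x"
        by (rule filterlim_compose)
      then show "(\<lambda>k. s k x) \<longlonglongrightarrow> D x" unfolding s_def by simp
    qed
    show "AE x in lborel. norm (s k x) \<le> B * indicator K2 x" for k
      using s_bound by simp
  qed
  then show ?thesis using s0 by (simp add: LIMSEQ_const_iff)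
qed

text \<open>The divergence theorem for the field \<open>a V\<close>, obtained coordinate by
  coordinate from the zero extension of \<open>a (V \<bullet> e)\<close>. Only the product is asked
  to vanish off \<open>K\<close>, and only the diagonal of the derivative \<open>W\<close> is asked
  to be continuous, since the divergence sees nothing else.\<close>

lemma green_identity:
  fixes a :: "'a::euclidean_space \<Rightarrow> real" and V :: "'a \<Rightarrow> 'a"
  assumes \<Omega>: "open \<Omega>" and K: "compact K" "K \<subseteq> \<Omega>"
    and a: "\<And>x. x \<in> \<Omega> \<Longrightarrow> GDERIV a x :> A x" and A: "continuous_on \<Omega> A"
    and V: "\<And>x. x \<in> \<Omega> \<Longrightarrow> (V has_derivative W x) (at x)"
    and W: "\<And>e. e \<in> Basis \<Longrightarrow> continuous_on \<Omega> (\<lambda>x. W x e \<bullet> e)"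
    and supp: "\<And>x. x \<in> \<Omega> - K \<Longrightarrow> a x *\<^sub>R V x = 0"
  shows "(LINT x:K|lborel. A x \<bullet> V x + a x * (\<Sum>e\<in>Basis. W x e \<bullet> e)) = 0"
proof -
  have conta: "continuous_on \<Omega> a"
    using a \<Omega> by (auto simp: continuous_on_eq_continuous_at gderiv_def intro: has_derivative_continuous)
  have contV: "continuous_on \<Omega> V"
    using V \<Omega> by (auto simp: continuous_on_eq_continuous_at intro: has_derivative_continuous)
  define d where "d = (\<lambda>e x. (A x \<bullet> e) * (V x \<bullet> e) + a x * (W x e \<bullet> e))"
  have contd: "continuous_on \<Omega> (d e)" if "e \<in> Basis" for e
    unfolding d_def
    by (intro continuous_on_add continuous_on_mult[OF conta W[OF that]]
          continuous_on_mult[OF continuous_on_inner[OF A continuous_on_const]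
            continuous_on_inner[OF contV continuous_on_const]])
  have main: "(LINT x:K|lborel. d e x) = 0" if e: "e \<in> Basis" for e
  proof -
    define f where "f = (\<lambda>x. if x \<in> \<Omega> then a x * (V x \<bullet> e) else 0)"
    define D where "D = (\<lambda>x. if x \<in> \<Omega> then d e x else 0)"
    have f0: "f x = 0" if "x \<notin> K" for x
      using supp[of x] that by (auto simp: f_def)
    have oK: "open (- K)" using K by (simp add: compact_imp_closed open_Compl)
    have der: "((\<lambda>t. f (x + t *\<^sub>R e)) has_real_derivative D x) (at 0)" for x
    proof (cases "x \<in> \<Omega>")
      case True
      have "((\<lambda>x. a x * (V x \<bullet> e)) has_derivative (\<lambda>h. a x * (W x h \<bullet> e) + (h \<bullet> A x) * (V x \<bullet> e))) (at x)"
        using a[OF True] V[OF True] unfolding gderiv_def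
        by (auto intro!: derivative_eq_intros)
      moreover have "(f has_derivative f') (at x)" if "((\<lambda>x. a x * (V x \<bullet> e)) has_derivative f') (at x)" for f'
        using that \<Omega> True by (auto simp: f_def elim: has_derivative_transform_within_open)
      ultimately have fd: "(f has_derivative (\<lambda>h. a x * (W x h \<bullet> e) + (h \<bullet> A x) * (V x \<bullet> e))) (at (x + 0 *\<^sub>R e))"
        by simp
      have "((\<lambda>t::real. x + t *\<^sub>R e) has_derivative (\<lambda>t. t *\<^sub>R e)) (at 0)"
        by (auto intro!: derivative_eq_intros)
      from has_derivative_compose[OF this, of f, OF fd] have "((\<lambda>t. f (x + t *\<^sub>R e)) has_derivative
          (\<lambda>t. a x * (W x (t *\<^sub>R e) \<bullet> e) + (t *\<^sub>R e \<bullet> A x) * (V x \<bullet> e))) (at 0)"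
        by simp
      moreover have "linear (W x)" using V[OF True] has_derivative_linear by blast
      ultimately show ?thesis using True
        by (auto simp: has_field_derivative_def D_def d_def linear_cmul inner_commute algebra_simps
            elim!: has_derivative_eq_rhs)
    next
      case False
      then have "x \<in> - K" using K by auto
      then have "((\<lambda>t. f (x + t *\<^sub>R e)) has_real_derivative 0) (at 0)"
        using f0 by (intro directional_deriv_outside_support[OF oK]) auto
      then show ?thesis using False by (simp add: D_def)
    qed
    have D0: "D x = 0" if "x \<notin> K" for x
      using DERIV_unique[OF der directional_deriv_outside_support[OF oK]] that f0 by auto
    \<comment> \<open>\<Omega> and the complement of \<open>K\<close> form an open cover, so a
      function vanishing off \<open>K\<close> is continuous everywhere as soon as it is continuous
      on \<Omega>.\<close>
    have glue: "continuous_on UNIV g" if "continuous_on \<Omega> g" "\<And>x. x \<notin> K \<Longrightarrow> g x = 0" for g :: "'a \<Rightarrow> real"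
    proof -
      have "continuous_on (- K) g"
        by (rule continuous_on_eq[OF continuous_on_const[of _ 0]]) (use that in auto)
      then have "continuous_on (\<Omega> \<union> - K) g"
        by (intro continuous_on_open_Un \<Omega> oK that(1))
      moreover have "\<Omega> \<union> - K = UNIV" using K by auto
      ultimately show ?thesis by simp
    qed
    have "continuous_on \<Omega> f"
      by (rule continuous_on_eq[of _ "\<lambda>x. a x * (V x \<bullet> e)"]) (auto simp: f_def intro!: continuous_intros conta contV)
    moreover have "continuous_on \<Omega> D"
      by (rule continuous_on_eq[OF contd[OF e]]) (auto simp: D_def)
    ultimately have "(LINT x|lborel. D x) = 0"
      using f0 D0 by (intro integral_directional_deriv_zero[OF K(1) f0 _ der] glue)
    moreover have "(\<lambda>x. indicator K x *\<^sub>R d e x) = D"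
    proof (rule ext)
      show "indicator K x *\<^sub>R d e x = D x" for x
        using D0[of x] K(2) by (cases "x \<in> K") (auto simp: D_def)
    qed
    ultimately show ?thesis by (simp add: set_lebesgue_integral_def)
  qed
  have "A x \<bullet> V x + a x * (\<Sum>e\<in>Basis. W x e \<bullet> e) = (\<Sum>e\<in>Basis. d e x)" for x
    unfolding d_def by (simp add: sum.distrib sum_distrib_left euclidean_inner[of "A x" "V x"])
  then have "(LINT x:K|lborel. A x \<bullet> V x + a x * (\<Sum>e\<in>Basis. W x e \<bullet> e)) = (LINT x:K|lborel. \<Sum>e\<in>Basis. d e x)"
    by simp
  also have "\<dots> = (\<Sum>e\<in>Basis. LINT x:K|lborel. d e x)"
    unfolding set_lebesgue_integral_def scaleR_sum_right
    by (intro Bochner_Integration.integral_sum borel_integrable_compact K(1) continuous_on_subset[OF contd K(2)])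
  also have "\<dots> = 0" by (intro sum.neutral ballI main)
  finally show ?thesis .
qed

section \<open>Functions with continuous gradient and Laplacian\<close>

text \<open>A working substitute for C^2. Gradient and Laplacian are explicit parameters, so that
  after mollification averages of weak derivatives can be put in their place. \<open>W\<close> is
  the derivative of the gradient; continuity is asked only of its diagonal, which is what the
  divergence theorem consumes.\<close>

definition gradient_laplacian_on ::
  "'a::euclidean_space set \<Rightarrow> ('a \<Rightarrow> real) \<Rightarrow> ('a \<Rightarrow> 'a) \<Rightarrow> ('a \<Rightarrow> real) \<Rightarrow> bool" where
  "gradient_laplacian_on \<Omega> u G L \<longleftrightarrow> continuous_on \<Omega> G \<and> (\<forall>x\<in>\<Omega>. GDERIV u x :> G x) \<and>
    (\<exists>W. (\<forall>x\<in>\<Omega>. (G has_derivative W x) (at x)) \<and> (\<forall>e\<in>Basis. continuous_on \<Omega> (\<lambda>x. W x e \<bullet> e)) \<and>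
         (\<forall>x\<in>\<Omega>. L x = (\<Sum>e\<in>Basis. W x e \<bullet> e)))"

lemma gderiv_continuous_on:
  assumes "\<And>x. x \<in> \<Omega> \<Longrightarrow> GDERIV a x :> A x"
  shows "continuous_on \<Omega> a"
  using assms unfolding gderiv_def
  by (meson continuous_at_imp_continuous_on has_derivative_continuous)

lemma gradient_laplacian_onD:
  fixes \<Omega> :: "'a::euclidean_space set"
  assumes "gradient_laplacian_on \<Omega> u G L"
  shows "x \<in> \<Omega> \<Longrightarrow> GDERIV u x :> G x" "continuous_on \<Omega> u" "continuous_on \<Omega> G" "continuous_on \<Omega> L"
proof -
  obtain W :: "'a \<Rightarrow> 'a \<Rightarrow> 'a" where "\<forall>e\<in>Basis. continuous_on \<Omega> (\<lambda>x. W x e \<bullet> e)"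
    and L: "\<forall>x\<in>\<Omega>. L x = (\<Sum>e\<in>Basis. W x e \<bullet> e)"
    using assms unfolding gradient_laplacian_on_def by blast
  then have "continuous_on \<Omega> (\<lambda>x. \<Sum>e\<in>Basis. W x e \<bullet> e)"
    by (intro continuous_on_sum) auto
  then show "continuous_on \<Omega> L" using L by (simp cong: continuous_on_cong)
  show "continuous_on \<Omega> u"
    using assms gderiv_continuous_on unfolding gradient_laplacian_on_def by blast
qed (use assms in \<open>auto simp: gradient_laplacian_on_def\<close>)

text \<open>The integrand is the divergence of \<open>a G\<close>. The alternative in the last
  hypothesis lets the compact support sit in either factor; the second Green identity of the
  potential estimate uses both.\<close>

lemma green_laplacian:
  assumes "gradient_laplacian_on \<Omega> u G L" "open \<Omega>" "compact K" "K \<subseteq> \<Omega>"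
    and "\<And>x. x \<in> \<Omega> \<Longrightarrow> GDERIV a x :> A x" "continuous_on \<Omega> A"
    and "\<And>x. x \<in> \<Omega> - K \<Longrightarrow> a x = 0 \<or> G x = 0"
  shows "(LINT x:K|lborel. A x \<bullet> G x + a x * L x) = 0"
proof -
  obtain W where W: "\<And>x. x \<in> \<Omega> \<Longrightarrow> (G has_derivative W x) (at x)"
      "\<And>e. e \<in> Basis \<Longrightarrow> continuous_on \<Omega> (\<lambda>x. W x e \<bullet> e)"
    and L: "\<And>x. x \<in> \<Omega> \<Longrightarrow> L x = (\<Sum>e\<in>Basis. W x e \<bullet> e)"
    using assms(1) unfolding gradient_laplacian_on_def by blast
  have "(LINT x:K|lborel. A x \<bullet> G x + a x * (\<Sum>e\<in>Basis. W x e \<bullet> e)) = 0"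
    using assms(7) by (intro green_identity[OF assms(2-6) W(1) W(2)]) auto
  moreover have "(LINT x:K|lborel. A x \<bullet> G x + a x * L x)
      = (LINT x:K|lborel. A x \<bullet> G x + a x * (\<Sum>e\<in>Basis. W x e \<bullet> e))"
    using L assms(3,4) by (intro set_lebesgue_integral_cong) (auto simp: borel_compact)
  ultimately show ?thesis by simp
qed

lemma gradient_laplacian_on_compose:
  assumes "gradient_laplacian_on \<Omega> u G L"
    and P: "\<And>x. x \<in> \<Omega> \<Longrightarrow> (P has_real_derivative P1 (u x)) (at (u x))"
    and P1: "\<And>x. x \<in> \<Omega> \<Longrightarrow> (P1 has_real_derivative P2 (u x)) (at (u x))"
    and P2: "continuous_on \<Omega> (\<lambda>x. P2 (u x))"
  shows "gradient_laplacian_on \<Omega> (\<lambda>x. P (u x)) (\<lambda>x. P1 (u x) *\<^sub>R G x)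
           (\<lambda>x. P2 (u x) * (norm (G x))\<^sup>2 + P1 (u x) * L x)"
proof -
  note u = gradient_laplacian_onD[OF assms(1)]
  obtain W where W: "\<And>x. x \<in> \<Omega> \<Longrightarrow> (G has_derivative W x) (at x)"
      "\<And>e. e \<in> Basis \<Longrightarrow> continuous_on \<Omega> (\<lambda>x. W x e \<bullet> e)"
    and L: "\<And>x. x \<in> \<Omega> \<Longrightarrow> L x = (\<Sum>e\<in>Basis. W x e \<bullet> e)"
    using assms(1) unfolding gradient_laplacian_on_def by blast
  have gP1: "GDERIV (\<lambda>x. P1 (u x)) x :> P2 (u x) *\<^sub>R G x" if "x \<in> \<Omega>" for x
    using GDERIV_DERIV_compose[OF u(1)[OF that] P1[OF that]] .
  have cP1: "continuous_on \<Omega> (\<lambda>x. P1 (u x))" by (rule gderiv_continuous_on[OF gP1])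
  define W' where "W' = (\<lambda>x h. (P2 (u x) * (h \<bullet> G x)) *\<^sub>R G x + P1 (u x) *\<^sub>R W x h)"
  have "((\<lambda>x. P1 (u x) *\<^sub>R G x) has_derivative W' x) (at x)" if "x \<in> \<Omega>" for x
    using gP1[OF that] W(1)[OF that] unfolding gderiv_def W'_def
    by (auto intro!: derivative_eq_intros simp: algebra_simps)
  moreover have "continuous_on \<Omega> (\<lambda>x. W' x e \<bullet> e)" if "e \<in> Basis" for e
  proof -
    have "(\<lambda>x. W' x e \<bullet> e) = (\<lambda>x. P2 (u x) * (e \<bullet> G x) * (G x \<bullet> e) + P1 (u x) * (W x e \<bullet> e))"
      by (simp add: W'_def inner_add_left)
    moreover have "continuous_on \<Omega> \<dots>"
      by (intro continuous_on_add continuous_on_mult[OF cP1 W(2)[OF that]] continuous_on_mult[OF P2]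
          continuous_on_mult continuous_on_inner continuous_on_const P2 u(3))
    ultimately show ?thesis by (simp only:)
  qed
  moreover have "P2 (u x) * (norm (G x))\<^sup>2 + P1 (u x) * L x = (\<Sum>e\<in>Basis. W' x e \<bullet> e)" if "x \<in> \<Omega>" for x
  proof -
    have "(norm (G x))\<^sup>2 = (\<Sum>e\<in>Basis. (e \<bullet> G x) * (G x \<bullet> e))"
      unfolding power2_norm_eq_inner by (subst euclidean_inner) (simp add: inner_commute)
    then show ?thesis
      by (simp add: W'_def inner_add_left sum.distrib sum_distrib_left L[OF that] mult.assoc)
  qed
  moreover have "GDERIV (\<lambda>x. P (u x)) x :> P1 (u x) *\<^sub>R G x" if "x \<in> \<Omega>" for x
    using GDERIV_DERIV_compose[OF u(1)[OF that] P[OF that]] .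
  moreover have "continuous_on \<Omega> (\<lambda>x. P1 (u x) *\<^sub>R G x)"
    by (intro continuous_on_scaleR cP1 u(3))
  ultimately show ?thesis unfolding gradient_laplacian_on_def by blast
qed

text \<open>The constant \<open>d\<close> is free for two purposes: with \<epsilon>^2 this is a
  positive regularised squared distance, to be composed with singular powers; with -\<rho>^2 its
  negative part is a cutoff for a ball.\<close>

lemma gradient_laplacian_on_shifted_square:
  "gradient_laplacian_on UNIV (\<lambda>x::'a::euclidean_space. (norm (x - c))\<^sup>2 + d) (\<lambda>x. 2 *\<^sub>R (x - c)) (\<lambda>x. 2 * real DIM('a))"
proof -
  have "GDERIV (\<lambda>x::'a. (norm (x - c))\<^sup>2 + d) x :> 2 *\<^sub>R (x - c)" for x
    unfolding gderiv_def power2_norm_eq_inner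
    by (auto intro!: derivative_eq_intros simp: inner_commute)
  moreover have "((\<lambda>x. 2 *\<^sub>R (x - c)) has_derivative (\<lambda>h. 2 *\<^sub>R h)) (at x)" for x :: 'a
    by (auto intro!: derivative_eq_intros)
  moreover have "2 * real DIM('a) = (\<Sum>e\<in>(Basis::'a set). (2 *\<^sub>R e) \<bullet> e)"
    by (simp add: inner_Basis)
  ultimately show ?thesis unfolding gradient_laplacian_on_def
    by (intro conjI exI[of _ "\<lambda>x h. 2 *\<^sub>R h"] ballI continuous_intros) auto
qed

section \<open>From partial derivatives to the coordinate-free notion\<close>

lemma sum_Basis_vec:
  fixes g :: "real^'n \<Rightarrow> 'b::comm_monoid_add"
  shows "(\<Sum>e\<in>Basis. g e) = (\<Sum>i\<in>UNIV. g (axis i (1::real)))"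
proof -
  have inj: "inj (\<lambda>i::'n. axis i (1::real))" by (auto simp: inj_def axis_eq_axis)
  have "(Basis :: (real^'n) set) = range (\<lambda>i::'n. axis i (1::real))" by (auto simp: Basis_vec_def)
  then have "sum g Basis = sum g (range (\<lambda>i::'n. axis i (1::real)))" by simp
  also have "\<dots> = (\<Sum>i\<in>UNIV. g (axis i (1::real)))" using sum.reindex[OF inj, of g] by simp
  finally show ?thesis .
qed

lemma gderiv_grad:
  assumes "f differentiable (at x)"
  shows "GDERIV f x :> grad f x"
proof -
  let ?D = "frechet_derivative f (at x)"
  have D: "(f has_derivative ?D) (at x)" using assms frechet_derivative_works by blast
  then have lin: "linear ?D" by (rule has_derivative_linear)
  have "?D h = h \<bullet> grad f x" for h
  proof -
    have "?D h = ?D (\<Sum>e\<in>Basis. (h \<bullet> e) *\<^sub>R e)" by (simp add: euclidean_representation)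
    also have "\<dots> = (\<Sum>e\<in>Basis. (h \<bullet> e) * ?D e)" using lin by (simp add: linear_sum linear_cmul)
    also have "\<dots> = h \<bullet> grad f x"
      by (simp add: sum_Basis_vec inner_axis) (simp add: inner_vec_def grad_def partial_def)
    finally show ?thesis .
  qed
  then show ?thesis using D unfolding gderiv_def by presburger
qed

lemma gradient_laplacian_on_Ck:
  assumes "open \<Omega>" "Ck_on 2 \<Omega> u"
  shows "gradient_laplacian_on \<Omega> u (grad u) (laplacian u)"
proof -
  have d: "u differentiable_on \<Omega>" "\<And>i. partial i u differentiable_on \<Omega>"
    and c: "\<And>i j. continuous_on \<Omega> (partial j (partial i u))"
    using assms(2) by (auto simp: numeral_2_eq_2)
  define W where "W = (\<lambda>x h. \<chi> i. h \<bullet> grad (partial i u) x)"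
  have e: "W x (axis i 1) \<bullet> axis i 1 = partial i (partial i u) x" for x i
    by (simp add: W_def inner_axis inner_axis' grad_def)
  have "GDERIV u x :> grad u x" if "x \<in> \<Omega>" for x
    using d(1) assms(1) that by (intro gderiv_grad) (simp add: differentiable_on_eq_differentiable_at)
  moreover have "continuous_on \<Omega> (grad u)"
    unfolding grad_def using d(2) by (intro continuous_on_vec_lambda differentiable_imp_continuous_on)
  moreover have "(grad u has_derivative W x) (at x)" if "x \<in> \<Omega>" for x
  proof (subst has_derivative_componentwise_within, rule ballI)
    fix e :: "real^'a" assume "e \<in> Basis"
    then obtain i where i: "e = axis i 1" by (auto simp: Basis_vec_def)
    have "GDERIV (partial i u) x :> grad (partial i u) x"
      using d(2) assms(1) that by (intro gderiv_grad) (simp add: differentiable_on_eq_differentiable_at)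
    then show "((\<lambda>x. grad u x \<bullet> e) has_derivative (\<lambda>h. W x h \<bullet> e)) (at x)"
      by (simp add: i W_def inner_axis grad_def gderiv_def)
  qed
  moreover have "continuous_on \<Omega> (\<lambda>x. W x e \<bullet> e)" if "e \<in> Basis" for e
    using that e c by (auto simp: Basis_vec_def)
  moreover have "laplacian u x = (\<Sum>e\<in>Basis. W x e \<bullet> e)" for x
    by (simp add: laplacian_def sum_Basis_vec e)
  ultimately show ?thesis unfolding gradient_laplacian_on_def by blast
qed

section \<open>Singular kernels\<close>

text \<open>At 0 the difference quotient is at most |h|^n, which tends to 0 because n \<ge> 1.
  Squares of positive parts are therefore C^1 and cubes C^2; the cutoffs in x and in u below are
  built from such powers.\<close>

lemma DERIV_pos_part_power:
  assumes "n \<ge> 1"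
  shows "((\<lambda>y::real. max 0 y ^ Suc n) has_real_derivative real (Suc n) * max 0 y ^ n) (at y)"
proof -
  consider "y > 0" | "y < 0" | "y = 0" by linarith
  then show ?thesis
  proof cases
    case 1
    have "((\<lambda>y::real. y ^ Suc n) has_real_derivative real (Suc n) * y ^ n) (at y)"
      using DERIV_pow[of "Suc n" y] by simp
    moreover have "open {0::real<..}" "y \<in> {0<..}" using 1 by auto
    ultimately have "((\<lambda>y::real. max 0 y ^ Suc n) has_real_derivative real (Suc n) * y ^ n) (at y)"
      by (rule has_field_derivative_transform_within_open) (simp add: max_def)
    then show ?thesis using 1 by (simp add: max_def)
  next
    case 2
    have "((\<lambda>y::real. 0) has_real_derivative real (Suc n) * max 0 y ^ n) (at y)"
      using 2 assms by (simp add: max_def zero_power)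
    moreover have "open {..<0::real}" "y \<in> {..<0}" using 2 by auto
    ultimately show ?thesis
      by (rule has_field_derivative_transform_within_open) (simp add: max_def)
  next
    case 3
    have "((\<lambda>h::real. max 0 h ^ Suc n / h) \<longlongrightarrow> 0) (at 0)"
    proof (rule Lim_null_comparison)
      show "\<forall>\<^sub>F h::real in at 0. norm (max 0 h ^ Suc n / h) \<le> \<bar>h\<bar> ^ n"
        by (rule eventually_at_topological[THEN iffD2], intro exI[of _ UNIV]) (auto simp: max_def abs_mult)
      show "((\<lambda>h::real. \<bar>h\<bar> ^ n) \<longlongrightarrow> 0) (at 0)"
        using assms by (intro tendsto_eq_intros | simp)+
    qed
    then show ?thesis using 3 assms by (simp add: has_field_derivative_iff zero_power)
  qed
qed

lemma gradient_laplacian_on_subset: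
  assumes "gradient_laplacian_on \<Omega> u G L" "S \<subseteq> \<Omega>"
  shows "gradient_laplacian_on S u G L"
proof -
  obtain W where "\<forall>x\<in>\<Omega>. (G has_derivative W x) (at x)" "\<forall>e\<in>Basis. continuous_on \<Omega> (\<lambda>x. W x e \<bullet> e)"
    "\<forall>x\<in>\<Omega>. L x = (\<Sum>e\<in>Basis. W x e \<bullet> e)"
    using assms(1) unfolding gradient_laplacian_on_def by blast
  then show ?thesis
    using assms unfolding gradient_laplacian_on_def
    by (intro conjI exI[of _ W]) (auto intro: continuous_on_subset)
qed

text \<open>\<open>h\<close> is the antiderivative of -t^(-\<nu>) that vanishes at \<open>T\<close>;
  for \<nu> = 1 it is a logarithm. A positive exponent \<kappa>, possibly larger than \<nu> - 1,
  treats the bounded, the logarithmic and the singular case at once. The upper bound holds because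
  the difference of its two sides decreases on (0, T] and is nonnegative at
  \<open>T\<close>.\<close>

lemma singular_kernel_profile:
  fixes \<nu> \<kappa> T :: real
  assumes "\<kappa> > 0" "\<kappa> \<ge> \<nu> - 1" "T > 0"
  obtains h :: "real \<Rightarrow> real" where
    "\<And>t. t > 0 \<Longrightarrow> (h has_real_derivative - (t powr (- \<nu>))) (at t)"
    "\<And>t. 0 < t \<Longrightarrow> t \<le> T \<Longrightarrow> 0 \<le> h t"
    "\<And>t. 0 < t \<Longrightarrow> t \<le> T \<Longrightarrow> h t \<le> T powr (\<kappa> + 1 - \<nu>) / \<kappa> * t powr (- \<kappa>)"
proof -
  define J where "J = (\<lambda>t::real. if \<nu> = 1 then ln t else t powr (1 - \<nu>) / (1 - \<nu>))"
  have J: "(J has_real_derivative t powr (- \<nu>)) (at t)" if "t > 0" for t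
  proof (cases "\<nu> = 1")
    case True
    then have "J = ln" by (simp add: J_def)
    then show ?thesis using that True by (auto intro!: derivative_eq_intros simp: powr_minus inverse_eq_divide)
  next
    case False
    then have "J = (\<lambda>t. t powr (1 - \<nu>) / (1 - \<nu>))" by (simp add: J_def)
    moreover have "((\<lambda>t. t powr (1 - \<nu>)) has_real_derivative (1 - \<nu>) * t powr (1 - \<nu> - 1)) (at t)"
      using that by (rule has_real_derivative_powr)
    then have "((\<lambda>t. t powr (1 - \<nu>) / (1 - \<nu>)) has_real_derivative (1 - \<nu>) * t powr (1 - \<nu> - 1) / (1 - \<nu>)) (at t)"
      by (rule DERIV_cdivide)
    ultimately show ?thesis using False by simp
  qed
  define h where "h = (\<lambda>t. J T - J t)"
  have h: "(h has_real_derivative - (t powr (- \<nu>))) (at t)" if "t > 0" for t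
    unfolding h_def using J[OF that] by (auto intro!: derivative_eq_intros)
  define C where "C = T powr (\<kappa> + 1 - \<nu>) / \<kappa>"
  show ?thesis
  proof (rule that[of h])
    fix t :: real assume t: "0 < t" "t \<le> T"
    have "h T \<le> h t"
    proof (rule DERIV_nonpos_imp_nonincreasing[OF t(2)])
      fix s assume "t \<le> s" "s \<le> T"
      then show "\<exists>y. DERIV h s :> y \<and> y \<le> 0" using h[of s] t(1) by (intro exI[of _ "- (s powr (- \<nu>))"]) auto
    qed
    then show "0 \<le> h t" by (simp add: h_def)
    let ?d = "\<lambda>t. C * t powr (- \<kappa>) - h t"
    have "?d T \<le> ?d t"
    proof (rule DERIV_nonpos_imp_nonincreasing[OF t(2)])
      fix s assume s: "t \<le> s" "s \<le> T"
      then have s0: "s > 0" using t(1) by linarith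
      have "((\<lambda>s. s powr (- \<kappa>)) has_real_derivative (- \<kappa>) * s powr (- \<kappa> - 1)) (at s)"
        using s0 by (rule has_real_derivative_powr)
      from DERIV_diff[OF DERIV_cmult[OF this] h[OF s0]]
      have "(?d has_real_derivative C * (- \<kappa> * s powr (- \<kappa> - 1)) - - (s powr (- \<nu>))) (at s)" .
      moreover have "s powr (- \<nu>) \<le> C * \<kappa> * s powr (- \<kappa> - 1)"
      proof -
        have "s powr (- \<nu>) = s powr (\<kappa> + 1 - \<nu>) * s powr (- \<kappa> - 1)" by (simp flip: powr_add)
        also have "\<dots> \<le> T powr (\<kappa> + 1 - \<nu>) * s powr (- \<kappa> - 1)"
          using s s0 assms by (intro mult_right_mono powr_mono2) auto
        finally show ?thesis using assms(1) by (simp add: C_def)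
      qed
      ultimately show "\<exists>y. DERIV ?d s :> y \<and> y \<le> 0" by (intro exI conjI) (assumption, simp add: algebra_simps)
    qed
    moreover have "?d T \<ge> 0" using assms by (simp add: h_def C_def)
    ultimately show "h t \<le> T powr (\<kappa> + 1 - \<nu>) / \<kappa> * t powr (- \<kappa>)" by (simp add: C_def)
  qed (rule h)
qed

section \<open>Integrals of inverse powers of the distance, uniformly in the regularisation\<close>

lemma set_integrable_compact:
  fixes f :: "'a::euclidean_space \<Rightarrow> real"
  assumes "compact K" "continuous_on K f"
  shows "set_integrable lborel K f"
  unfolding set_integrable_def using assms by (rule borel_integrable_compact)

text \<open>The divergence of \<open>\<zeta> t\<^bsup>-\<sigma>\<^esup> (x - x\<^sub>0)\<close>, with \<open>t = |x - x\<^sub>0|\<^sup>2 + \<epsilon>\<^sup>2\<close> and a radial cutoff \<open>\<zeta>\<close>, is at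
  least \<open>(n - 2\<sigma>) \<zeta> t\<^bsup>-\<sigma>\<^esup>\<close> up to a term with \<open>\<nabla>\<zeta>\<close>; this replaces polar coordinates.\<close>

lemma integral_inverse_power_bound:
  fixes \<sigma> R :: real
  assumes \<sigma>: "0 \<le> \<sigma>" "2 * \<sigma> < real DIM('a::euclidean_space)" and R: "R > 0"
  shows "\<exists>C\<ge>0. \<forall>(x0::'a) \<epsilon> K. \<epsilon> > 0 \<longrightarrow> compact K \<longrightarrow> K \<subseteq> cball x0 R \<longrightarrow>
    (LINT x:K|lborel. ((norm (x - x0))\<^sup>2 + \<epsilon>\<^sup>2) powr (- \<sigma>)) \<le> C"
proof -
  define d where "d = real DIM('a) - 2 * \<sigma>"
  have d: "d > 0" using \<sigma> by (simp add: d_def)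
  \<comment> \<open>The value of |x - x0|^2 at which the cutoff error 8 P |x - x0|^2 equals the gain
    d P^2, where P = 4 R^2 - |x - x0|^2.\<close>
  define q0 where "q0 = 4 * R\<^sup>2 / (1 + 8 / d)"
  have q0: "q0 > 0" using R d by (simp add: q0_def add_pos_pos)
  define C0 where "C0 = 128 * R ^ 4 * q0 powr (- \<sigma>)"
  have C0: "C0 \<ge> 0" by (simp add: C0_def)
  define C where "C = C0 * measure lborel (cball (0::'a) (2 * R)) / (9 * R ^ 4 * d)"
  show ?thesis
  proof (intro exI[of _ C] conjI allI impI)
    show "C \<ge> 0" using C0 d by (simp add: C_def)
    fix x0 :: 'a and \<epsilon> :: real and K
    assume \<epsilon>: "\<epsilon> > 0" and K: "compact K" "K \<subseteq> cball x0 R"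
    let ?q = "\<lambda>x. (norm (x - x0))\<^sup>2"
    let ?t = "\<lambda>x. ?q x + \<epsilon>\<^sup>2"
    let ?P = "\<lambda>x. max 0 (4 * R\<^sup>2 - ?q x)"
    let ?Kc = "cball x0 (2 * R)"
    have t: "?t x > 0" for x using \<epsilon> by (simp add: add_nonneg_pos)
    \<comment> \<open>The cutoff is the square of (4 R^2 - |x - x0|^2)_+, rewritten as a function of
      t alone; \<open>Suc 1\<close> matches the form of \<open>DERIV_pos_part_power\<close>.\<close>
    define f where "f = (\<lambda>t. max 0 (4 * R\<^sup>2 + \<epsilon>\<^sup>2 - t) ^ Suc 1 * t powr (- \<sigma>))"
    define f' where "f' = (\<lambda>t. (- 2 * max 0 (4 * R\<^sup>2 + \<epsilon>\<^sup>2 - t)) * t powr (- \<sigma>)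
        + max 0 (4 * R\<^sup>2 + \<epsilon>\<^sup>2 - t) ^ Suc 1 * (- \<sigma> * t powr (- \<sigma> - 1)))"
    have f': "(f has_real_derivative f' t) (at t)" if "t > 0" for t
    proof -
      have "((\<lambda>t. 4 * R\<^sup>2 + \<epsilon>\<^sup>2 - t) has_real_derivative - 1) (at t)" by (auto intro!: derivative_eq_intros)
      from DERIV_chain2[OF DERIV_pos_part_power[OF order_refl] this]
      have "((\<lambda>t. max 0 (4 * R\<^sup>2 + \<epsilon>\<^sup>2 - t) ^ Suc 1) has_real_derivative - 2 * max 0 (4 * R\<^sup>2 + \<epsilon>\<^sup>2 - t)) (at t)"
        by simp
      from DERIV_mult[OF this has_real_derivative_powr[OF that, of "- \<sigma>"]] show ?thesis
        unfolding f_def f'_def by (simp add: algebra_simps)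
    qed
    note sq = gradient_laplacian_on_shifted_square[of x0 "\<epsilon>\<^sup>2"]
    have "GDERIV (\<lambda>x. f (?t x)) x :> f' (?t x) *\<^sub>R (2 *\<^sub>R (x - x0))" for x
      by (rule GDERIV_DERIV_compose[OF gradient_laplacian_onD(1)[OF sq UNIV_I] f'[OF t]])
    moreover have "continuous_on UNIV (\<lambda>x. f' (?t x) *\<^sub>R (2 *\<^sub>R (x - x0)))"
      unfolding f'_def by (intro continuous_intros) (use \<epsilon> in auto)
    moreover have "f (?t x) = 0" if "x \<notin> ?Kc" for x
    proof -
      have "(2 * R)\<^sup>2 \<le> ?q x" using that R by (intro power_mono) (auto simp: dist_norm norm_minus_commute)
      then show ?thesis by (simp add: f_def power_mult_distrib)
    qed
    ultimately have green: "(LINT x:?Kc|lborel. (f' (?t x) *\<^sub>R (2 *\<^sub>R (x - x0))) \<bullet> (2 *\<^sub>R (x - x0))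
         + f (?t x) * (2 * real DIM('a))) = 0"
      by (intro green_laplacian[OF sq]) auto
    \<comment> \<open>Because |x - x0|^2 \<le> t, the bulk terms have total coefficient at least 2n
      - 4\<sigma> = 2d. Half of this is spent on the cutoff error, up to the constant
      \<open>C0\<close>.\<close>
    have pw: "d * ((?P x)\<^sup>2 * ?t x powr (- \<sigma>)) - C0
        \<le> (f' (?t x) *\<^sub>R (2 *\<^sub>R (x - x0))) \<bullet> (2 *\<^sub>R (x - x0)) + f (?t x) * (2 * real DIM('a))" for x
    proof -
      let ?s = "?t x powr (- \<sigma>)"
      have e1: "(f' (?t x) *\<^sub>R (2 *\<^sub>R (x - x0))) \<bullet> (2 *\<^sub>R (x - x0)) + f (?t x) * (2 * real DIM('a))
         = 2 * real DIM('a) * ((?P x)\<^sup>2 * ?s) - 8 * ?P x * ?q x * ?s - 4 * \<sigma> * (?P x)\<^sup>2 * (?q x * ?t x powr (- \<sigma> - 1))"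
        by (simp add: f_def f'_def power2_eq_square flip: power2_norm_eq_inner) (simp add: algebra_simps power2_eq_square)
      have "?q x * ?t x powr (- \<sigma> - 1) \<le> ?t x * ?t x powr (- \<sigma> - 1)"
        by (intro mult_right_mono) auto
      also have "\<dots> = ?s" using t[of x] by (simp add: powr_diff)
      finally have "4 * \<sigma> * (?P x)\<^sup>2 * (?q x * ?t x powr (- \<sigma> - 1)) \<le> 4 * \<sigma> * (?P x)\<^sup>2 * ?s"
        using \<sigma> by (intro mult_left_mono) auto
      \<comment> \<open>Close to the pole the error is absorbed directly; where this fails, |x -
        x0|^2 \<ge> \<open>q0\<close> keeps t^(-\<sigma>) bounded.\<close>
      moreover have "8 * ?P x * ?q x * ?s \<le> d * ((?P x)\<^sup>2 * ?s) + C0"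
      proof (cases "8 * ?q x \<le> d * ?P x")
        case True
        then have "(8 * ?q x) * (?P x * ?s) \<le> (d * ?P x) * (?P x * ?s)" by (intro mult_right_mono) auto
        then show ?thesis using C0 by (simp add: power2_eq_square algebra_simps)
      next
        case False
        show ?thesis
        proof (cases "4 * R\<^sup>2 \<le> ?q x")
          case True then show ?thesis using C0 by simp
        next
          case F2: False
          then have P: "?P x = 4 * R\<^sup>2 - ?q x" by simp
          have "4 * R\<^sup>2 * d < ?q x * (d + 8)" using False unfolding P by (simp add: algebra_simps)
          then have "q0 \<le> ?q x" using d by (simp add: q0_def field_simps)
          then have "q0 \<le> ?t x" by (simp add: add_increasing2)
          then have s: "?s \<le> q0 powr (- \<sigma>)" using q0 \<sigma> by (intro powr_mono2') auto
          have "8 * ?P x * ?q x * ?s \<le> 8 * (4 * R\<^sup>2) * (4 * R\<^sup>2) * q0 powr (- \<sigma>)"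
            using F2 by (intro mult_mono s) (auto simp: P)
          also have "\<dots> = C0" by (simp add: C0_def power2_eq_square power4_eq_xxxx)
          finally show ?thesis using d by (simp add: add_increasing)
        qed
      qed
      ultimately show ?thesis unfolding e1 d_def by (simp add: algebra_simps)
    qed
    have c1: "continuous_on S (\<lambda>x. (?P x)\<^sup>2 * ?t x powr (- \<sigma>))" for S
      by (intro continuous_intros) (use \<epsilon> in auto)
    note c1' = set_integrable_compact[OF compact_cball c1]
    have cf: "continuous_on ?Kc (\<lambda>x. (f' (?t x) *\<^sub>R (2 *\<^sub>R (x - x0))) \<bullet> (2 *\<^sub>R (x - x0)) + f (?t x) * (2 * real DIM('a)))"
      unfolding f_def f'_def by (intro continuous_intros) (use \<epsilon> in auto)
    let ?I = "LINT x:?Kc|lborel. (?P x)\<^sup>2 * ?t x powr (- \<sigma>)"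
    have "(LINT x:?Kc|lborel. d * ((?P x)\<^sup>2 * ?t x powr (- \<sigma>)) - C0)
      \<le> (LINT x:?Kc|lborel. (f' (?t x) *\<^sub>R (2 *\<^sub>R (x - x0))) \<bullet> (2 *\<^sub>R (x - x0)) + f (?t x) * (2 * real DIM('a)))"
    proof (rule set_integral_mono[OF _ _ pw])
      show "set_integrable lborel ?Kc (\<lambda>x. d * ((?P x)\<^sup>2 * ?t x powr (- \<sigma>)) - C0)"
        by (intro set_integrable_compact compact_cball continuous_on_diff
          continuous_on_mult[OF continuous_on_const c1] continuous_on_const)
    qed (intro set_integrable_compact compact_cball cf)
    also note green
    finally have "(LINT x:?Kc|lborel. d * ((?P x)\<^sup>2 * ?t x powr (- \<sigma>)) - C0) \<le> 0" .
    moreover have "(LINT x:?Kc|lborel. d * ((?P x)\<^sup>2 * ?t x powr (- \<sigma>)) - C0)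
       = d * ?I - C0 * measure lborel ?Kc"
    proof -
      have cc: "set_integrable lborel ?Kc (\<lambda>x. C0)" "(LINT x:?Kc|lborel. C0) = C0 * measure lborel ?Kc"
        by (auto intro!: set_integrable_compact simp: set_lebesgue_integral_def mult.commute)
      have "set_integrable lborel ?Kc (\<lambda>x. d * ((?P x)\<^sup>2 * ?t x powr (- \<sigma>)))"
        using c1' by simp
      from set_integral_diff(2)[OF this cc(1)] show ?thesis using cc(2) by simp
    qed
    moreover have "measure lborel ?Kc = measure lborel (cball (0::'a) (2 * R))"
      using R content_ball_conv_unit_ball[of "2 * R" x0] content_ball_conv_unit_ball[of "2 * R" "0::'a"]
      by (simp add: content_cball_conv_ball)
    ultimately have I: "?I \<le> C0 * measure lborel (cball (0::'a) (2 * R)) / d"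
      using d by (simp add: field_simps)
    \<comment> \<open>\<open>K\<close> reaches only to radius \<open>R\<close>, half the cutoff
      radius, so \<open>?P\<close> is at least 3 R^2 there; this is the source of 9 R^4.\<close>
    have "(LINT x:K|lborel. ?t x powr (- \<sigma>)) \<le> (LINT x:?Kc|lborel. (1 / (9 * R ^ 4)) * ((?P x)\<^sup>2 * ?t x powr (- \<sigma>)))"
      unfolding set_lebesgue_integral_def
    proof (rule integral_mono)
      show "integrable lborel (\<lambda>x. indicator K x *\<^sub>R ?t x powr (- \<sigma>))"
        by (intro borel_integrable_compact K continuous_intros) (use \<epsilon> in auto)
      show "integrable lborel (\<lambda>x. indicator ?Kc x *\<^sub>R ((1 / (9 * R ^ 4)) * ((?P x)\<^sup>2 * ?t x powr (- \<sigma>))))"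
        by (intro borel_integrable_compact compact_cball continuous_on_mult continuous_on_const c1)
      show "indicator K x *\<^sub>R ?t x powr (- \<sigma>) \<le> indicator ?Kc x *\<^sub>R ((1 / (9 * R ^ 4)) * ((?P x)\<^sup>2 * ?t x powr (- \<sigma>)))" for x
      proof (cases "x \<in> K")
        case True
        then have n: "norm (x - x0) \<le> R" using K by (auto simp: dist_norm norm_minus_commute)
        then have "x \<in> ?Kc" using R by (simp add: dist_norm norm_minus_commute)
        have "?q x \<le> R\<^sup>2" using n by (intro power_mono) auto
        then have "3 * R\<^sup>2 \<le> ?P x" by simp
        then have "(3 * R\<^sup>2)\<^sup>2 \<le> (?P x)\<^sup>2" by (intro power_mono) auto
        then have "9 * R ^ 4 \<le> (?P x)\<^sup>2" by (simp add: power_mult_distrib flip: power_mult)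
        then have "1 \<le> (1 / (9 * R ^ 4)) * (?P x)\<^sup>2" using R by (simp add: field_simps)
        from mult_right_mono[OF this, of "?t x powr (- \<sigma>)"] show ?thesis
          using True \<open>x \<in> ?Kc\<close> by (simp add: mult.assoc)
      qed auto
    qed
    also have "\<dots> = (1 / (9 * R ^ 4)) * ?I" by simp
    also have "\<dots> \<le> (1 / (9 * R ^ 4)) * (C0 * measure lborel (cball (0::'a) (2 * R)) / d)"
      by (intro mult_left_mono I) simp
    also have "\<dots> = C" by (simp add: C_def)
    finally show "(LINT x:K|lborel. ?t x powr (- \<sigma>)) \<le> C" .
  qed
qed

text \<open>Young's inequality without sharp constants: if b \<le> a^(1/(p-1)), the product is at
  most the first power on the right, otherwise at most the second.\<close>

lemma mult_le_sum_powr: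
  fixes a b p :: real
  assumes "a \<ge> 0" "b \<ge> 0" "p > 1"
  shows "a * b \<le> a powr (p / (p - 1)) + b powr p"
proof (cases "a = 0 \<or> b = 0")
  case False
  then have ab: "a > 0" "b > 0" using assms by auto
  show ?thesis
  proof (cases "b \<le> a powr (1 / (p - 1))")
    case True
    have "a * b \<le> a * a powr (1 / (p - 1))" using True ab by (intro mult_left_mono) auto
    also have "\<dots> = a powr (1 + 1 / (p - 1))" using ab by (simp add: powr_add)
    also have "1 + 1 / (p - 1) = p / (p - 1)" using assms(3) by (simp add: field_simps)
    finally show ?thesis by (simp add: add_increasing2)
  next
    case F: False
    have "a = (a powr (1 / (p - 1))) powr (p - 1)" using assms(3) ab by (simp add: powr_powr)
    also have "\<dots> \<le> b powr (p - 1)" using F assms(3) by (intro powr_mono2) auto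
    finally have "a * b \<le> b powr (p - 1) * b" using ab by (intro mult_right_mono) auto
    also have "\<dots> = b powr p" using ab by (simp add: powr_diff)
    finally show ?thesis by (simp add: add_increasing)
  qed
qed (use assms in auto)

text \<open>The kernel \<open>k = h(|x - x\<^sub>0|\<^sup>2 + \<epsilon>\<^sup>2)\<close> with \<open>h' = - t\<^bsup>-n/2\<^esup>\<close> is a regularised Newtonian potential:
  \<open>- \<Delta>k = 2n \<epsilon>\<^sup>2 t\<^bsup>-n/2-1\<^esup>\<close> is nonnegative and has mass bounded below on the ball of radius \<open>\<epsilon>\<close>.\<close>

lemma subsolution_sup_bound:
  fixes p R :: real
  assumes p: "p > 1" "2 * p > real DIM('a::euclidean_space)" and R: "R > 0"
  shows "\<exists>C\<ge>0. \<forall>(\<Omega>::'a set) K w G L F Y x0. open \<Omega> \<longrightarrow> compact K \<longrightarrow> K \<subseteq> \<Omega> \<longrightarrow> K \<subseteq> cball x0 R \<longrightarrow>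
    gradient_laplacian_on \<Omega> w G L \<longrightarrow> (\<forall>x\<in>\<Omega>. w x \<ge> 0) \<longrightarrow> (\<forall>x\<in>\<Omega> - K. w x = 0 \<and> G x = 0) \<longrightarrow>
    (\<forall>x\<in>K. - L x \<le> F x \<and> F x > 0) \<longrightarrow> continuous_on K F \<longrightarrow> Y > 0 \<longrightarrow> x0 \<in> \<Omega> \<longrightarrow>
    w x0 \<le> C * Y * (1 + Y powr (- p) * (LINT x:K|lborel. F x powr p))"
proof -
  define n where "n = real DIM('a)"
  have n: "n > 0" by (simp add: n_def)
  define \<nu> where "\<nu> = n / 2"
  define q where "q = p / (p - 1)"
  have q: "q > 1" using p by (simp add: q_def field_simps)
  have \<nu>: "\<nu> > 0" using n by (simp add: \<nu>_def)
  have \<nu>q: "\<nu> / q = \<nu> - \<nu> / p" using p by (simp add: q_def field_simps)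
  have \<nu>p: "\<nu> / p < 1" using p by (simp add: \<nu>_def n_def field_simps)
  have \<nu>q0: "\<nu> / q > 0" using \<nu> q by simp
  have "\<nu> - 1 < \<nu> / q" using \<nu>q \<nu>p by linarith
  \<comment> \<open>This window for \<kappa> is where 2p > n enters: \<kappa> \<ge> \<nu> - 1 lets
    t^(-\<kappa>) dominate the kernel, and \<kappa> q < \<nu> makes the q-th power integrable
    uniformly in \<epsilon>.\<close>
  then have "max (\<nu> - 1) 0 < \<nu> / q" using \<nu>q0 by simp
  then obtain \<kappa> where "max (\<nu> - 1) 0 < \<kappa>" and \<kappa>3: "\<kappa> < \<nu> / q" using dense by blast
  then have \<kappa>: "\<kappa> > 0" "\<kappa> \<ge> \<nu> - 1" "\<kappa> < \<nu> / q" by simp_all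
  have \<kappa>q: "2 * (\<kappa> * q) < n" using \<kappa>(3) q by (simp add: \<nu>_def field_simps)
  define T where "T = R\<^sup>2 + 1"
  have T: "T > 0" by (simp add: T_def add_nonneg_pos)
  obtain h :: "real \<Rightarrow> real" where h: "\<And>t. t > 0 \<Longrightarrow> (h has_real_derivative - (t powr (- \<nu>))) (at t)"
    and h0: "\<And>t. 0 < t \<Longrightarrow> t \<le> T \<Longrightarrow> 0 \<le> h t"
    and hle: "\<And>t. 0 < t \<Longrightarrow> t \<le> T \<Longrightarrow> h t \<le> T powr (\<kappa> + 1 - \<nu>) / \<kappa> * t powr (- \<kappa>)"
    using singular_kernel_profile[OF \<kappa>(1,2) T] by blast
  define Ch where "Ch = T powr (\<kappa> + 1 - \<nu>) / \<kappa>"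
  have Ch: "Ch \<ge> 0" using \<kappa> by (simp add: Ch_def)
  have "0 \<le> \<kappa> * q" "2 * (\<kappa> * q) < real DIM('a)" using \<kappa> q \<kappa>q by (auto simp: n_def)
  from integral_inverse_power_bound[OF this R] obtain C5 where C5: "C5 \<ge> 0"
    "\<And>(x0::'a) \<epsilon> K. \<epsilon> > 0 \<Longrightarrow> compact K \<Longrightarrow> K \<subseteq> cball x0 R \<Longrightarrow>
      (LINT x:K|lborel. ((norm (x - x0))\<^sup>2 + \<epsilon>\<^sup>2) powr (- (\<kappa> * q))) \<le> C5" by blast
  define \<beta> where "\<beta> = measure lborel (ball (0::'a) 1)"
  have \<beta>: "\<beta> > 0" unfolding \<beta>_def by (rule content_ball_pos) simp
  \<comment> \<open>\<open>w x0 * c\<close> will be half of \<open>w x0\<close> times a lower bound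
    for the mass of -\<Delta>k on the ball of radius \<epsilon>; all powers of \<epsilon>
    cancel.\<close>
  define c where "c = n * 2 powr (- \<nu> - 1) * \<beta>"
  have c: "c > 0" using n \<beta> by (simp add: c_def)
  define C where "C = (Ch powr q * C5 + 1) / c"
  have C: "C \<ge> 0" using c C5(1) by (simp add: C_def)
  show ?thesis
  proof (intro exI[of _ C] conjI C allI impI)
    fix \<Omega> K :: "'a set" and w L F :: "'a \<Rightarrow> real" and G :: "'a \<Rightarrow> 'a" and Y :: real and x0 :: 'a
    assume \<Omega>: "open \<Omega>" and K: "compact K" "K \<subseteq> \<Omega>" "K \<subseteq> cball x0 R"
      and w: "gradient_laplacian_on \<Omega> w G L" and w0: "\<forall>x\<in>\<Omega>. w x \<ge> 0"
      and supp: "\<forall>x\<in>\<Omega> - K. w x = 0 \<and> G x = 0" and LF: "\<forall>x\<in>K. - L x \<le> F x \<and> F x > 0"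
      and cF: "continuous_on K F" and Y: "Y > 0" and x0: "x0 \<in> \<Omega>"
    note wD = gradient_laplacian_onD[OF w]
    let ?S = "LINT x:K|lborel. F x powr p"
    have S0: "?S \<ge> 0" unfolding set_lebesgue_integral_def by (intro integral_nonneg_AE AE_I2) simp
    show "w x0 \<le> C * Y * (1 + Y powr (- p) * ?S)"
    proof (cases "w x0 = 0")
      case True
      then show ?thesis using C Y S0 by simp
    next
      case False
      then have wpos: "w x0 > 0" using w0 x0 by force
      have "isCont w x0" using wD(2) \<Omega> x0 by (simp add: continuous_on_eq_continuous_at)
      then obtain \<epsilon>1 where \<epsilon>1: "\<epsilon>1 > 0" "\<And>x. dist x x0 < \<epsilon>1 \<Longrightarrow> dist (w x) (w x0) < w x0 / 2"
        using wpos unfolding continuous_within_eps_delta by (meson UNIV_I half_gt_zero)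
      obtain \<epsilon>2 where \<epsilon>2: "\<epsilon>2 > 0" "ball x0 \<epsilon>2 \<subseteq> \<Omega>" using \<Omega> x0 open_contains_ball by blast
      \<comment> \<open>\<epsilon> may depend on \<open>w\<close> and \<open>x0\<close>, because
        neither \<open>c\<close> nor \<open>C5\<close> involves it; \<epsilon> \<le> 1 keeps t below
        \<open>T\<close> on \<open>K\<close>.\<close>
      define \<epsilon> where "\<epsilon> = min 1 (min \<epsilon>1 \<epsilon>2)"
      have \<epsilon>: "\<epsilon> > 0" "\<epsilon> \<le> 1" "\<epsilon> \<le> \<epsilon>1" "\<epsilon> \<le> \<epsilon>2" using \<epsilon>1(1) \<epsilon>2(1) by (auto simp: \<epsilon>_def)
      have wb: "w x \<ge> w x0 / 2" if "x \<in> ball x0 \<epsilon>" for x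
      proof -
        have "dist (w x) (w x0) < w x0 / 2" using that \<epsilon> by (intro \<epsilon>1(2)) (simp add: dist_commute)
        then show ?thesis unfolding dist_real_def by linarith
      qed
      have bK: "ball x0 \<epsilon> \<subseteq> K"
      proof
        fix x assume x: "x \<in> ball x0 \<epsilon>"
        then have "x \<in> \<Omega>" using \<epsilon>2(2) \<epsilon>(4) by auto
        then show "x \<in> K" using wb[OF x] wpos supp by force
      qed
      let ?t = "\<lambda>x. (norm (x - x0))\<^sup>2 + \<epsilon>\<^sup>2"
      have t: "?t x > 0" for x using \<epsilon>(1) by (simp add: add_nonneg_pos)
      have tT: "?t x \<le> T" if "x \<in> K" for x
      proof -
        have "(norm (x - x0))\<^sup>2 \<le> R\<^sup>2" using K(3) that by (intro power_mono) (auto simp: dist_norm norm_minus_commute)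
        moreover have "\<epsilon>\<^sup>2 \<le> 1" using \<epsilon> by (simp add: power_le_one)
        ultimately show ?thesis by (simp add: T_def)
      qed
      let ?k = "\<lambda>x. h (?t x)"
      let ?Gk = "\<lambda>x. (- (?t x powr (- \<nu>))) *\<^sub>R (2 *\<^sub>R (x - x0))"
      let ?D = "\<lambda>x. - (2 * n * \<epsilon>\<^sup>2 * ?t x powr (- \<nu> - 1))"
      have "gradient_laplacian_on UNIV ?k ?Gk
         (\<lambda>x. (\<nu> * ?t x powr (- \<nu> - 1)) * (norm (2 *\<^sub>R (x - x0)))\<^sup>2 + (- (?t x powr (- \<nu>))) * (2 * real DIM('a)))"
      proof (rule gradient_laplacian_on_compose[OF gradient_laplacian_on_shifted_square])
        show "(h has_real_derivative - (?t x powr (- \<nu>))) (at (?t x))" for x by (rule h[OF t])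
        show "((\<lambda>t. - (t powr (- \<nu>))) has_real_derivative \<nu> * ?t x powr (- \<nu> - 1)) (at (?t x))" for x
          using DERIV_minus[OF has_real_derivative_powr[OF t, of "- \<nu>"]] by simp
        show "continuous_on UNIV (\<lambda>x. \<nu> * ?t x powr (- \<nu> - 1))"
          by (intro continuous_intros) (use \<epsilon>(1) in auto)
      qed
      \<comment> \<open>The exponent \<nu> = n/2 cancels the terms in |x - x0|^2: 4\<nu> |x - x0|^2
        - 2n t = -2n \<epsilon>^2.\<close>
      moreover have "(\<nu> * ?t x powr (- \<nu> - 1)) * (norm (2 *\<^sub>R (x - x0)))\<^sup>2 + (- (?t x powr (- \<nu>))) * (2 * real DIM('a)) = ?D x" for x
      proof -
        have "?t x powr (- \<nu>) = ?t x * ?t x powr (- \<nu> - 1)" using t[of x] by (simp add: powr_diff)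
        then have "(\<nu> * ?t x powr (- \<nu> - 1)) * (norm (2 *\<^sub>R (x - x0)))\<^sup>2 + (- (?t x powr (- \<nu>))) * (2 * real DIM('a))
          = (\<nu> * ?t x powr (- \<nu> - 1)) * (4 * (norm (x - x0))\<^sup>2) - (?t x * ?t x powr (- \<nu> - 1)) * (2 * n)"
          by (simp add: n_def power_mult_distrib)
        also have "\<dots> = ?D x" by (simp add: \<nu>_def algebra_simps)
        finally show ?thesis .
      qed
      ultimately have kUNIV: "gradient_laplacian_on UNIV ?k ?Gk ?D" by simp
      note k = gradient_laplacian_on_subset[OF kUNIV subset_UNIV, of \<Omega>]
      note kD = gradient_laplacian_onD[OF k]
      \<comment> \<open>Two Green identities with the support condition in different factors: here
        \<open>G\<close> vanishes off \<open>K\<close>, in the next one \<open>w\<close> does.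
        Subtracting them moves the Laplacian from \<open>w\<close> to the kernel.\<close>
      have g1: "(LINT x:K|lborel. ?Gk x \<bullet> G x + ?k x * L x) = 0"
        using supp by (intro green_laplacian[OF w \<Omega> K(1,2) kD(1,3)]) auto
      have g2: "(LINT x:K|lborel. G x \<bullet> ?Gk x + w x * ?D x) = 0"
        using supp by (intro green_laplacian[OF k \<Omega> K(1,2) wD(1,3)]) auto
      have iK: "set_integrable lborel K f" if "continuous_on \<Omega> f" for f :: "'a \<Rightarrow> real"
        by (rule set_integrable_compact[OF K(1) continuous_on_subset[OF that K(2)]])
      have cfs: "continuous_on \<Omega> (\<lambda>x. ?Gk x \<bullet> G x)" "continuous_on \<Omega> (\<lambda>x. ?k x * L x)" "continuous_on \<Omega> (\<lambda>x. w x * ?D x)"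
        by (intro continuous_on_inner continuous_on_mult kD(2-4) wD(2-4))+
      have "(LINT x:K|lborel. ?Gk x \<bullet> G x) + (LINT x:K|lborel. ?k x * L x) = 0"
        using g1 set_integral_add(2)[OF iK[OF cfs(1)] iK[OF cfs(2)]] by simp
      moreover have "(LINT x:K|lborel. ?Gk x \<bullet> G x) + (LINT x:K|lborel. w x * ?D x) = 0"
        using g2 set_integral_add(2)[OF iK[OF cfs(1)] iK[OF cfs(3)]] by (simp add: inner_commute)
      ultimately have eq: "(LINT x:K|lborel. ?k x * L x) = (LINT x:K|lborel. w x * ?D x)" by simp
      let ?l = "(w x0 / 2) * (2 * n * \<epsilon>\<^sup>2 * (2 * \<epsilon>\<^sup>2) powr (- \<nu> - 1))"
      have l: "?l * measure lborel (ball x0 \<epsilon>) = w x0 * c"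
      proof -
        have "measure lborel (ball x0 \<epsilon>) = \<epsilon> ^ DIM('a) * \<beta>"
          using content_ball_conv_unit_ball[of \<epsilon> x0] \<epsilon> by (simp add: \<beta>_def)
        moreover have "\<epsilon> ^ DIM('a) = \<epsilon> powr n" using \<epsilon> by (simp add: n_def powr_realpow)
        moreover have "(2 * \<epsilon>\<^sup>2) powr (- \<nu> - 1) = 2 powr (- \<nu> - 1) * \<epsilon> powr (- n - 2)"
        proof -
          have "\<epsilon>\<^sup>2 = \<epsilon> powr 2" using \<epsilon> by simp
          then have "(\<epsilon>\<^sup>2) powr (- \<nu> - 1) = \<epsilon> powr (2 * (- \<nu> - 1))" by (simp only: powr_powr)
          also have "2 * (- \<nu> - 1) = - n - 2" by (simp add: \<nu>_def)
          finally show ?thesis by (simp add: powr_mult)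
        qed
        moreover have "\<epsilon>\<^sup>2 * \<epsilon> powr (- n - 2) * \<epsilon> powr n = 1"
        proof -
          have "\<epsilon>\<^sup>2 = \<epsilon> powr 2" using \<epsilon> by simp
          then have "\<epsilon>\<^sup>2 * \<epsilon> powr (- n - 2) * \<epsilon> powr n = \<epsilon> powr (2 + (- n - 2) + n)" by (simp only: powr_add)
          then show ?thesis using \<epsilon> by simp
        qed
        ultimately have "?l * measure lborel (ball x0 \<epsilon>) = w x0 * (n * 2 powr (- \<nu> - 1) * \<beta>) * (\<epsilon>\<^sup>2 * \<epsilon> powr (- n - 2) * \<epsilon> powr n)"
          by simp
        then show ?thesis using \<open>\<epsilon>\<^sup>2 * \<epsilon> powr (- n - 2) * \<epsilon> powr n = 1\<close> by (simp add: c_def)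
      qed
      have "w x0 * c = (LINT x|lborel. indicator (ball x0 \<epsilon>) x * ?l)"
        unfolding l[symmetric] by (simp add: mult.commute)
      also have "\<dots> \<le> (LINT x:K|lborel. - (w x * ?D x))" unfolding set_lebesgue_integral_def
      proof (rule integral_mono)
        have "emeasure lborel (ball x0 \<epsilon>) < \<infinity>" by (rule emeasure_bounded_finite) simp
        then show "integrable lborel (\<lambda>x. indicator (ball x0 \<epsilon>) x * ?l)"
          by (intro integrable_mult_left integrable_real_indicator) auto
        show "integrable lborel (\<lambda>x. indicator K x *\<^sub>R - (w x * ?D x))"
          using iK[OF continuous_on_minus[OF cfs(3)]] by (simp add: set_integrable_def)
        show "indicator (ball x0 \<epsilon>) x * ?l \<le> indicator K x *\<^sub>R - (w x * ?D x)" for x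
        proof (cases "x \<in> ball x0 \<epsilon>")
          case True
          then have "norm (x - x0) \<le> \<epsilon>" by (simp add: dist_norm norm_minus_commute)
          then have "(norm (x - x0))\<^sup>2 \<le> \<epsilon>\<^sup>2" by (intro power_mono) auto
          then have "?t x \<le> 2 * \<epsilon>\<^sup>2" by simp
          then have "(2 * \<epsilon>\<^sup>2) powr (- \<nu> - 1) \<le> ?t x powr (- \<nu> - 1)" using t[of x] \<nu> by (intro powr_mono2') auto
          then have A: "2 * n * \<epsilon>\<^sup>2 * (2 * \<epsilon>\<^sup>2) powr (- \<nu> - 1) \<le> 2 * n * \<epsilon>\<^sup>2 * ?t x powr (- \<nu> - 1)"
            using n by (intro mult_left_mono) auto
          have "?l \<le> w x * (2 * n * \<epsilon>\<^sup>2 * ?t x powr (- \<nu> - 1))"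
            using wb[OF True] wpos n by (intro mult_mono A) auto
          then show ?thesis using True bK by (simp add: subset_iff)
        next
          case False
          have "0 \<le> w x * (2 * n * \<epsilon>\<^sup>2 * ?t x powr (- \<nu> - 1))" if "x \<in> K"
            using w0 K(2) that n by (intro mult_nonneg_nonneg) auto
          then show ?thesis using False by (cases "x \<in> K") auto
        qed
      qed
      also have "\<dots> = (LINT x:K|lborel. - (?k x * L x))"
        using eq by (simp add: set_lebesgue_integral_def)
      \<comment> \<open>Young's inequality for the kernel and F/Y. The weight \<open>Y\<close> stays
        free and is chosen when the estimate is applied.\<close>
      also have "\<dots> \<le> (LINT x:K|lborel. Y * (Ch powr q * ?t x powr (- (\<kappa> * q)) + Y powr (- p) * F x powr p))"
      proof (rule set_integral_mono)
        show "set_integrable lborel K (\<lambda>x. - (?k x * L x))" by (rule iK[OF continuous_on_minus[OF cfs(2)]])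
        show "set_integrable lborel K (\<lambda>x. Y * (Ch powr q * ?t x powr (- (\<kappa> * q)) + Y powr (- p) * F x powr p))"
          using LF \<epsilon>(1) by (intro set_integrable_compact K(1) continuous_intros cF) force+
        fix x assume x: "x \<in> K"
        have k0: "?k x \<ge> 0" using h0[OF t tT[OF x]] .
        have kle: "?k x \<le> Ch * ?t x powr (- \<kappa>)" using hle[OF t tT[OF x]] by (simp add: Ch_def)
        have F0: "F x > 0" and LFx: "- L x \<le> F x" using LF x by auto
        have "- (?k x * L x) \<le> ?k x * F x" using mult_left_mono[OF LFx k0] by simp
        also have "\<dots> = Y * (?k x * (F x / Y))" using Y by simp
        also have "\<dots> \<le> Y * (?k x powr q + (F x / Y) powr p)"
          unfolding q_def using k0 F0 Y p by (intro mult_left_mono mult_le_sum_powr) auto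
        also have "\<dots> \<le> Y * (Ch powr q * ?t x powr (- (\<kappa> * q)) + Y powr (- p) * F x powr p)"
        proof (intro mult_left_mono add_mono)
          have "?k x powr q \<le> (Ch * ?t x powr (- \<kappa>)) powr q" using k0 kle q by (intro powr_mono2) auto
          also have "\<dots> = Ch powr q * ?t x powr (- (\<kappa> * q))" using Ch by (simp add: powr_mult powr_powr)
          finally show "?k x powr q \<le> Ch powr q * ?t x powr (- (\<kappa> * q))" .
          show "(F x / Y) powr p \<le> Y powr (- p) * F x powr p"
            using F0 Y by (simp add: powr_divide powr_minus field_simps)
        qed (use Y in auto)
        finally show "- (?k x * L x) \<le> Y * (Ch powr q * ?t x powr (- (\<kappa> * q)) + Y powr (- p) * F x powr p)" .
      qed
      also have "\<dots> = Y * (Ch powr q * (LINT x:K|lborel. ?t x powr (- (\<kappa> * q))) + Y powr (- p) * ?S)"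
      proof -
        have 1: "set_integrable lborel K (\<lambda>x. ?t x powr (- (\<kappa> * q)))"
          using \<epsilon>(1) by (intro set_integrable_compact K(1) continuous_intros) auto
        have 2: "set_integrable lborel K (\<lambda>x. F x powr p)"
          using LF by (intro set_integrable_compact K(1) continuous_intros cF) force+
        from set_integral_add(2)[OF set_integrable_mult_right[OF 1] set_integrable_mult_right[OF 2], of "Ch powr q" "Y powr (- p)"]
        show ?thesis by simp
      qed
      also have "\<dots> \<le> Y * (Ch powr q * C5 + Y powr (- p) * ?S)"
        using Y by (intro mult_left_mono add_mono C5(2) \<epsilon>(1) K) auto
      also have "\<dots> \<le> Y * ((Ch powr q * C5 + 1) * (1 + Y powr (- p) * ?S))"
      proof (intro mult_left_mono)
        have "0 \<le> Ch powr q * C5 * (Y powr (- p) * ?S)" using C5(1) S0 by (intro mult_nonneg_nonneg) auto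
        then show "Ch powr q * C5 + Y powr (- p) * ?S \<le> (Ch powr q * C5 + 1) * (1 + Y powr (- p) * ?S)"
          by (simp add: algebra_simps)
      qed (use Y in simp)
      finally have "w x0 * c \<le> Y * ((Ch powr q * C5 + 1) * (1 + Y powr (- p) * ?S))" .
      then have "w x0 \<le> Y * ((Ch powr q * C5 + 1) * (1 + Y powr (- p) * ?S)) / c"
        using c by (simp add: pos_le_divide_eq)
      then show ?thesis by (simp add: C_def mult_ac)
    qed
  qed
qed

section \<open>Mollification\<close>

text \<open>For m = 0 the classical flat function e^(-1/s). The powers of 1/s make the family closed
  under differentiation up to linear combinations.\<close>

definition flat_exp :: "nat \<Rightarrow> real \<Rightarrow> real" where
  "flat_exp m s = (if s > 0 then (1 / s) ^ m * exp (- 1 / s) else 0)"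

lemma flat_exp_nonneg: "flat_exp m s \<ge> 0"
  by (simp add: flat_exp_def)

text \<open>The k-th power of x/k \<le> exp (x/k).\<close>

lemma power_times_exp_minus_le: "x ^ k * exp (- x) \<le> real k ^ k" if "x \<ge> 0" for x :: real
proof (cases "k = 0")
  case False
  have "x / real k \<le> exp (x / real k)" using exp_ge_add_one_self[of "x / real k"] by linarith
  then have "(x / real k) ^ k \<le> exp (x / real k) ^ k"
    using that by (intro power_mono) auto
  also have "\<dots> = exp x" using False by (simp flip: exp_of_nat_mult)
  finally have "x ^ k \<le> real k ^ k * exp x" using False by (simp add: power_divide field_simps)
  then show ?thesis by (simp add: exp_minus field_simps)
qed (use that in simp)

text \<open>Apply \<open>power_times_exp_minus_le\<close> at 1/s with exponent m + 2; the spare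
  factor s^2 yields derivative 0 at the origin.\<close>

lemma flat_exp_le: "flat_exp m s \<le> real (m + 2) ^ (m + 2) * s\<^sup>2"
proof (cases "s > 0")
  case True
  have "(1 / s) ^ (m + 2) * exp (- (1 / s)) \<le> real (m + 2) ^ (m + 2)"
    using True by (intro power_times_exp_minus_le) auto
  then have "(1 / s) ^ (m + 2) * exp (- (1 / s)) * s\<^sup>2 \<le> real (m + 2) ^ (m + 2) * s\<^sup>2"
    by (rule mult_right_mono) auto
  moreover have "(1 / s) ^ (m + 2) * exp (- (1 / s)) * s\<^sup>2 = flat_exp m s"
    using True by (simp add: flat_exp_def power_add power_divide power2_eq_square)
  ultimately show ?thesis by linarith
qed (simp add: flat_exp_def)

lemma DERIV_flat_exp:
  "(flat_exp m has_real_derivative flat_exp (m + 2) s - real m * flat_exp (m + 1) s) (at s)"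
proof -
  consider "s > 0" | "s < 0" | "s = 0" by linarith
  then show ?thesis
  proof cases
    case 1
    have "((\<lambda>s. (1 / s) ^ m * exp (- 1 / s)) has_real_derivative
        flat_exp (m + 2) s - real m * flat_exp (m + 1) s) (at s)"
    proof -
      have "((\<lambda>s. (1 / s) ^ m * exp (- 1 / s)) has_real_derivative
          real m * (1 / s) ^ (m - 1) * (- 1 / s\<^sup>2) * exp (- 1 / s) + (1 / s) ^ m * (exp (- 1 / s) * (1 / s\<^sup>2))) (at s)"
        using 1 by (auto intro!: derivative_eq_intros simp: power2_eq_square)
      moreover have "real m * (1 / s) ^ (m - 1) * (- 1 / s\<^sup>2) * exp (- 1 / s) + (1 / s) ^ m * (exp (- 1 / s) * (1 / s\<^sup>2))
          = flat_exp (m + 2) s - real m * flat_exp (m + 1) s"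
        using 1 by (cases m) (simp_all add: flat_exp_def field_simps power2_eq_square)
      ultimately show ?thesis by simp
    qed
    moreover have "open {0::real<..}" "s \<in> {0<..}" using 1 by auto
    ultimately show ?thesis
      by (rule has_field_derivative_transform_within_open) (simp add: flat_exp_def)
  next
    case 2
    have "((\<lambda>s. 0) has_real_derivative flat_exp (m + 2) s - real m * flat_exp (m + 1) s) (at s)"
      using 2 by (simp add: flat_exp_def)
    moreover have "open {..<0::real}" "s \<in> {..<0}" using 2 by auto
    ultimately show ?thesis
      by (rule has_field_derivative_transform_within_open) (simp add: flat_exp_def)
  next
    case 3
    let ?C = "real (m + 2) ^ (m + 2)"
    have "((\<lambda>h. flat_exp m h / h) \<longlongrightarrow> 0) (at 0)"
    proof (rule Lim_null_comparison)
      show "\<forall>\<^sub>F h in at 0. norm (flat_exp m h / h) \<le> ?C * \<bar>h\<bar>"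
      proof (rule eventually_at_topological[THEN iffD2], intro exI[of _ UNIV] conjI ballI impI)
        fix h :: real assume "h \<noteq> 0"
        then show "norm (flat_exp m h / h) \<le> ?C * \<bar>h\<bar>"
          using flat_exp_le[of m h] flat_exp_nonneg[of m h]
          by (simp add: divide_le_eq abs_mult power2_eq_square mult.assoc)
      qed auto
      show "((\<lambda>h. ?C * \<bar>h\<bar>) \<longlongrightarrow> 0) (at 0)"
        by (intro tendsto_eq_intros | simp)+
    qed
    then show ?thesis using 3 by (simp add: has_field_derivative_iff flat_exp_def)
  qed
qed

section \<open>Smooth radial bumps as test functions\<close>

lemma partial_eq:
  assumes "GDERIV f x :> D"
  shows "partial i f x = D $ i"
proof -
  have "frechet_derivative f (at x) = (\<lambda>h. h \<bullet> D)"
    using assms frechet_derivative_at unfolding gderiv_def by metis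
  then show ?thesis by (simp add: partial_def inner_axis')
qed

text \<open>A class that contains the standard bump and is closed under partial derivatives by the
  product rule. Smoothness then follows by induction on the order, without formulas for higher
  derivatives.\<close>

inductive radial_bump :: "(real^'n::finite) \<Rightarrow> real \<Rightarrow> (real^'n \<Rightarrow> real) \<Rightarrow> bool" for c d where
  base: "radial_bump c d (\<lambda>y. flat_exp m (d - (norm (y - c))\<^sup>2))"
| coord: "radial_bump c d f \<Longrightarrow> radial_bump c d (\<lambda>y. (y - c) $ i * f y)"
| scale: "radial_bump c d f \<Longrightarrow> radial_bump c d (\<lambda>y. k * f y)"
| add: "radial_bump c d f \<Longrightarrow> radial_bump c d g \<Longrightarrow> radial_bump c d (\<lambda>y. f y + g y)"

lemma GDERIV_radial: 
  assumes "\<And>s. (f has_real_derivative f' s) (at s)"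
  shows "GDERIV (\<lambda>y. f (d - (norm (y - c))\<^sup>2)) y :> (- 2 * f' (d - (norm (y - c))\<^sup>2)) *\<^sub>R (y - c)"
proof -
  have "GDERIV (\<lambda>y. d - (norm (y - c))\<^sup>2) y :> - 2 *\<^sub>R (y - c)"
    unfolding gderiv_def power2_norm_eq_inner
    by (auto intro!: derivative_eq_intros simp: inner_commute)
  from GDERIV_DERIV_compose[OF this assms] show ?thesis by (simp add: mult.commute)
qed

lemma GDERIV_differentiable: "GDERIV f x :> D \<Longrightarrow> f differentiable (at x)"
  unfolding gderiv_def differentiable_def by blast

lemma radial_bump_partial:
  assumes "radial_bump c d f"
  shows "(\<forall>y. f differentiable (at y)) \<and> (\<forall>i. radial_bump c d (partial i f))"
  using assms
proof induction
  case (base m)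
  let ?q = "\<lambda>y. d - (norm (y - c))\<^sup>2"
  have D: "GDERIV (\<lambda>y. flat_exp m (?q y)) y :>
      (- 2 * (flat_exp (m + 2) (?q y) - real m * flat_exp (m + 1) (?q y))) *\<^sub>R (y - c)" for y
    by (rule GDERIV_radial[OF DERIV_flat_exp])
  have "partial i (\<lambda>y. flat_exp m (?q y)) = (\<lambda>y. (y - c) $ i *
      ((- 2) * flat_exp (m + 2) (?q y) + (2 * real m) * flat_exp (m + 1) (?q y)))" for i
    by (rule ext) (simp add: partial_eq[OF D] algebra_simps)
  moreover have "radial_bump c d (\<lambda>y. (y - c) $ i *
      ((- 2) * flat_exp (m + 2) (?q y) + (2 * real m) * flat_exp (m + 1) (?q y)))" for i
    by (rule radial_bump.coord[OF radial_bump.add[OF radial_bump.scale[OF radial_bump.base] radial_bump.scale[OF radial_bump.base]]])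
  ultimately have "radial_bump c d (partial i (\<lambda>y. flat_exp m (?q y)))" for i by (simp only:)
  then show ?case using GDERIV_differentiable[OF D] by simp
next
  case (coord f j)
  then have D: "GDERIV f y :> grad f y" for y by (blast intro: gderiv_grad)
  have "((\<lambda>y. (y - c) \<bullet> axis j 1) has_derivative (\<lambda>h. h \<bullet> axis j 1)) (at y)" for y
    by (auto intro!: derivative_eq_intros)
  then have "GDERIV (\<lambda>y. (y - c) $ j) y :> axis j 1" for y
    by (simp add: gderiv_def inner_axis)
  from GDERIV_mult[OF this D]
  have E: "GDERIV (\<lambda>y. (y - c) $ j * f y) y :> (y - c) $ j *\<^sub>R grad f y + f y *\<^sub>R axis j 1" for y .
  have "partial i (\<lambda>y. (y - c) $ j * f y) = (\<lambda>y. (y - c) $ j * partial i f y + of_bool (i = j) * f y)" for i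
    by (rule ext, subst partial_eq[OF E], subst partial_eq[OF D]) (simp add: axis_def)
  moreover have "radial_bump c d (\<lambda>y. (y - c) $ j * partial i f y + of_bool (i = j) * f y)" for i
    using coord by (intro radial_bump.add[OF radial_bump.coord radial_bump.scale]) auto
  ultimately have "radial_bump c d (partial i (\<lambda>y. (y - c) $ j * f y))" for i by (simp only:)
  then show ?case using GDERIV_differentiable[OF E] by simp
next
  case (scale f k)
  then have D: "GDERIV f y :> grad f y" for y by (blast intro: gderiv_grad)
  have E: "GDERIV (\<lambda>y. k * f y) y :> k *\<^sub>R grad f y" for y
    using GDERIV_mult[OF GDERIV_const D, of k] by simp
  have "partial i (\<lambda>y. k * f y) = (\<lambda>y. k * partial i f y)" for i
    by (rule ext) (simp add: partial_eq[OF E] partial_eq[OF D])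
  then have "radial_bump c d (partial i (\<lambda>y. k * f y))" for i
    using scale.IH by (simp only: radial_bump.scale)
  then show ?case using GDERIV_differentiable[OF E] by simp
next
  case (add f g)
  then have D: "GDERIV f y :> grad f y" and D': "GDERIV g y :> grad g y" for y
    by (blast intro: gderiv_grad)+
  note E = GDERIV_add[OF D D']
  have "partial i (\<lambda>y. f y + g y) = (\<lambda>y. partial i f y + partial i g y)" for i
    by (rule ext) (simp add: partial_eq[OF E] partial_eq[OF D] partial_eq[OF D'])
  then have "radial_bump c d (partial i (\<lambda>y. f y + g y))" for i
    using add.IH by (simp only: radial_bump.add)
  then show ?case using GDERIV_differentiable[OF E] by simp
qed

lemma radial_bump_smooth: 
  assumes "radial_bump c d f"
  shows "smooth_fun_on UNIV f"
proof -
  have "Ck_on k UNIV f" for k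
    using assms
  proof (induction k arbitrary: f)
    case 0
    then have "f differentiable_on UNIV"
      using radial_bump_partial[of c d f] by (simp add: differentiable_on_eq_differentiable_at)
    then show ?case by (simp add: differentiable_imp_continuous_on)
  next
    case (Suc k)
    then have "f differentiable_on UNIV"
      using radial_bump_partial[of c d f] by (simp add: differentiable_on_eq_differentiable_at)
    moreover have "Ck_on k UNIV (partial i f)" for i
      using radial_bump_partial[OF Suc.prems] Suc.IH by blast
    ultimately show ?case by simp
  qed
  then show ?thesis by (simp add: smooth_fun_on_def)
qed

definition bump :: "real \<Rightarrow> 'a::real_inner \<Rightarrow> real" where
  "bump r z = flat_exp 0 (r\<^sup>2 - (norm z)\<^sup>2)"

text \<open>\<open>flat_exp 2\<close> is the derivative of \<open>flat_exp 0\<close>, since the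
  second term of \<open>DERIV_flat_exp\<close> carries the factor m = 0.\<close>

definition bump_grad :: "real \<Rightarrow> 'a::real_inner \<Rightarrow> 'a" where
  "bump_grad r z = (- 2 * flat_exp 2 (r\<^sup>2 - (norm z)\<^sup>2)) *\<^sub>R z"

lemma bump_nonneg: "bump r z \<ge> 0"
  by (simp add: bump_def flat_exp_nonneg)

lemma bump_eq_0: "bump r z = 0" if "norm z > r" "r > 0"
proof -
  have "r\<^sup>2 < (norm z)\<^sup>2" using that by (intro power_strict_mono) auto
  then show ?thesis by (simp add: bump_def flat_exp_def)
qed

lemma bump_pos: "bump r z > 0" if "norm z < r"
proof -
  have "(norm z)\<^sup>2 < r\<^sup>2" using that by (intro power_strict_mono) auto
  then show ?thesis by (simp add: bump_def flat_exp_def)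
qed

lemma GDERIV_bump: "GDERIV (bump r) z :> bump_grad r z"
proof -
  have "GDERIV (\<lambda>y. flat_exp 0 (r\<^sup>2 - (norm (y - 0))\<^sup>2)) z :>
     (- 2 * (flat_exp (0 + 2) (r\<^sup>2 - (norm (z - 0))\<^sup>2) - real 0 * flat_exp (0 + 1) (r\<^sup>2 - (norm (z - 0))\<^sup>2))) *\<^sub>R (z - 0)"
    by (rule GDERIV_radial[OF DERIV_flat_exp])
  then show ?thesis by (simp add: bump_def[abs_def] bump_grad_def numeral_2_eq_2)
qed

lemma continuous_on_flat_exp: "continuous_on UNIV (flat_exp m)"
  using DERIV_flat_exp DERIV_isCont continuous_at_imp_continuous_on by blast

lemma continuous_on_bump: "continuous_on S (bump r)" "continuous_on S (bump_grad r)"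
  unfolding bump_def bump_grad_def
  by (intro continuous_intros continuous_on_compose2[OF continuous_on_flat_exp]; simp)+

lemma bump_test_function:
  fixes x :: "real^'n::finite"
  assumes "r > 0" "cball x r \<subseteq> \<Omega>"
  shows "test_function \<Omega> (\<lambda>y. bump r (x - y))"
proof -
  have "(\<lambda>y. bump r (x - y)) = (\<lambda>y. flat_exp 0 (r\<^sup>2 - (norm (y - x))\<^sup>2))"
    by (simp add: bump_def norm_minus_commute)
  then have "radial_bump x (r\<^sup>2) (\<lambda>y. bump r (x - y))"
    using radial_bump.base[of x "r\<^sup>2" 0] by simp
  then have "smooth_fun_on UNIV (\<lambda>y. bump r (x - y))" by (rule radial_bump_smooth)
  moreover have "{y. bump r (x - y) \<noteq> 0} \<subseteq> cball x r"
    using bump_eq_0[of r] assms by (force simp: dist_norm not_le[symmetric])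
  then have c: "closure {y. bump r (x - y) \<noteq> 0} \<subseteq> cball x r"
    by (rule closure_minimal) simp
  moreover have "compact (closure {y. bump r (x - y) \<noteq> 0})"
    using bounded_subset[OF bounded_cball c] by (simp add: compact_eq_bounded_closed)
  ultimately show ?thesis unfolding test_function_def using assms(2) by simp
qed

lemma bump_partial: "partial i (\<lambda>y. bump r (x - y)) y = - bump_grad r (x - y) $ i"
proof -
  have "((\<lambda>y. bump r (x - y)) has_derivative (\<lambda>h. (- h) \<bullet> bump_grad r (x - y))) (at y)"
    using GDERIV_bump[of r "x - y"] unfolding gderiv_def
    by (intro has_derivative_compose[of "\<lambda>y. x - y" _ y UNIV "bump r"]) (auto intro!: derivative_eq_intros)
  then have "GDERIV (\<lambda>y. bump r (x - y)) y :> - bump_grad r (x - y)"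
    unfolding gderiv_def by simp
  from partial_eq[OF this] show ?thesis by simp
qed


section \<open>Convolution with a smooth kernel\<close>

lemma integrable_scaleR_continuous_shift:
  fixes f :: "'a::euclidean_space \<Rightarrow> real" and g :: "'a \<Rightarrow> 'b::euclidean_space"
  assumes S: "bounded S" "S \<in> sets lebesgue" and f: "integrable (lebesgue_on S) f"
    and g: "continuous_on UNIV g"
  shows "integrable (lebesgue_on S) (\<lambda>y. f y *\<^sub>R g (x - y))"
proof -
  obtain R where R: "\<And>y. y \<in> S \<Longrightarrow> norm y \<le> R" using S(1) bounded_iff by metis
  have "compact (g ` cball 0 (norm x + R))"
    using continuous_on_subset[OF g] by (intro compact_continuous_image) auto
  then obtain B where B: "\<And>z. z \<in> cball 0 (norm x + R) \<Longrightarrow> norm (g z) \<le> B"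
    by (meson bounded_iff compact_imp_bounded image_eqI)
  have "continuous_on UNIV (\<lambda>y. g (x - y))"
    by (intro continuous_intros continuous_on_compose2[OF g]) auto
  then have "(\<lambda>y. g (x - y)) \<in> borel_measurable (lebesgue_on S)"
    by (intro measurable_restrict_space1 measurable_completion) (simp add: borel_measurable_continuous_onI)
  then have "(\<lambda>y. f y *\<^sub>R g (x - y)) \<in> borel_measurable (lebesgue_on S)"
    using f by (intro borel_measurable_scaleR) auto
  moreover have "AE y in lebesgue_on S. norm (f y *\<^sub>R g (x - y)) \<le> norm (B * f y)"
  proof (rule AE_I2)
    fix y assume "y \<in> space (lebesgue_on S)"
    then have "norm (x - y) \<le> norm x + R"
      using R[of y] norm_triangle_ineq4[of x y] by (simp add: space_restrict_space)
    then have "norm (g (x - y)) \<le> B" using B by simp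
    then have "norm (g (x - y)) \<le> \<bar>B\<bar>" by linarith
    then show "norm (f y *\<^sub>R g (x - y)) \<le> norm (B * f y)"
      using mult_left_mono[of "norm (g (x - y))" "\<bar>B\<bar>" "\<bar>f y\<bar>"] by (simp add: abs_mult mult.commute)
  qed
  moreover have "integrable (lebesgue_on S) (\<lambda>y. B * f y)" using f by simp
  ultimately show ?thesis by (rule Bochner_Integration.integrable_bound[rotated])
qed

text \<open>\<open>f\<close> is merely integrable, so all regularity comes from the kernel: by
  uniform continuity of its gradient on a compact ball, the first-order Taylor remainder is at most
  e' |w - x| uniformly in y, and it integrates to a multiple of the L^1 norm of
  \<open>f\<close>.\<close>

lemma GDERIV_convolution:
  fixes f \<rho> :: "'a::euclidean_space \<Rightarrow> real"
  assumes S: "bounded S" "S \<in> sets lebesgue" and f: "integrable (lebesgue_on S) f"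
    and \<rho>: "\<And>z. GDERIV \<rho> z :> \<rho>' z" and \<rho>': "continuous_on UNIV \<rho>'"
  shows "GDERIV (\<lambda>x. LINT y|lebesgue_on S. f y * \<rho> (x - y)) x :> (LINT y|lebesgue_on S. f y *\<^sub>R \<rho>' (x - y))"
proof -
  have c\<rho>: "continuous_on UNIV \<rho>" by (rule gderiv_continuous_on[OF \<rho>])
  have int1: "integrable (lebesgue_on S) (\<lambda>y. f y * \<rho> (x - y))" for x
    using integrable_scaleR_continuous_shift[OF S f c\<rho>] by simp
  note int2 = integrable_scaleR_continuous_shift[OF S f \<rho>']
  obtain R where R: "\<And>y. y \<in> S \<Longrightarrow> norm y \<le> R" using S(1) bounded_iff by metis
  define I where "I = (LINT y|lebesgue_on S. \<bar>f y\<bar>)"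
  have I: "I \<ge> 0" unfolding I_def by (rule integral_nonneg_AE) auto
  let ?F = "\<lambda>x. LINT y|lebesgue_on S. f y * \<rho> (x - y)"
  let ?D = "LINT y|lebesgue_on S. f y *\<^sub>R \<rho>' (x - y)"
  have main: "\<exists>d>0. \<forall>w. norm (w - x) < d \<longrightarrow> norm (?F w - ?F x - (w - x) \<bullet> ?D) \<le> e * norm (w - x)"
    if e: "e > 0" for e
  proof -
    define e' where "e' = e / (I + 1)"
    have e': "e' > 0" using e I by (simp add: e'_def)
    \<comment> \<open>Contains every segment from x - y to w - y with y in \<open>S\<close> and |w -
      x| < 1.\<close>
    let ?B = "cball (0::'a) (norm x + R + 1)"
    have "uniformly_continuous_on ?B \<rho>'"
      using continuous_on_subset[OF \<rho>'] by (intro compact_uniformly_continuous) auto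
    then obtain d where d: "d > 0"
      "\<And>z w. z \<in> ?B \<Longrightarrow> w \<in> ?B \<Longrightarrow> dist w z < d \<Longrightarrow> dist (\<rho>' w) (\<rho>' z) < e'"
      using e' unfolding uniformly_continuous_on_def by metis
    have lin: "\<bar>\<rho> (w - y) - \<rho> (x - y) - (w - x) \<bullet> \<rho>' (x - y)\<bar> \<le> norm (w - x) * e'"
      if y: "y \<in> S" and w: "norm (w - x) < min d 1" for y w
    proof -
      let ?S = "closed_segment (x - y) (w - y)"
      have xy: "norm (x - y) \<le> norm x + R"
        using R[OF y] norm_triangle_ineq4[of x y] by linarith
      have inB: "z \<in> ?B" and dz: "dist z (x - y) < d" if "z \<in> ?S" for z
      proof -
        have "norm (z - (x - y)) \<le> norm ((w - y) - (x - y))"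
          using that segment_bound(1) by blast
        then have *: "norm (z - (x - y)) \<le> norm (w - x)" by simp
        then show "dist z (x - y) < d" using w by (simp add: dist_norm)
        have "norm z \<le> norm (x - y) + norm (z - (x - y))" using norm_triangle_sub by blast
        then show "z \<in> ?B" using * w xy by simp
      qed
      have "norm (\<rho> (w - y) - \<rho> (x - y) - (\<lambda>z h. h \<bullet> \<rho>' z) (x - y) ((w - y) - (x - y)))
          \<le> norm ((w - y) - (x - y)) * e'"
      proof (rule differentiable_bound_linearization[where S = ?S and f = \<rho> and f' = "\<lambda>z h. h \<bullet> \<rho>' z"])
        show "x - y + t *\<^sub>R (w - y - (x - y)) \<in> ?S" if "t \<in> {0..1}" for t
          using that by (auto simp: closed_segment_def algebra_simps intro!: exI[of _ t])
        show "(\<rho> has_derivative (\<lambda>h. h \<bullet> \<rho>' z)) (at z within ?S)" for z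
          using \<rho>[of z] unfolding gderiv_def by (rule has_derivative_at_withinI)
        show "onorm ((\<lambda>h. h \<bullet> \<rho>' z) - (\<lambda>h. h \<bullet> \<rho>' (x - y))) \<le> e'" if "z \<in> ?S" for z
        proof (rule onorm_le)
          fix h :: 'a
          have "dist (\<rho>' z) (\<rho>' (x - y)) < e'" using inB[OF that] inB[of "x - y"] dz[OF that] d(2) by auto
          then have "norm (\<rho>' z - \<rho>' (x - y)) \<le> e'" by (simp add: dist_norm)
          then have "norm h * norm (\<rho>' z - \<rho>' (x - y)) \<le> norm h * e'" by (rule mult_left_mono) simp
          moreover have "\<bar>h \<bullet> (\<rho>' z - \<rho>' (x - y))\<bar> \<le> norm h * norm (\<rho>' z - \<rho>' (x - y))"
            by (rule Cauchy_Schwarz_ineq2)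
          ultimately show "norm (((\<lambda>h. h \<bullet> \<rho>' z) - (\<lambda>h. h \<bullet> \<rho>' (x - y))) h) \<le> e' * norm h"
            by (simp add: inner_diff_right mult.commute)
        qed
      qed auto
      then show ?thesis by simp
    qed
    have "norm (?F w - ?F x - (w - x) \<bullet> ?D) \<le> e * norm (w - x)" if w: "norm (w - x) < min d 1" for w
    proof -
      have eq: "?F w - ?F x - (w - x) \<bullet> ?D =
        (LINT y|lebesgue_on S. f y * (\<rho> (w - y) - \<rho> (x - y) - (w - x) \<bullet> \<rho>' (x - y)))"
        using int1[of x] int1[of w] int2[of x]
        by (simp add: right_diff_distrib flip: integral_inner_right inner_scaleR_right)
      have "norm (LINT y|lebesgue_on S. f y * (\<rho> (w - y) - \<rho> (x - y) - (w - x) \<bullet> \<rho>' (x - y)))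
         \<le> (LINT y|lebesgue_on S. \<bar>f y\<bar> * (norm (w - x) * e'))"
      proof (rule Bochner_Integration.integral_norm_bound_integral)
        show "integrable (lebesgue_on S) (\<lambda>y. f y * (\<rho> (w - y) - \<rho> (x - y) - (w - x) \<bullet> \<rho>' (x - y)))"
          using int1[of x] int1[of w] integrable_inner_right[OF int2[of x], of "w - x"]
          by (simp add: right_diff_distrib)
        show "integrable (lebesgue_on S) (\<lambda>y. \<bar>f y\<bar> * (norm (w - x) * e'))" using f by simp
        fix y assume "y \<in> space (lebesgue_on S)"
        then have "y \<in> S" by (simp add: space_restrict_space)
        from lin[OF this w] show "norm (f y * (\<rho> (w - y) - \<rho> (x - y) - (w - x) \<bullet> \<rho>' (x - y)))
           \<le> \<bar>f y\<bar> * (norm (w - x) * e')"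
          by (simp add: abs_mult mult_left_mono)
      qed
      also have "\<dots> = I * (norm (w - x) * e')" by (simp add: I_def)
      also have "\<dots> \<le> e * norm (w - x)"
        using I e unfolding e'_def by (simp add: field_simps mult_left_mono)
      finally show ?thesis unfolding eq .
    qed
    then show ?thesis using d(1) by (intro exI[of _ "min d 1"]) auto
  qed
  show ?thesis
    unfolding gderiv_def has_derivative_at_alt using main by (auto intro: bounded_linear_inner_left)
qed

lemma in_Lp_integrable:
  assumes "bounded \<Omega>" "\<Omega> \<in> sets lebesgue" "p \<ge> 1" "in_Lp \<Omega> p f"
  shows "integrable (lebesgue_on \<Omega>) f"
proof (rule Bochner_Integration.integrable_bound)
  have "finite_measure (lebesgue_on \<Omega>)"
    using assms(1,2) bounded_set_imp_lmeasurable finite_measure_lebesgue_on by blast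
  then interpret finite_measure "lebesgue_on \<Omega>" .
  show "integrable (lebesgue_on \<Omega>) (\<lambda>x. 1 + \<bar>f x\<bar> powr p)"
    using assms(4) by (simp add: in_Lp_def)
  show "f \<in> borel_measurable (lebesgue_on \<Omega>)" using assms(4) by (simp add: in_Lp_def)
  have "\<bar>t\<bar> \<le> 1 + \<bar>t\<bar> powr p" for t :: real
  proof (cases "\<bar>t\<bar> \<le> 1")
    case False
    then have "\<bar>t\<bar> powr 1 \<le> \<bar>t\<bar> powr p" using assms(3) by (intro powr_mono) auto
    then show ?thesis using False by simp
  qed (smt (verit) powr_ge_zero)
  then show "AE x in lebesgue_on \<Omega>. norm (f x) \<le> norm (1 + \<bar>f x\<bar> powr p)"
    by (intro AE_I2) (smt (verit) real_norm_def powr_ge_zero)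
qed

text \<open>The bump centred at \<open>x\<close> is an admissible test function because its ball
  lies in \<Omega>. Differentiating it in y produces a minus sign that cancels the one in the
  definition of weak derivatives.\<close>

lemma weak_partial_mollified:
  assumes "has_weak_partial \<Omega> i f h" "r > 0" "cball x r \<subseteq> \<Omega>"
  shows "(LINT y|lebesgue_on \<Omega>. f y * bump_grad r (x - y) $ i) = (LINT y|lebesgue_on \<Omega>. h y * bump r (x - y))"
  using assms(1) bump_test_function[OF assms(2,3)] unfolding has_weak_partial_def
  by (fastforce simp: bump_partial)

text \<open>The derivative first falls on the kernel and is then moved to \<open>f\<close> by the
  weak formulation; a weak gradient thus becomes a classical one wherever the r-ball lies in
  \<Omega>.\<close>

lemma GDERIV_mollified:
  fixes \<Omega> :: "(real^'n::finite) set"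
  assumes S: "bounded \<Omega>" "\<Omega> \<in> sets lebesgue" and f: "integrable (lebesgue_on \<Omega>) f"
    and w: "\<And>i. has_weak_partial \<Omega> i f (\<lambda>y. h y $ i)" and r: "r > 0" "cball x r \<subseteq> \<Omega>"
  shows "GDERIV (\<lambda>x. LINT y|lebesgue_on \<Omega>. f y * bump r (x - y)) x :>
     (\<chi> i. LINT y|lebesgue_on \<Omega>. h y $ i * bump r (x - y))"
proof -
  note int = integrable_scaleR_continuous_shift[OF S f continuous_on_bump(2)]
  have "(LINT y|lebesgue_on \<Omega>. f y *\<^sub>R bump_grad r (x - y)) $ i = (LINT y|lebesgue_on \<Omega>. h y $ i * bump r (x - y))" for i
  proof -
    have "(LINT y|lebesgue_on \<Omega>. f y *\<^sub>R bump_grad r (x - y)) $ i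
        = (LINT y|lebesgue_on \<Omega>. f y *\<^sub>R bump_grad r (x - y)) \<bullet> axis i 1"
      by (simp add: inner_axis)
    also have "\<dots> = (LINT y|lebesgue_on \<Omega>. (f y *\<^sub>R bump_grad r (x - y)) \<bullet> axis i 1)"
      using int by (intro integral_inner_left[symmetric]) auto
    also have "\<dots> = (LINT y|lebesgue_on \<Omega>. f y * bump_grad r (x - y) $ i)" by (simp add: inner_axis)
    finally show ?thesis using weak_partial_mollified[OF w r] by simp
  qed
  then have "(LINT y|lebesgue_on \<Omega>. f y *\<^sub>R bump_grad r (x - y)) = (\<chi> i. LINT y|lebesgue_on \<Omega>. h y $ i * bump r (x - y))"
    by (simp add: vec_eq_iff)
  with GDERIV_convolution[OF S f GDERIV_bump continuous_on_bump(2), of r x] show ?thesis by simp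
qed

lemma continuous_on_mollified:
  fixes f :: "'a::euclidean_space \<Rightarrow> real"
  assumes "bounded \<Omega>" "\<Omega> \<in> sets lebesgue" "integrable (lebesgue_on \<Omega>) f"
  shows "continuous_on U (\<lambda>x. LINT y|lebesgue_on \<Omega>. f y * bump r (x - y))"
  by (rule gderiv_continuous_on[OF GDERIV_convolution[OF assms GDERIV_bump continuous_on_bump(2)]])

text \<open>Mollification commutes with weak derivatives; this is applied to \<phi> and then to each
  component of \<open>G\<close>, whose weak gradient is a row of \<open>H\<close>.\<close>

lemma gradient_laplacian_on_mollified:
  fixes \<Omega> :: "(real^'n::finite) set"
  assumes S: "bounded \<Omega>" "\<Omega> \<in> sets lebesgue" and p: "p \<ge> 1" and W: "W2p_with_derivs \<Omega> p \<phi> G H"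
    and r: "r > 0" "\<And>x. x \<in> U \<Longrightarrow> cball x r \<subseteq> \<Omega>"
  shows "gradient_laplacian_on U (\<lambda>x. LINT y|lebesgue_on \<Omega>. \<phi> y * bump r (x - y))
      (\<lambda>x. \<chi> i. LINT y|lebesgue_on \<Omega>. G y $ i * bump r (x - y))
      (\<lambda>x. LINT y|lebesgue_on \<Omega>. trace (H y) * bump r (x - y))"
proof -
  let ?D = "\<lambda>i x. \<chi> j. LINT y|lebesgue_on \<Omega>. H y $ i $ j * bump r (x - y)"
  let ?G = "\<lambda>x. \<chi> i. LINT y|lebesgue_on \<Omega>. G y $ i * bump r (x - y)"
  have i\<phi>: "integrable (lebesgue_on \<Omega>) \<phi>" and iG: "\<And>i. integrable (lebesgue_on \<Omega>) (\<lambda>y. G y $ i)"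
    and iH: "\<And>i j. integrable (lebesgue_on \<Omega>) (\<lambda>y. H y $ i $ j)"
    using W in_Lp_integrable[OF S p] unfolding W2p_with_derivs_def by auto
  have g1: "GDERIV (\<lambda>x. LINT y|lebesgue_on \<Omega>. \<phi> y * bump r (x - y)) x :> ?G x" if "x \<in> U" for x
    using W r that unfolding W2p_with_derivs_def by (intro GDERIV_mollified[OF S i\<phi>]) auto
  have g2: "GDERIV (\<lambda>x. LINT y|lebesgue_on \<Omega>. G y $ i * bump r (x - y)) x :> ?D i x" if "x \<in> U" for x i
    using W r that unfolding W2p_with_derivs_def by (intro GDERIV_mollified[OF S iG]) auto
  define Wd where "Wd = (\<lambda>x h. \<chi> i. h \<bullet> ?D i x)"
  have cG: "continuous_on U ?G"
    by (intro continuous_on_vec_lambda continuous_on_mollified S iG)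
  have dG: "(?G has_derivative Wd x) (at x)" if "x \<in> U" for x
  proof (subst has_derivative_componentwise_within, rule ballI)
    fix e :: "real^'n" assume "e \<in> Basis"
    then obtain i where i: "e = axis i 1" by (auto simp: Basis_vec_def)
    show "((\<lambda>x. ?G x \<bullet> e) has_derivative (\<lambda>h. Wd x h \<bullet> e)) (at x)"
      using g2[OF that, of i] by (simp add: i Wd_def inner_axis gderiv_def)
  qed
  have We: "Wd x (axis i 1) \<bullet> axis i 1 = (LINT y|lebesgue_on \<Omega>. H y $ i $ i * bump r (x - y))" for x i
    by (simp add: Wd_def inner_axis inner_axis')
  have cW: "continuous_on U (\<lambda>x. Wd x e \<bullet> e)" if "e \<in> Basis" for e
    using that continuous_on_mollified[OF S iH] by (auto simp: Basis_vec_def We)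
  have tr: "(LINT y|lebesgue_on \<Omega>. trace (H y) * bump r (x - y)) = (\<Sum>e\<in>Basis. Wd x e \<bullet> e)" for x
  proof -
    have "integrable (lebesgue_on \<Omega>) (\<lambda>y. H y $ i $ i * bump r (x - y))" for i
      using integrable_scaleR_continuous_shift[OF S iH continuous_on_bump(1)] by simp
    then show ?thesis
      by (simp add: sum_Basis_vec We trace_def sum_distrib_right Bochner_Integration.integral_sum)
  qed
  show ?thesis unfolding gradient_laplacian_on_def
    using cG g1 dG cW tr by (intro conjI ballI exI[of _ Wd]) auto
qed

section \<open>Total mass of the bump and the L^1 bound for mollification\<close>

lemma bump_mass:
  fixes x :: "'a::euclidean_space"
  assumes "r > 0" "cball x r \<subseteq> \<Omega>" "\<Omega> \<in> sets lebesgue"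
  shows "(LINT y|lebesgue_on \<Omega>. bump r (x - y)) = (LINT z|lborel. bump r (z::'a))"
proof -
  have "(LINT y|lebesgue_on \<Omega>. bump r (x - y)) = (LINT y|lebesgue. indicator \<Omega> y *\<^sub>R bump r (x - y))"
    using assms(3) by (subst integral_restrict_space) auto
  also have "\<dots> = (LINT y|lebesgue. bump r (x - y))"
  proof (rule Bochner_Integration.integral_cong[OF refl])
    show "indicator \<Omega> y *\<^sub>R bump r (x - y) = bump r (x - y)" for y
      using bump_eq_0[of r "x - y"] assms(1,2)
      by (cases "y \<in> \<Omega>") (auto simp: subset_iff dist_norm not_le[symmetric])
  qed
  also have "\<dots> = (LINT y|lborel. bump r (x - y))"
    by (rule integral_completion)
       (auto intro!: borel_measurable_continuous_onI continuous_on_compose2[OF continuous_on_bump(1)] continuous_intros)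
  also have "\<dots> = (LINT y|lborel. bump r ((+) (- x) y))"
    by (simp add: bump_def norm_minus_commute)
  also have "\<dots> = (LINT z|distr lborel borel ((+) (- x)). bump r z)"
    by (rule integral_distr[symmetric]) (auto simp: borel_measurable_continuous_onI continuous_on_bump)
  also have "\<dots> = (LINT z|lborel. bump r (z::'a))"
    by (simp only: lborel_distr_plus)
  finally show ?thesis .
qed

lemma bump_integrable: 
  assumes "r > 0"
  shows "integrable lborel (bump r :: 'a::euclidean_space \<Rightarrow> real)"
  using assms by (intro integrable_compact_support[of "cball 0 r"] continuous_on_bump bump_eq_0) auto

lemma bump_mass_pos:
  assumes "r > 0"
  shows "(LINT z|lborel. bump r (z::'a::euclidean_space)) > 0"
proof -
  have "0 \<le> (LINT z|lborel. bump r (z::'a))" by (simp add: bump_nonneg)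
  moreover have "(LINT z|lborel. bump r (z::'a)) \<noteq> 0"
  proof
    assume "(LINT z|lborel. bump r (z::'a)) = 0"
    then have "AE z in lborel. bump r (z::'a) = 0"
      by (subst (asm) integral_nonneg_eq_0_iff_AE) (auto simp: bump_nonneg bump_integrable assms)
    then have "AE z in lborel. z \<notin> ball (0::'a) r"
      using bump_pos by (force elim!: eventually_mono)
    then have "emeasure lborel (ball (0::'a) r) = 0"
      by (subst (asm) AE_iff_measurable[of "ball (0::'a) r"]) auto
    then show False using content_ball_pos[OF assms, of "0::'a"] by (simp add: measure_def)
  qed
  ultimately show ?thesis by simp
qed

text \<open>Tonelli's theorem and translation invariance. The total mass of the bump stands in for 1
  because the kernel is not normalised; the second factor of the product carries Lebesgue measure
  because \<open>f\<close> is only Lebesgue measurable.\<close>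

lemma integral_mollified_le:
  fixes f :: "'a::euclidean_space \<Rightarrow> real"
  assumes S: "bounded \<Omega>" "\<Omega> \<in> sets lebesgue" and f: "integrable (lebesgue_on \<Omega>) f" "\<And>y. f y \<ge> 0"
    and K: "compact K" and r: "r > 0"
  shows "(LINT x:K|lborel. LINT y|lebesgue_on \<Omega>. f y * bump r (x - y))
      \<le> (LINT z|lborel. bump r (z::'a)) * (LINT y|lebesgue_on \<Omega>. f y)"
proof -
  let ?N = "\<lambda>x. LINT y|lebesgue_on \<Omega>. f y * bump r (x - y)"
  let ?c = "LINT z|lborel. bump r (z::'a)"
  have N0: "?N x \<ge> 0" for x using f(2) by (simp add: bump_nonneg)
  have fin: "finite_measure (lebesgue_on \<Omega>)"
    using S bounded_set_imp_lmeasurable finite_measure_lebesgue_on by blast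
  then interpret F: finite_measure "lebesgue_on \<Omega>" .
  interpret P: pair_sigma_finite "lborel :: 'a measure" "lebesgue_on \<Omega>" ..
  have fm: "f \<in> borel_measurable (lebesgue_on \<Omega>)" using f(1) by simp
  have id: "(\<lambda>y. y) \<in> measurable (lebesgue_on \<Omega>) borel"
    by (intro measurable_restrict_space1 measurable_completion) simp
  have bm: "(\<lambda>p. bump r (fst p - snd p)) \<in> borel_measurable (lborel \<Otimes>\<^sub>M lebesgue_on \<Omega>)"
  proof -
    have "(\<lambda>p. fst p - snd p) \<in> borel_measurable (lborel \<Otimes>\<^sub>M lebesgue_on \<Omega>)"
      using measurable_compose[OF measurable_snd id] by (intro borel_measurable_diff) auto
    then show ?thesis
      using borel_measurable_continuous_onI[OF continuous_on_bump(1)[of UNIV r]] measurable_compose by blast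
  qed
  have "K \<in> sets lborel" using K borel_compact by simp
  have meas: "(\<lambda>(x, y). indicator K x * ennreal (f y * bump r (x - y))) \<in> borel_measurable (lborel \<Otimes>\<^sub>M lebesgue_on \<Omega>)"
  proof -
    have "(\<lambda>p. f (snd p) * bump r (fst p - snd p)) \<in> borel_measurable (lborel \<Otimes>\<^sub>M lebesgue_on \<Omega>)"
      by (intro borel_measurable_times bm measurable_compose[OF measurable_snd fm])
    moreover have "(\<lambda>p. indicator K (fst p) :: ennreal) \<in> borel_measurable (lborel \<Otimes>\<^sub>M lebesgue_on \<Omega>)"
      using \<open>K \<in> sets lborel\<close> by (intro measurable_compose[OF measurable_fst]) simp
    ultimately show ?thesis
      unfolding split_beta by (intro borel_measurable_times_ennreal measurable_compose[OF _ measurable_ennreal])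
  qed
  have "ennreal (LINT x:K|lborel. ?N x) = (\<integral>\<^sup>+x. ennreal (indicator K x *\<^sub>R ?N x) \<partial>lborel)"
    unfolding set_lebesgue_integral_def using N0
    by (intro nn_integral_eq_integral[symmetric] borel_integrable_compact K continuous_on_mollified S f(1)) auto
  also have "\<dots> = (\<integral>\<^sup>+x. \<integral>\<^sup>+y. indicator K x * ennreal (f y * bump r (x - y)) \<partial>lebesgue_on \<Omega> \<partial>lborel)"
  proof (rule nn_integral_cong)
    fix x
    have "integrable (lebesgue_on \<Omega>) (\<lambda>y. f y * bump r (x - y))"
      using integrable_scaleR_continuous_shift[OF S f(1) continuous_on_bump(1)] by simp
    then have "(\<integral>\<^sup>+y. ennreal (f y * bump r (x - y)) \<partial>lebesgue_on \<Omega>) = ennreal (?N x)"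
      using f(2) by (intro nn_integral_eq_integral) (auto simp: bump_nonneg)
    then show "ennreal (indicator K x *\<^sub>R ?N x) = (\<integral>\<^sup>+y. indicator K x * ennreal (f y * bump r (x - y)) \<partial>lebesgue_on \<Omega>)"
      by (cases "x \<in> K") auto
  qed
  also have "\<dots> = (\<integral>\<^sup>+y. \<integral>\<^sup>+x. indicator K x * ennreal (f y * bump r (x - y)) \<partial>lborel \<partial>lebesgue_on \<Omega>)"
    using P.Fubini'[OF meas] by simp
  also have "\<dots> \<le> (\<integral>\<^sup>+y. ennreal (?c * f y) \<partial>lebesgue_on \<Omega>)"
  proof (rule nn_integral_mono)
    fix y :: 'a
    have b: "integrable lborel (\<lambda>x. bump r (x - y))" "(LINT x|lborel. bump r (x - y)) = ?c"
      using bump_integrable[OF r, where 'a = 'a] integrable_distr_eq[of "(+) (- y)" lborel borel "bump r"]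
        integral_distr[of "(+) (- y)" lborel borel "bump r"]
      by (simp_all add: lborel_distr_plus borel_measurable_continuous_onI continuous_on_bump)
    have "(\<integral>\<^sup>+x. indicator K x * ennreal (f y * bump r (x - y)) \<partial>lborel)
       \<le> (\<integral>\<^sup>+x. ennreal (f y * bump r (x - y)) \<partial>lborel)"
      by (intro nn_integral_mono) (auto simp: indicator_def)
    also have "\<dots> = ennreal (LINT x|lborel. f y * bump r (x - y))"
      using b f(2) by (intro nn_integral_eq_integral) (auto simp: bump_nonneg)
    also have "\<dots> = ennreal (?c * f y)" using b by (simp add: mult.commute)
    finally show "(\<integral>\<^sup>+x. indicator K x * ennreal (f y * bump r (x - y)) \<partial>lborel) \<le> ennreal (?c * f y)" .
  qed
  also have "\<dots> = ennreal (LINT y|lebesgue_on \<Omega>. ?c * f y)"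
    using f bump_mass_pos[OF r, where 'a = 'a] by (intro nn_integral_eq_integral) auto
  finally show ?thesis
    using f(2) bump_mass_pos[OF r, where 'a = 'a] by (subst (asm) ennreal_le_iff) (auto intro!: mult_nonneg_nonneg)
qed

section \<open>The stability inequality\<close>

lemma uniform_modulus:
  fixes V :: "'a::euclidean_space \<Rightarrow> 'b::metric_space"
  assumes "compact C" "continuous_on C V" "\<omega> > 0"
  obtains d where "d > 0" "\<And>x y. x \<in> C \<Longrightarrow> y \<in> C \<Longrightarrow> dist x y < d \<Longrightarrow> dist (V x) (V y) < \<omega>"
  using compact_uniformly_continuous[OF assms(2,1)] assms(3) unfolding uniformly_continuous_on_def
  by metis

text \<open>For smooth \<open>\<phi>\<close> one multiplies the inequality by \<open>\<psi>\<^sup>2/\<phi>\<close>. In general \<open>\<phi>\<close> is replaced by a mollification \<open>m\<close>;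
  the commutator of mollification and multiplication by \<open>V\<close> is controlled by the \<open>L\<^sup>1\<close> norm of \<open>G\<close> and the
  modulus of continuity of \<open>V\<close>. The mollifier is not normalised, since only quotients by \<open>m\<close> occur.\<close>

lemma stability_inequality:
  fixes \<Omega> K :: "(real^'n::finite) set"
  assumes \<Omega>: "open \<Omega>" "bounded \<Omega>" and K: "compact K" "K \<subseteq> \<Omega>"
    and p: "p \<ge> 1" and W: "W2p_with_derivs \<Omega> p \<phi> G H"
    and \<phi>: "continuous_on (closure \<Omega>) \<phi>" "\<And>x. x \<in> closure \<Omega> \<Longrightarrow> \<phi> x > 0"
    and ineq: "AE x in lebesgue_on \<Omega>. - trace (H x) - 2 * (V x \<bullet> G x) \<ge> g x * \<phi> x"
    and V: "continuous_on \<Omega> V" and g: "continuous_on \<Omega> g"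
    and \<psi>: "\<And>x. x \<in> \<Omega> \<Longrightarrow> GDERIV \<psi> x :> \<Psi> x" "continuous_on \<Omega> \<Psi>"
      "\<And>x. x \<in> \<Omega> - K \<Longrightarrow> \<psi> x = 0"
  shows "(LINT x:K|lborel. g x * (\<psi> x)\<^sup>2) \<le> (LINT x:K|lborel. (norm (\<Psi> x - \<psi> x *\<^sub>R V x))\<^sup>2)"
proof (cases "K = {}")
  case True then show ?thesis by (simp add: set_lebesgue_integral_def)
next
  case False
  have mS: "\<Omega> \<in> sets lebesgue" using \<Omega>(1) by (simp add: borel_open)
  note S = \<Omega>(2) mS
  have spc: "space (lebesgue_on \<Omega>) = \<Omega>" by (simp add: space_restrict_space)
  have c\<psi>: "continuous_on \<Omega> \<psi>" by (rule gderiv_continuous_on[OF \<psi>(1)])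
  have i\<phi>: "integrable (lebesgue_on \<Omega>) \<phi>" and iG: "\<And>i. integrable (lebesgue_on \<Omega>) (\<lambda>y. G y $ i)"
    and iH: "\<And>i j. integrable (lebesgue_on \<Omega>) (\<lambda>y. H y $ i $ j)"
    using W in_Lp_integrable[OF S p] unfolding W2p_with_derivs_def by auto
  have iG': "integrable (lebesgue_on \<Omega>) G"
  proof -
    have "integrable (lebesgue_on \<Omega>) (\<lambda>y. \<Sum>e\<in>Basis. (G y \<bullet> e) *\<^sub>R e)"
      using iG by (intro Bochner_Integration.integrable_sum integrable_scaleR_left) (auto simp: Basis_vec_def inner_axis)
    then show ?thesis by (simp add: euclidean_representation)
  qed
  have iT: "integrable (lebesgue_on \<Omega>) (\<lambda>y. trace (H y))"
    unfolding trace_def using iH by (intro Bochner_Integration.integrable_sum)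
  have iN: "integrable (lebesgue_on \<Omega>) (\<lambda>y. norm (G y))" using iG' by simp
  \<comment> \<open>The positive minimum of \<phi> survives mollification as m \<ge> \<mu> c, which
    permits division by m.\<close>
  obtain \<mu> where \<mu>: "\<mu> > 0" "\<And>x. x \<in> closure \<Omega> \<Longrightarrow> \<phi> x \<ge> \<mu>"
  proof -
    have "compact (closure \<Omega>)" "closure \<Omega> \<noteq> {}" using \<Omega> K False by (auto simp: compact_closure)
    then obtain x0 where "x0 \<in> closure \<Omega>" "\<forall>y\<in>closure \<Omega>. \<phi> x0 \<le> \<phi> y"
      using continuous_attains_inf \<phi>(1) by blast
    then show ?thesis using that[of "\<phi> x0"] \<phi>(2) by blast
  qed
  obtain Q where Q: "\<And>x. x \<in> K \<Longrightarrow> (\<psi> x)\<^sup>2 \<le> Q"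
  proof -
    have "compact ((\<lambda>x. (\<psi> x)\<^sup>2) ` K)"
      using K continuous_on_subset[OF c\<psi>] by (intro compact_continuous_image continuous_intros) auto
    then show ?thesis using that bounded_iff compact_imp_bounded
      by (metis (no_types, lifting) image_eqI real_norm_def abs_le_D1)
  qed
  obtain \<epsilon> where \<epsilon>: "\<epsilon> > 0" "(\<Union>x\<in>K. cball x \<epsilon>) \<subseteq> \<Omega>"
    using compact_subset_open_imp_cball_epsilon_subset[OF K(1) \<Omega>(1) K(2)] by blast
  define K1 where "K1 = {x + y | x y. x \<in> K \<and> y \<in> cball 0 \<epsilon>}"
  have K1: "compact K1" unfolding K1_def by (intro compact_sums K compact_cball)
  have K1': "y \<in> K1" if "x \<in> K" "dist x y \<le> \<epsilon>" for x y
    unfolding K1_def using that by (intro CollectI exI[of _ x] exI[of _ "y - x"]) (auto simp: dist_norm norm_minus_commute)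
  have K1\<Omega>: "K1 \<subseteq> \<Omega>" 
  proof
    fix z assume "z \<in> K1"
    then obtain x y where "x \<in> K" "y \<in> cball 0 \<epsilon>" "z = x + y" by (auto simp: K1_def)
    then have "z \<in> (\<Union>x\<in>K. cball x \<epsilon>)" by (intro UN_I[of x]) (auto simp: dist_norm)
    then show "z \<in> \<Omega>" using \<epsilon>(2) by blast
  qed
  \<comment> \<open>A neighbourhood of half the width: for radii r \<le> \<epsilon>/2 the balls
    around its points remain in \<open>K1\<close>, where the moduli of continuity are
    uniform.\<close>
  define U where "U = (\<Union>x\<in>K. ball x (\<epsilon> / 2))"
  have U: "open U" "K \<subseteq> U" unfolding U_def using \<epsilon>(1) by auto
  define I where "I = (LINT y|lebesgue_on \<Omega>. norm (G y))"
  define J where "J = (LINT x:K|lborel. (\<psi> x)\<^sup>2)"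
  let ?R = "LINT x:K|lborel. (norm (\<Psi> x - \<psi> x *\<^sub>R V x))\<^sup>2"
  \<comment> \<open>The error is \<omega> times a quantity free of the mollification radius: the
    mass \<open>c\<close> of the bump enters both the lower bound for m and the L^1 bound for
    \<open>N\<close>, and cancels.\<close>
  have main: "(LINT x:K|lborel. g x * (\<psi> x)\<^sup>2) \<le> ?R + \<omega> * (J + 2 * Q * I / \<mu>)" if \<omega>: "\<omega> > 0" for \<omega>
  proof -
    obtain d1 where d1: "d1 > 0" "\<And>x y. x \<in> K1 \<Longrightarrow> y \<in> K1 \<Longrightarrow> dist x y < d1 \<Longrightarrow> dist (V x) (V y) < \<omega>"
      using uniform_modulus[OF K1 continuous_on_subset[OF V K1\<Omega>] \<omega>] by blast
    obtain d2 where d2: "d2 > 0" "\<And>x y. x \<in> K1 \<Longrightarrow> y \<in> K1 \<Longrightarrow> dist x y < d2 \<Longrightarrow> dist (g x) (g y) < \<omega>"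
      using uniform_modulus[OF K1 continuous_on_subset[OF g K1\<Omega>] \<omega>] by blast
    define r where "r = min (\<epsilon> / 2) (min d1 d2 / 2)"
    have r: "r > 0" "r \<le> \<epsilon> / 2" "r < d1" "r < d2" using \<epsilon> d1(1) d2(1) by (auto simp: r_def min_def)
    have UK1: "y \<in> K1" if "x \<in> U" "y \<in> cball x r" for x y
    proof -
      obtain z where z: "z \<in> K" "dist z x < \<epsilon> / 2" using \<open>x \<in> U\<close> by (auto simp: U_def)
      then have "dist z y \<le> \<epsilon>" using that r(2) dist_triangle[of z y x] by simp
      then show ?thesis using K1' z by blast
    qed
    have cb: "cball x r \<subseteq> \<Omega>" if "x \<in> U" for x using UK1[OF that] K1\<Omega> by blast
    have U\<Omega>: "U \<subseteq> \<Omega>" using cb r(1) by force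
    define m where "m = (\<lambda>x. LINT y|lebesgue_on \<Omega>. \<phi> y * bump r (x - y))"
    define M where "M = (\<lambda>x. \<chi> i. LINT y|lebesgue_on \<Omega>. G y $ i * bump r (x - y))"
    define T where "T = (\<lambda>x. LINT y|lebesgue_on \<Omega>. trace (H y) * bump r (x - y))"
    define N where "N = (\<lambda>x. LINT y|lebesgue_on \<Omega>. norm (G y) * bump r (x - y))"
    define c where "c = (LINT z|lborel. bump r (z::real^'n))"
    have c: "c > 0" unfolding c_def by (rule bump_mass_pos[OF r(1)])
    have gl: "gradient_laplacian_on U m M T"
      unfolding m_def M_def T_def by (rule gradient_laplacian_on_mollified[OF S p W r(1) cb])
    note glD = gradient_laplacian_onD[OF gl]
    note int = integrable_scaleR_continuous_shift[OF S _ continuous_on_bump(1), simplified]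
    have mlow: "m x \<ge> \<mu> * c" if "x \<in> U" for x
    proof -
      have "\<mu> * c = (LINT y|lebesgue_on \<Omega>. \<mu> * bump r (x - y))"
        using bump_mass[OF r(1) cb[OF that] mS] by (simp add: c_def)
      also have "\<dots> \<le> m x" unfolding m_def
      proof (rule integral_mono)
        have "finite_measure (lebesgue_on \<Omega>)"
          using S bounded_set_imp_lmeasurable finite_measure_lebesgue_on by blast
        then interpret finite_measure "lebesgue_on \<Omega>" .
        show "integrable (lebesgue_on \<Omega>) (\<lambda>y. \<mu> * bump r (x - y))" by (rule int) simp
        show "integrable (lebesgue_on \<Omega>) (\<lambda>y. \<phi> y * bump r (x - y))" by (rule int[OF i\<phi>])
        show "\<mu> * bump r (x - y) \<le> \<phi> y * bump r (x - y)" if "y \<in> space (lebesgue_on \<Omega>)" for y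
          using \<mu>(2)[of y] that spc closure_subset[of \<Omega>] by (intro mult_right_mono bump_nonneg) auto
      qed
      finally show ?thesis .
    qed
    have mpos: "m x > 0" if "x \<in> U" for x
      using mlow[OF that] mult_pos_pos[OF \<mu>(1) c] by linarith
    have N0: "N x \<ge> 0" for x unfolding N_def by (simp add: bump_nonneg)
    \<comment> \<open>Freezing \<open>V\<close> and \<open>g\<close> at the centre \<open>x\<close>
      under the kernel costs \<omega> |G| and \<omega> \<phi>; averaging turns these into the two
      error terms.\<close>
    have key: "- T x - 2 * (V x \<bullet> M x) \<ge> (g x - \<omega>) * m x - 2 * \<omega> * N x" if x: "x \<in> U" for x
    proof -
      have VM: "V x \<bullet> M x = (LINT y|lebesgue_on \<Omega>. (V x \<bullet> G y) * bump r (x - y))"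
        unfolding M_def inner_vec_def using int[OF iG]
        by (simp add: sum_distrib_right mult.assoc Bochner_Integration.integral_sum)
      have iVG: "integrable (lebesgue_on \<Omega>) (\<lambda>y. V x \<bullet> G y)" using iG' by simp
      have "(g x - \<omega>) * m x - 2 * \<omega> * N x
          = (LINT y|lebesgue_on \<Omega>. (g x - \<omega>) * (\<phi> y * bump r (x - y)) - 2 * \<omega> * (norm (G y) * bump r (x - y)))"
        unfolding m_def N_def using int[OF i\<phi>] int[OF iN] by simp
      also have "\<dots> \<le> (LINT y|lebesgue_on \<Omega>. - (trace (H y) * bump r (x - y)) - 2 * ((V x \<bullet> G y) * bump r (x - y)))"
      proof (rule integral_mono_AE)
        show "integrable (lebesgue_on \<Omega>) (\<lambda>y. (g x - \<omega>) * (\<phi> y * bump r (x - y)) - 2 * \<omega> * (norm (G y) * bump r (x - y)))"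
          using int[OF i\<phi>] int[OF iN] by simp
        show "integrable (lebesgue_on \<Omega>) (\<lambda>y. - (trace (H y) * bump r (x - y)) - 2 * ((V x \<bullet> G y) * bump r (x - y)))"
          using int[OF iT] int[OF iVG] by simp
        show "AE y in lebesgue_on \<Omega>. (g x - \<omega>) * (\<phi> y * bump r (x - y)) - 2 * \<omega> * (norm (G y) * bump r (x - y))
            \<le> - (trace (H y) * bump r (x - y)) - 2 * ((V x \<bullet> G y) * bump r (x - y))"
          using ineq
        proof (rule AE_mp, intro AE_I2 impI)
          fix y assume y: "y \<in> space (lebesgue_on \<Omega>)" and *: "- trace (H y) - 2 * (V y \<bullet> G y) \<ge> g y * \<phi> y"
          show "(g x - \<omega>) * (\<phi> y * bump r (x - y)) - 2 * \<omega> * (norm (G y) * bump r (x - y))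
            \<le> - (trace (H y) * bump r (x - y)) - 2 * ((V x \<bullet> G y) * bump r (x - y))"
          proof (cases "norm (x - y) > r")
            case True
            then show ?thesis using bump_eq_0[OF _ r(1), of "x - y"] by simp
          next
            case False
            then have d: "dist x y \<le> r" by (simp add: dist_norm)
            then have "x \<in> K1" "y \<in> K1" using UK1[OF x] r(1) by auto
            then have "dist (V x) (V y) < \<omega>" "dist (g x) (g y) < \<omega>" using d1(2) d2(2) d r by auto
            then have Vd: "norm (V x - V y) \<le> \<omega>" and gd: "g x - \<omega> \<le> g y" by (auto simp: dist_norm)
            have "(V x - V y) \<bullet> G y \<le> norm (V x - V y) * norm (G y)" by (rule norm_cauchy_schwarz)
            also have "\<dots> \<le> \<omega> * norm (G y)" using Vd by (rule mult_right_mono) simp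
            finally have 1: "V x \<bullet> G y \<le> V y \<bullet> G y + \<omega> * norm (G y)" by (simp add: inner_diff_left)
            have "\<phi> y > 0" using y spc closure_subset \<phi>(2) by blast
            then have "(g x - \<omega>) * \<phi> y \<le> g y * \<phi> y" using gd by (intro mult_right_mono) auto
            with 1 * have "(g x - \<omega>) * \<phi> y - 2 * \<omega> * norm (G y) \<le> - trace (H y) - 2 * (V x \<bullet> G y)" by linarith
            from mult_right_mono[OF this bump_nonneg[of r "x - y"]] show ?thesis
              by (simp add: algebra_simps)
          qed
        qed
      qed
      also have "\<dots> = - T x - 2 * (V x \<bullet> M x)"
        unfolding VM T_def using int[OF iT] int[OF iVG] by simp
      finally show ?thesis .
    qed
    define a where "a = (\<lambda>x. (\<psi> x)\<^sup>2 / m x)"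
    define A where "A = (\<lambda>x. (2 * \<psi> x / m x) *\<^sub>R \<Psi> x - ((\<psi> x)\<^sup>2 / (m x)\<^sup>2) *\<^sub>R M x)"
    have dA: "GDERIV a x :> A x" if "x \<in> U" for x
    proof -
      have "GDERIV (\<lambda>x. inverse (m x)) x :> - (inverse (m x))\<^sup>2 *\<^sub>R M x"
        using GDERIV_inverse[OF glD(1)[OF that]] mpos[OF that] by simp
      moreover have "GDERIV (\<lambda>x. \<psi> x * \<psi> x) x :> \<psi> x *\<^sub>R \<Psi> x + \<psi> x *\<^sub>R \<Psi> x"
        using GDERIV_mult \<psi>(1) U\<Omega> that by blast
      ultimately have "GDERIV (\<lambda>x. (\<psi> x * \<psi> x) * inverse (m x)) x :>
         (\<psi> x * \<psi> x) *\<^sub>R (- (inverse (m x))\<^sup>2 *\<^sub>R M x) + inverse (m x) *\<^sub>R (\<psi> x *\<^sub>R \<Psi> x + \<psi> x *\<^sub>R \<Psi> x)"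
        by (rule GDERIV_mult[rotated])
      moreover have "(\<psi> x * \<psi> x) *\<^sub>R (- (inverse (m x))\<^sup>2 *\<^sub>R M x) + inverse (m x) *\<^sub>R (\<psi> x *\<^sub>R \<Psi> x + \<psi> x *\<^sub>R \<Psi> x) = A x"
        by (simp add: A_def field_simps power2_eq_square flip: scaleR_add_left)
      ultimately show ?thesis by (simp add: a_def divide_inverse power2_eq_square)
    qed
    have c\<psi>U: "continuous_on U \<psi>" "continuous_on U \<Psi>" "continuous_on U V" "continuous_on U g"
      using continuous_on_subset[OF _ U\<Omega>] c\<psi> \<psi>(2) V g by auto
    have m0: "\<forall>x\<in>U. m x \<noteq> 0" "\<forall>x\<in>U. (m x)\<^sup>2 \<noteq> 0" using mpos by fastforce+
    have cA: "continuous_on U A" unfolding A_def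
      by (intro continuous_intros c\<psi>U glD(2,3) m0)
    have ca: "continuous_on U a" by (rule gderiv_continuous_on[OF dA])
    have green: "(LINT x:K|lborel. A x \<bullet> M x + a x * T x) = 0"
      using \<psi>(3) U\<Omega> by (intro green_laplacian[OF gl U(1) K(1) U(2) dA cA]) (auto simp: a_def)
    have cN: "continuous_on U N" unfolding N_def by (rule continuous_on_mollified[OF S iN])
    have intK: "set_integrable lborel K f" if "continuous_on U f" for f :: "real^'n \<Rightarrow> real"
      unfolding set_integrable_def using K(1) continuous_on_subset[OF that U(2)] by (rule borel_integrable_compact)
    have pw: "g x * (\<psi> x)\<^sup>2 \<le> (norm (\<Psi> x - \<psi> x *\<^sub>R V x))\<^sup>2 + \<omega> * (\<psi> x)\<^sup>2 + (2 * \<omega> * Q / (\<mu> * c)) * N x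
        - (A x \<bullet> M x + a x * T x)" if x: "x \<in> K" for x
    proof -
      have xU: "x \<in> U" using x U by blast
      have mx: "m x > 0" by (rule mpos[OF xU])
      have a0: "a x \<ge> 0" using mx by (simp add: a_def)
      \<comment> \<open>With y = \<nabla>\<psi> - \<psi> V and z = (\<psi>/m) \<nabla>m, the square
        |y - z|^2 \<ge> 0 absorbs both the quadratic term of \<open>A\<close> and the drift term.
        This is how \<nabla>\<psi> acquires the correction -\<psi> V.\<close>
      let ?z = "(\<psi> x / m x) *\<^sub>R M x"
      let ?y = "\<Psi> x - \<psi> x *\<^sub>R V x"
      have "0 \<le> (norm (?y - ?z))\<^sup>2" by simp
      then have 1: "2 * (?y \<bullet> ?z) - ?z \<bullet> ?z \<le> (norm ?y)\<^sup>2"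
        by (simp add: power2_norm_eq_inner inner_diff_left inner_diff_right inner_commute)
      have 2: "A x \<bullet> M x - a x * (2 * (V x \<bullet> M x)) = 2 * (?y \<bullet> ?z) - ?z \<bullet> ?z"
        by (simp add: A_def a_def inner_diff_left inner_diff_right power2_eq_square inner_commute algebra_simps)
      have "a x * ((g x - \<omega>) * m x - 2 * \<omega> * N x) \<le> a x * (- T x - 2 * (V x \<bullet> M x))"
        by (rule mult_left_mono[OF key[OF xU] a0])
      moreover have "a x * ((g x - \<omega>) * m x - 2 * \<omega> * N x) = g x * (\<psi> x)\<^sup>2 - \<omega> * (\<psi> x)\<^sup>2 - 2 * \<omega> * (a x * N x)"
        using mx by (simp add: a_def field_simps)
      moreover have "a x * N x \<le> Q / (\<mu> * c) * N x"
      proof (rule mult_right_mono[OF _ N0])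
        have "a x \<le> (\<psi> x)\<^sup>2 / (\<mu> * c)" unfolding a_def
          using mlow[OF xU] \<mu>(1) c by (intro divide_left_mono) (auto simp: mx)
        also have "\<dots> \<le> Q / (\<mu> * c)" using Q[OF x] \<mu>(1) c by (intro divide_right_mono) auto
        finally show "a x \<le> Q / (\<mu> * c)" .
      qed
      then have "2 * \<omega> * (a x * N x) \<le> 2 * \<omega> * (Q / (\<mu> * c) * N x)" using \<omega> by (intro mult_left_mono) auto
      ultimately show ?thesis using 1 2 by (simp add: algebra_simps)
    qed
    have i1: "set_integrable lborel K (\<lambda>x. g x * (\<psi> x)\<^sup>2)"
      by (intro intK continuous_intros c\<psi>U)
    have i2: "set_integrable lborel K (\<lambda>x. (norm (\<Psi> x - \<psi> x *\<^sub>R V x))\<^sup>2)"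
      by (intro intK continuous_intros c\<psi>U)
    have i3: "set_integrable lborel K (\<lambda>x. \<omega> * (\<psi> x)\<^sup>2)"
      by (intro intK continuous_intros c\<psi>U)
    have i4: "set_integrable lborel K (\<lambda>x. (2 * \<omega> * Q / (\<mu> * c)) * N x)"
      by (intro intK continuous_on_mult continuous_on_const cN)
    have i5: "set_integrable lborel K (\<lambda>x. A x \<bullet> M x + a x * T x)"
      by (intro intK continuous_on_add continuous_on_mult continuous_on_inner cA ca glD(3,4))
    have "(LINT x:K|lborel. g x * (\<psi> x)\<^sup>2) \<le> (LINT x:K|lborel. (norm (\<Psi> x - \<psi> x *\<^sub>R V x))\<^sup>2 + \<omega> * (\<psi> x)\<^sup>2
        + (2 * \<omega> * Q / (\<mu> * c)) * N x - (A x \<bullet> M x + a x * T x))"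
      by (intro set_integral_mono i1 set_integral_diff set_integral_add i2 i3 i4 i5 pw)
    also have "\<dots> = ?R + \<omega> * J + (2 * \<omega> * Q / (\<mu> * c)) * (LINT x:K|lborel. N x) - 0"
      unfolding J_def using i2 i3 i4 i5 green
      by (simp add: set_integral_diff set_integral_add)
    also have "(2 * \<omega> * Q / (\<mu> * c)) * (LINT x:K|lborel. N x) \<le> (2 * \<omega> * Q / (\<mu> * c)) * (c * I)"
    proof (rule mult_left_mono)
      show "(LINT x:K|lborel. N x) \<le> c * I" unfolding N_def c_def I_def
        by (rule integral_mollified_le[OF S iN _ K(1) r(1)]) simp
      have "0 \<le> Q" using Q False by (meson all_not_in_conv order_trans zero_le_power2)
      then show "0 \<le> 2 * \<omega> * Q / (\<mu> * c)" using \<omega> \<mu>(1) c by simp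
    qed
    finally show ?thesis using c \<mu>(1) by (simp add: algebra_simps)
  qed
  let ?C = "J + 2 * Q * I / \<mu>"
  show ?thesis
  proof (rule field_le_epsilon)
    fix e :: real assume e: "e > 0"
    let ?w = "e / (\<bar>?C\<bar> + 1)"
    have w: "?w > 0" using e by simp
    have "?C \<le> \<bar>?C\<bar> + 1" by (rule add_increasing2[OF zero_le_one abs_ge_self])
    then have "?w * ?C \<le> ?w * (\<bar>?C\<bar> + 1)" using w by (intro mult_left_mono) simp_all
    also have "\<dots> = e"
      using abs_ge_zero[of ?C] by (simp add: add_nonneg_eq_0_iff del: abs_ge_zero)
    finally show "(LINT x:K|lborel. g x * (\<psi> x)\<^sup>2) \<le> ?R + e" using main[OF w] by linarith
  qed
qed

text \<open>The coefficient \<open>b\<close> need not even be measurable, but the equation makes \<open>b |\<nabla>u|\<^sup>2\<close>, hence \<open>b \<nabla>u\<close>, continuous.\<close>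

lemma continuous_on_scaled_gradient:
  fixes b :: "'a::euclidean_space \<Rightarrow> real" and v :: "'a \<Rightarrow> 'a"
  assumes \<Omega>: "open \<Omega>" and v: "continuous_on \<Omega> v" and c: "continuous_on \<Omega> (\<lambda>x. b x * (norm (v x))\<^sup>2)"
    and b: "\<And>x. x \<in> \<Omega> \<Longrightarrow> \<bar>b x\<bar> \<le> B"
  shows "continuous_on \<Omega> (\<lambda>x. b x *\<^sub>R v x)"
  unfolding continuous_on_eq_continuous_at[OF \<Omega>]
proof
  fix x assume x: "x \<in> \<Omega>"
  have vx: "isCont v x" and cx: "isCont (\<lambda>x. b x * (norm (v x))\<^sup>2) x"
    using v c x \<Omega> by (simp_all add: continuous_on_eq_continuous_at)
  show "isCont (\<lambda>x. b x *\<^sub>R v x) x"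
  proof (cases "v x = 0")
    case True
    have "((\<lambda>y. b y *\<^sub>R v y) \<longlongrightarrow> 0) (at x)"
    proof (rule Lim_null_comparison)
      have "\<forall>\<^sub>F y in at x. y \<in> \<Omega>" using \<Omega> x eventually_at_topological by blast
      then show "\<forall>\<^sub>F y in at x. norm (b y *\<^sub>R v y) \<le> B * norm (v y)"
        by (rule eventually_mono) (use b in \<open>auto intro!: mult_right_mono\<close>)
      show "((\<lambda>y. B * norm (v y)) \<longlongrightarrow> 0) (at x)"
        using vx True by (auto simp: isCont_def intro!: tendsto_eq_intros)
    qed
    then show ?thesis using True by (simp add: isCont_def)
  next
    case False
    \<comment> \<open>Where \<open>v\<close> does not vanish, \<open>b v\<close> is recovered by
      division. The formula also agrees with \<open>b v\<close> at zeros of \<open>v\<close>, since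
      the vector factor is zero there.\<close>
    have "isCont (\<lambda>y. (b y * (norm (v y))\<^sup>2 / (norm (v y))\<^sup>2) *\<^sub>R v y) x"
    proof (intro isCont_scaleR isCont_divide cx vx)
      show "isCont (\<lambda>y. (norm (v y))\<^sup>2) x" using vx by (intro continuous_intros)
    qed (use False in simp)
    moreover have "(\<lambda>y. (b y * (norm (v y))\<^sup>2 / (norm (v y))\<^sup>2) *\<^sub>R v y) = (\<lambda>y. b y *\<^sub>R v y)"
    proof
      show "(b y * (norm (v y))\<^sup>2 / (norm (v y))\<^sup>2) *\<^sub>R v y = b y *\<^sub>R v y" for y
        by (cases "v y = 0") auto
    qed
    ultimately show ?thesis by (simp only:)
  qed
qed

text \<open>\<open>u\<close> is a positive supersolution of -\<Delta>u = \<lambda>u, so \<lambda>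
  cannot exceed the first Dirichlet eigenvalue. Testing with \<zeta>^2/u and completing the square
  gives \<lambda> \<integral> \<zeta>^2 \<le> \<integral> |\<nabla>\<zeta>|^2 for one fixed cutoff
  \<zeta>; the bound is its Rayleigh quotient \<open>B / A\<close>.\<close>

lemma lambda_bound:
  fixes \<Omega> :: "'a::euclidean_space set"
  assumes "open \<Omega>" "\<Omega> \<noteq> {}"
  shows "\<exists>\<Lambda>\<ge>0. \<forall>u G L lam. gradient_laplacian_on \<Omega> u G L \<longrightarrow> (\<forall>x\<in>\<Omega>. u x > 0 \<and> - L x \<ge> lam * u x) \<longrightarrow> lam \<le> \<Lambda>"
proof -
  obtain c where "c \<in> \<Omega>" using assms(2) by blast
  then obtain \<rho> where \<rho>: "\<rho> > 0" "cball c \<rho> \<subseteq> \<Omega>" using assms(1) open_contains_cball by blast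
  let ?K = "cball c \<rho>"
  let ?q = "\<lambda>x. (norm (x - c))\<^sup>2 + (- \<rho>\<^sup>2)"
  define \<zeta> where "\<zeta> = (\<lambda>x. max 0 (- ?q x) ^ Suc 1)"
  define X where "X = (\<lambda>x. (- 2 * max 0 (- ?q x)) *\<^sub>R (2 *\<^sub>R (x - c)))"
  have \<zeta>': "GDERIV \<zeta> x :> X x" for x
  proof -
    have "((\<lambda>s::real. - s) has_real_derivative - 1) (at s)" for s by (auto intro!: derivative_eq_intros)
    from DERIV_chain2[OF DERIV_pos_part_power[OF order_refl] this]
    have "((\<lambda>s::real. max 0 (- s) ^ Suc 1) has_real_derivative - 2 * max 0 (- s)) (at s)" for s by simp
    from GDERIV_DERIV_compose[OF gradient_laplacian_onD(1)[OF gradient_laplacian_on_shifted_square UNIV_I] this]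
    show ?thesis unfolding \<zeta>_def X_def .
  qed
  have cX: "continuous_on S X" for S unfolding X_def by (intro continuous_intros)
  have c\<zeta>: "continuous_on S \<zeta>" for S unfolding \<zeta>_def by (intro continuous_intros)
  have \<zeta>0: "\<zeta> x = 0" if "x \<notin> ?K" for x
  proof -
    have "\<rho>\<^sup>2 \<le> (norm (x - c))\<^sup>2" using that \<rho> by (intro power_mono) (auto simp: dist_norm norm_minus_commute)
    then show ?thesis by (simp add: \<zeta>_def)
  qed
  define A where "A = (LINT x:?K|lborel. (\<zeta> x)\<^sup>2)"
  define B where "B = (LINT x:?K|lborel. (norm (X x))\<^sup>2)"
  have A: "A > 0"
  proof -
    \<comment> \<open>On the ball of half the radius, \<rho>^2 - |x - c|^2 is at least 3/4 \<rho>^2,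
      and \<zeta>^2 is its fourth power.\<close>
    let ?m = "(3 / 4 * \<rho>\<^sup>2) ^ 4"
    have "0 < ?m * measure lborel (ball c (\<rho> / 2))" using \<rho> content_ball_pos[of "\<rho> / 2" c] by simp
    also have "\<dots> = (LINT x|lborel. indicator (ball c (\<rho> / 2)) x * ?m)" by (simp add: mult.commute)
    also have "\<dots> \<le> A" unfolding A_def set_lebesgue_integral_def
    proof (rule integral_mono)
      have "emeasure lborel (ball c (\<rho> / 2)) < \<infinity>" by (rule emeasure_bounded_finite) simp
      then show "integrable lborel (\<lambda>x. indicator (ball c (\<rho> / 2)) x * ?m)"
        by (intro integrable_mult_left integrable_real_indicator) auto
      show "integrable lborel (\<lambda>x. indicator ?K x *\<^sub>R (\<zeta> x)\<^sup>2)"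
        by (intro borel_integrable_compact compact_cball continuous_intros c\<zeta>)
      show "indicator (ball c (\<rho> / 2)) x * ?m \<le> indicator ?K x *\<^sub>R (\<zeta> x)\<^sup>2" for x
      proof (cases "x \<in> ball c (\<rho> / 2)")
        case True
        then have "x \<in> ?K" using \<rho> by auto
        have "(norm (x - c))\<^sup>2 \<le> (\<rho> / 2)\<^sup>2" using True by (intro power_mono) (auto simp: dist_norm norm_minus_commute)
        then have "3 / 4 * \<rho>\<^sup>2 \<le> - ?q x" by (simp add: power_divide)
        then have "3 / 4 * \<rho>\<^sup>2 \<le> max 0 (- ?q x)" by (rule max.coboundedI2)
        then have "?m \<le> max 0 (- ?q x) ^ 4" by (intro power_mono) auto
        also have "max 0 (- ?q x) ^ 4 = (\<zeta> x)\<^sup>2" by (simp add: \<zeta>_def power2_eq_square power4_eq_xxxx)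
        finally show ?thesis using True \<open>x \<in> ?K\<close> by simp
      qed auto
    qed
    finally show ?thesis .
  qed
  have B: "B \<ge> 0" unfolding B_def set_lebesgue_integral_def by (intro integral_nonneg_AE AE_I2) simp
  show ?thesis
  proof (intro exI[of _ "B / A"] conjI allI impI)
    show "0 \<le> B / A" using A B by simp
    fix u G L lam assume u: "gradient_laplacian_on \<Omega> u G L" and ineq: "\<forall>x\<in>\<Omega>. u x > 0 \<and> - L x \<ge> lam * u x"
    note uD = gradient_laplacian_onD[OF u]
    have u0: "\<forall>x\<in>\<Omega>. u x \<noteq> 0" "\<forall>x\<in>\<Omega>. (u x)\<^sup>2 \<noteq> 0" using ineq by fastforce+
    define a where "a = (\<lambda>x. (\<zeta> x)\<^sup>2 / u x)"
    define a' where "a' = (\<lambda>x. (2 * \<zeta> x / u x) *\<^sub>R X x - ((\<zeta> x)\<^sup>2 / (u x)\<^sup>2) *\<^sub>R G x)"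
    have da: "GDERIV a x :> a' x" if "x \<in> \<Omega>" for x
    proof -
      have "GDERIV (\<lambda>x. inverse (u x)) x :> - (inverse (u x))\<^sup>2 *\<^sub>R G x"
        using GDERIV_inverse[OF uD(1)[OF that]] u0(1) that by simp
      from GDERIV_mult[OF GDERIV_mult[OF \<zeta>' \<zeta>'] this]
      have "GDERIV (\<lambda>x. (\<zeta> x * \<zeta> x) * inverse (u x)) x :>
         (\<zeta> x * \<zeta> x) *\<^sub>R (- (inverse (u x))\<^sup>2 *\<^sub>R G x) + inverse (u x) *\<^sub>R (\<zeta> x *\<^sub>R X x + \<zeta> x *\<^sub>R X x)" .
      moreover have "(\<zeta> x * \<zeta> x) *\<^sub>R (- (inverse (u x))\<^sup>2 *\<^sub>R G x) + inverse (u x) *\<^sub>R (\<zeta> x *\<^sub>R X x + \<zeta> x *\<^sub>R X x) = a' x"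
        by (simp add: a'_def field_simps power2_eq_square flip: scaleR_add_left)
      ultimately show ?thesis by (simp add: a_def divide_inverse power2_eq_square)
    qed
    have ca': "continuous_on \<Omega> a'" unfolding a'_def by (intro continuous_intros c\<zeta> cX uD(2,3) u0)
    have ca: "continuous_on \<Omega> a" by (rule gderiv_continuous_on[OF da])
    have green: "(LINT x:?K|lborel. a' x \<bullet> G x + a x * L x) = 0"
      using \<zeta>0 by (intro green_laplacian[OF u assms(1) compact_cball \<rho>(2) da ca']) (auto simp: a_def)
    have pw: "lam * (\<zeta> x)\<^sup>2 \<le> (norm (X x))\<^sup>2 - (a' x \<bullet> G x + a x * L x)" if "x \<in> ?K" for x
    proof -
      have x: "u x > 0" "- L x \<ge> lam * u x" using ineq \<rho>(2) that by auto
      have "a x * (lam * u x) \<le> a x * (- L x)" using x by (intro mult_left_mono) (auto simp: a_def)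
      moreover have "a x * (lam * u x) = lam * (\<zeta> x)\<^sup>2" using x by (simp add: a_def)
      moreover have "a' x \<bullet> G x \<le> (norm (X x))\<^sup>2"
      proof -
        let ?z = "(\<zeta> x / u x) *\<^sub>R G x"
        have "0 \<le> (norm (X x - ?z))\<^sup>2" by simp
        then have "2 * (X x \<bullet> ?z) - ?z \<bullet> ?z \<le> (norm (X x))\<^sup>2"
          by (simp add: power2_norm_eq_inner inner_diff_left inner_diff_right inner_commute)
        moreover have "a' x \<bullet> G x = 2 * (X x \<bullet> ?z) - ?z \<bullet> ?z"
          by (simp add: a'_def inner_diff_left inner_diff_right power2_eq_square inner_commute algebra_simps)
        ultimately show ?thesis by simp
      qed
      ultimately show ?thesis by simp
    qed
    have cg: "continuous_on ?K (\<lambda>x. a' x \<bullet> G x + a x * L x)"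
      by (rule continuous_on_subset[OF _ \<rho>(2)])
         (intro continuous_on_add continuous_on_inner continuous_on_mult ca ca' uD(3,4))
    have i1: "set_integrable lborel ?K (\<lambda>x. lam * (\<zeta> x)\<^sup>2)"
      by (intro set_integrable_compact compact_cball continuous_intros c\<zeta>)
    have i2: "set_integrable lborel ?K (\<lambda>x. (norm (X x))\<^sup>2)"
      by (intro set_integrable_compact compact_cball continuous_intros cX)
    note i3 = set_integrable_compact[OF compact_cball cg]
    have "lam * A = (LINT x:?K|lborel. lam * (\<zeta> x)\<^sup>2)" by (simp add: A_def)
    also have "\<dots> \<le> (LINT x:?K|lborel. (norm (X x))\<^sup>2 - (a' x \<bullet> G x + a x * L x))"
      by (intro set_integral_mono i1 set_integral_diff(1) i2 i3 pw)
    also have "\<dots> = B" using set_integral_diff(2)[OF i2 i3] green by (simp add: B_def)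
    finally show "lam \<le> B / A" using A by (simp add: pos_le_divide_eq)
  qed
qed

section \<open>The energy estimate\<close>

text \<open>The inequality between \<open>F\<close> and \<open>H\<close> holds for \<open>F = e\<^bsup>\<alpha>t\<^esup>\<close> and \<open>H = \<theta> e\<^bsup>2\<alpha>t\<^esup>\<close>, which do not vanish for \<open>t \<le> 1\<close>.
  With \<open>y = e\<^bsup>\<gamma>(1-t)\<^esup>\<close> and the cutoff \<open>z = (1 - y)\<^sub>+\<close>, the error \<open>(z\<^sup>2)'\<close> caused by \<open>F = e\<^bsup>\<alpha>t\<^esup> z\<^sup>2\<close> is absorbed by the
  decaying term \<open>A y z\<^sup>2\<close> in \<open>H\<close>.\<close>

lemma test_profiles:
  fixes \<alpha> c :: real
  assumes \<alpha>: "\<alpha> > 0" and c: "c > 0" "c \<le> 2 * \<alpha>"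
  obtains F F' H H' :: "real \<Rightarrow> real" and \<kappa> C where
    "\<And>t. (F has_real_derivative F' t) (at t)" "continuous_on UNIV F'"
    "\<And>t. (H has_real_derivative H' t) (at t)" "continuous_on UNIV H'"
    "\<And>t. t \<le> 1 \<Longrightarrow> F t = 0" "\<And>t. t \<le> 1 \<Longrightarrow> H t = 0"
    "\<And>t b. (\<alpha> - b)\<^sup>2 + c \<le> 2 * \<alpha> - b \<Longrightarrow> 0 \<le> b \<Longrightarrow> (F' t - b * F t)\<^sup>2 \<le> H' t - b * H t"
    "\<kappa> > 0" "C \<ge> 0" "\<And>t. \<kappa> * exp (2 * \<alpha> * t) - C \<le> (F t)\<^sup>2 - H t"
proof -
  \<comment> \<open>Chosen so that 2s (2\<alpha> - b) \<le> c for b \<ge> 0, hence (\<alpha> - b)^2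
    \<le> (1 - 2s)(2\<alpha> - b). One s of this margin remains in \<theta> = 1 - s; the other pays
    for the factor 1 + s from Young's inequality, as (1 + s)(1 - 2s) \<le> 1 - s.\<close>
  define s where "s = c / (4 * \<alpha>)"
  have s: "s > 0" "s \<le> 1 / 2" using \<alpha> c by (auto simp: s_def field_simps)
  define \<theta> where "\<theta> = 1 - s"
  have \<theta>: "\<theta> > 0" using s by (simp add: \<theta>_def)
  \<comment> \<open>Since 2\<alpha> - b \<ge> c, the decay of y at rate c/2 leaves at least \<gamma>
    A y z^2 in H' - b H, up to the common exponential. \<open>A\<close> is the constant with (1 +
    1/s)(2\<gamma> y z)^2 = \<gamma> A y^2 z^2, which is no larger because y \<le> 1 wherever z is
    nonzero.\<close>
  define \<gamma> where "\<gamma> = c / 2"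
  have \<gamma>: "\<gamma> > 0" using c by (simp add: \<gamma>_def)
  define A where "A = 2 * c * (1 + 1 / s)"
  have A: "A > 0" using c s by (simp add: A_def add_pos_pos)
  define y where "y = (\<lambda>t::real. exp (\<gamma> * (1 - t)))"
  define z where "z = (\<lambda>t. max 0 (1 - y t))"
  have y0: "y t > 0" for t by (simp add: y_def)
  have z0: "z t \<ge> 0" "z t \<le> 1" for t using y0[of t] by (auto simp: z_def)
  have dy: "(y has_real_derivative - \<gamma> * y t) (at t)" for t
    unfolding y_def by (auto intro!: derivative_eq_intros)
  have dz: "((\<lambda>t. z t ^ Suc n) has_real_derivative real (Suc n) * z t ^ n * (\<gamma> * y t)) (at t)" if "n \<ge> 1" for n t
  proof -
    have "((\<lambda>t. 1 - y t) has_real_derivative \<gamma> * y t) (at t)"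
      using DERIV_diff[OF DERIV_const dy, of 1 t] by simp
    from DERIV_chain2[OF DERIV_pos_part_power[OF that] this] show ?thesis unfolding z_def .
  qed
  have dz2: "((\<lambda>t. (z t)\<^sup>2) has_real_derivative 2 * z t * (\<gamma> * y t)) (at t)" for t
    using dz[of 1 t] by (simp add: numeral_2_eq_2)
  have dz4: "((\<lambda>t. z t ^ 4) has_real_derivative 4 * z t ^ 3 * (\<gamma> * y t)) (at t)" for t
    using dz[of 3 t] by (simp add: eval_nat_numeral)
  have de: "((\<lambda>t. exp (a * t)) has_real_derivative a * exp (a * t)) (at t)" for a t :: real
    by (auto intro!: derivative_eq_intros)
  define F where "F = (\<lambda>t. exp (\<alpha> * t) * (z t)\<^sup>2)"
  define F' where "F' = (\<lambda>t. exp (\<alpha> * t) * (\<alpha> * (z t)\<^sup>2 + 2 * z t * (\<gamma> * y t)))"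
  define H where "H = (\<lambda>t. exp (2 * \<alpha> * t) * (\<theta> * z t ^ 4 + A * (y t * (z t)\<^sup>2)))"
  define H' where "H' = (\<lambda>t. exp (2 * \<alpha> * t) * (2 * \<alpha> * (\<theta> * z t ^ 4 + A * (y t * (z t)\<^sup>2))
      + \<theta> * (4 * z t ^ 3 * (\<gamma> * y t)) + A * (y t * (2 * z t * (\<gamma> * y t)) - \<gamma> * y t * (z t)\<^sup>2)))"
  have cy: "continuous_on UNIV y" unfolding y_def by (intro continuous_intros)
  have cz: "continuous_on UNIV z" unfolding z_def by (intro continuous_intros cy)
  \<comment> \<open>For y \<le> \<open>y1\<close> one has s z^4 - A y z^2 \<ge> s - (4s + A) y \<ge>
    s/2, which is \<kappa>; \<open>t0\<close> is the argument at which y equals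
    \<open>y1\<close>.\<close>
  define y1 where "y1 = s / (2 * (4 * s + A))"
  have y1: "y1 > 0" "y1 \<le> 1" using s A by (auto simp: y1_def field_simps)
  define t0 where "t0 = 1 - ln y1 / \<gamma>"
  define \<kappa> where "\<kappa> = s / 2"
  define C where "C = (\<kappa> + A) * exp (2 * \<alpha> * t0)"
  have \<kappa>: "\<kappa> > 0" using s by (simp add: \<kappa>_def)
  show ?thesis
  proof (rule that[of F F' H H' \<kappa> C])
    show "(F has_real_derivative F' t) (at t)" for t
      using DERIV_mult[OF de[of \<alpha> t] dz2[of t]] unfolding F_def F'_def by (simp add: algebra_simps)
    show "(H has_real_derivative H' t) (at t)" for t
      using DERIV_mult[OF de[of "2 * \<alpha>" t] DERIV_add[OF DERIV_cmult[OF dz4[of t], of \<theta>] DERIV_cmult[OF DERIV_mult[OF dy[of t] dz2[of t]], of A]]]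
      unfolding H_def H'_def by (simp add: algebra_simps)
    show "continuous_on UNIV F'" "continuous_on UNIV H'"
      unfolding F'_def H'_def by (intro continuous_intros cy cz)+
    have "z t = 0" if "t \<le> 1" for t using that \<gamma> by (simp add: z_def y_def)
    then show "t \<le> 1 \<Longrightarrow> F t = 0" "t \<le> 1 \<Longrightarrow> H t = 0" for t by (auto simp: F_def H_def)
    show "\<kappa> > 0" by (rule \<kappa>)
    show "C \<ge> 0" using \<kappa> A by (simp add: C_def)
    fix t
    let ?e = "exp (2 * \<alpha> * t)"
    have ee: "(exp (\<alpha> * t))\<^sup>2 = ?e" by (simp add: power2_eq_square flip: exp_add)
    show "(F' t - b * F t)\<^sup>2 \<le> H' t - b * H t" if b: "(\<alpha> - b)\<^sup>2 + c \<le> 2 * \<alpha> - b" "0 \<le> b" for b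
    proof -
      define x where "x = (\<alpha> - b) * (z t)\<^sup>2"
      define w where "w = 2 * z t * (\<gamma> * y t)"
      have cb: "c \<le> 2 * \<alpha> - b" using b(1) by (smt (verit) zero_le_power2)
      have "(x + w)\<^sup>2 \<le> (1 + s) * x\<^sup>2 + (1 + 1 / s) * w\<^sup>2"
      proof -
        have "0 \<le> (s * x - w)\<^sup>2 / s" using s by simp
        also have "\<dots> = s * x\<^sup>2 - 2 * x * w + w\<^sup>2 / s" using s by (simp add: power2_eq_square field_simps)
        finally show ?thesis by (simp add: power2_eq_square algebra_simps)
      qed
      moreover have "(1 + s) * x\<^sup>2 \<le> \<theta> * (2 * \<alpha> - b) * z t ^ 4"
      proof -
        have "(\<alpha> - b)\<^sup>2 \<le> (1 - 2 * s) * (2 * \<alpha> - b)"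
        proof -
          have "2 * s * (2 * \<alpha> - b) \<le> 2 * s * (2 * \<alpha>)" using b s by (intro mult_left_mono) auto
          also have "\<dots> = c" using \<alpha> by (simp add: s_def)
          finally show ?thesis using b by (simp add: algebra_simps)
        qed
        then have "(1 + s) * (\<alpha> - b)\<^sup>2 \<le> (1 + s) * ((1 - 2 * s) * (2 * \<alpha> - b))" using s by (intro mult_left_mono) auto
        also have "\<dots> = ((1 + s) * (1 - 2 * s)) * (2 * \<alpha> - b)" by simp
        also have "\<dots> \<le> \<theta> * (2 * \<alpha> - b)"
          using s cb c by (intro mult_right_mono) (auto simp: \<theta>_def algebra_simps)
        finally have "(1 + s) * (\<alpha> - b)\<^sup>2 * z t ^ 4 \<le> \<theta> * (2 * \<alpha> - b) * z t ^ 4"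
          by (rule mult_right_mono) simp
        then show ?thesis by (simp add: x_def power_mult_distrib flip: power_mult)
      qed
      moreover have "(1 + 1 / s) * w\<^sup>2 \<le> \<theta> * (4 * z t ^ 3 * (\<gamma> * y t))
         + A * (y t * (2 * z t * (\<gamma> * y t)) - \<gamma> * y t * (z t)\<^sup>2) + (2 * \<alpha> - b) * (A * (y t * (z t)\<^sup>2))"
      proof (cases "z t = 0")
        case False
        then have y: "y t \<le> 1" by (auto simp: z_def max_def split: if_splits)
        have "(1 + 1 / s) * w\<^sup>2 = A * \<gamma> * ((y t * (z t)\<^sup>2) * y t)"
          by (simp add: w_def A_def \<gamma>_def power2_eq_square)
        also have "\<dots> \<le> A * \<gamma> * ((y t * (z t)\<^sup>2) * 1)"
          using A \<gamma> y y0[of t] by (intro mult_left_mono) auto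
        also have "\<dots> = c * (A * (y t * (z t)\<^sup>2)) - A * (\<gamma> * y t * (z t)\<^sup>2)"
          by (simp add: \<gamma>_def algebra_simps)
        also have "c * (A * (y t * (z t)\<^sup>2)) \<le> (2 * \<alpha> - b) * (A * (y t * (z t)\<^sup>2))"
          using cb A y0[of t] by (intro mult_right_mono) auto
        finally have "(1 + 1 / s) * w\<^sup>2 \<le> (2 * \<alpha> - b) * (A * (y t * (z t)\<^sup>2)) - A * (\<gamma> * y t * (z t)\<^sup>2)" by simp
        moreover have "0 \<le> \<theta> * (4 * z t ^ 3 * (\<gamma> * y t))" using \<theta> z0[of t] \<gamma> y0[of t] by simp
        moreover have "0 \<le> A * (y t * (2 * z t * (\<gamma> * y t)))" using A z0[of t] \<gamma> y0[of t] by simp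
        ultimately show ?thesis by (simp add: algebra_simps)
      qed (simp add: w_def)
      ultimately have "(x + w)\<^sup>2 \<le> \<theta> * (2 * \<alpha> - b) * z t ^ 4 + (\<theta> * (4 * z t ^ 3 * (\<gamma> * y t))
         + A * (y t * (2 * z t * (\<gamma> * y t)) - \<gamma> * y t * (z t)\<^sup>2) + (2 * \<alpha> - b) * (A * (y t * (z t)\<^sup>2)))" by linarith
      then have "?e * (x + w)\<^sup>2 \<le> ?e * (\<theta> * (2 * \<alpha> - b) * z t ^ 4 + (\<theta> * (4 * z t ^ 3 * (\<gamma> * y t))
         + A * (y t * (2 * z t * (\<gamma> * y t)) - \<gamma> * y t * (z t)\<^sup>2) + (2 * \<alpha> - b) * (A * (y t * (z t)\<^sup>2))))"
        by (intro mult_left_mono) auto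
      moreover have "(F' t - b * F t)\<^sup>2 = ?e * (x + w)\<^sup>2"
      proof -
        have "F' t - b * F t = exp (\<alpha> * t) * (x + w)" by (simp add: F'_def F_def x_def w_def algebra_simps)
        then show ?thesis by (simp add: power_mult_distrib ee)
      qed
      moreover have "H' t - b * H t = ?e * (\<theta> * (2 * \<alpha> - b) * z t ^ 4 + (\<theta> * (4 * z t ^ 3 * (\<gamma> * y t))
         + A * (y t * (2 * z t * (\<gamma> * y t)) - \<gamma> * y t * (z t)\<^sup>2) + (2 * \<alpha> - b) * (A * (y t * (z t)\<^sup>2))))"
        by (simp add: H'_def H_def algebra_simps)
      ultimately show ?thesis by simp
    qed
    have FH: "(F t)\<^sup>2 - H t = ?e * (s * z t ^ 4 - A * (y t * (z t)\<^sup>2))"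
    proof -
      have "(F t)\<^sup>2 = ?e * z t ^ 4" by (simp add: F_def power_mult_distrib ee flip: power_mult)
      then show ?thesis by (simp add: H_def \<theta>_def algebra_simps)
    qed
    show "\<kappa> * ?e - C \<le> (F t)\<^sup>2 - H t"
    proof (cases "t \<ge> t0")
      case True
      have "y t \<le> y1"
      proof -
        have "\<gamma> * (1 - t) \<le> \<gamma> * (1 - t0)" using True \<gamma> by simp
        also have "\<dots> = ln y1" using \<gamma> by (simp add: t0_def)
        finally have "y t \<le> exp (ln y1)" by (simp add: y_def)
        then show ?thesis using y1 by simp
      qed
      then have y: "y t \<le> 1" using y1 by linarith
      then have z: "z t = 1 - y t" by (simp add: z_def)
      have "1 + real 4 * (- y t) \<le> (1 + (- y t)) ^ 4" using y by (intro Bernoulli_inequality) simp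
      then have "1 - 4 * y t \<le> z t ^ 4" by (simp add: z)
      then have "s * (1 - 4 * y t) \<le> s * z t ^ 4" using s by (intro mult_left_mono) auto
      moreover have "A * (y t * (z t)\<^sup>2) \<le> A * (y t * 1)"
        using A y0[of t] z0[of t] by (intro mult_left_mono) (auto simp: power_le_one)
      moreover have "(4 * s + A) * y t \<le> (4 * s + A) * y1" using \<open>y t \<le> y1\<close> s A by (intro mult_left_mono) auto
      moreover have "(4 * s + A) * y1 = \<kappa>" using s A by (simp add: y1_def \<kappa>_def field_simps)
      ultimately have "\<kappa> \<le> s * z t ^ 4 - A * (y t * (z t)\<^sup>2)" by (simp add: \<kappa>_def algebra_simps)
      then have "?e * \<kappa> \<le> (F t)\<^sup>2 - H t" unfolding FH by (intro mult_left_mono) auto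
      moreover have "C \<ge> 0" using \<kappa> A by (simp add: C_def)
      ultimately show ?thesis by (simp add: mult.commute)
    next
      case False
      then have e: "?e \<le> exp (2 * \<alpha> * t0)" using \<alpha> by simp
      have "- A \<le> s * z t ^ 4 - A * (y t * (z t)\<^sup>2)"
      proof -
        have "y t * (z t)\<^sup>2 \<le> 1"
        proof (cases "y t \<le> 1")
          case True
          have "y t * (z t)\<^sup>2 \<le> 1 * 1" using True y0[of t] z0[of t] by (intro mult_mono) (auto simp: power_le_one)
          then show ?thesis by simp
        qed (simp add: z_def)
        then have "A * (y t * (z t)\<^sup>2) \<le> A * 1" using A by (intro mult_left_mono) auto
        moreover have "0 \<le> s * z t ^ 4" using s by simp
        ultimately show ?thesis by linarith
      qed
      then have "?e * (- A) \<le> (F t)\<^sup>2 - H t" unfolding FH by (intro mult_left_mono) auto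
      moreover have "(\<kappa> + A) * ?e \<le> C" unfolding C_def using e \<kappa> A by (intro mult_left_mono) auto
      ultimately show ?thesis by (simp add: algebra_simps)
    qed
  qed
qed

text \<open>Stability with F(u) and the equation with H(u) are linked by the pointwise inequality of
  the profiles, which leaves \<integral> e^u F^2 \<le> \<integral> e^u H once \<lambda> is divided
  out. The gap F^2 - H dominates \<kappa> e^(2\<alpha>u) - C, so the top exponential is controlled
  by the volume alone. The profiles depend only on \<alpha> and c, hence one constant serves every
  \<Omega>, \<open>b\<close>, \<lambda> and \<open>u\<close>.\<close>

lemma energy_bound:
  fixes \<alpha> c :: real
  assumes \<alpha>: "\<alpha> > 0" and c: "c > 0" "c \<le> 2 * \<alpha>"
  shows "\<exists>C\<ge>0. \<forall>(\<Omega>::'a::euclidean_space set) b lam u G L K. open \<Omega> \<longrightarrow> gradient_laplacian_on \<Omega> u G L \<longrightarrow>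
    K = {x\<in>\<Omega>. u x \<ge> 1} \<longrightarrow> compact K \<longrightarrow> lam > 0 \<longrightarrow>
    (\<forall>x\<in>\<Omega>. - L x - b x * (norm (G x))\<^sup>2 = lam * exp (u x)) \<longrightarrow>
    (\<forall>x\<in>\<Omega>. 0 \<le> b x \<and> (\<alpha> - b x)\<^sup>2 + c \<le> 2 * \<alpha> - b x) \<longrightarrow> continuous_on \<Omega> (\<lambda>x. b x *\<^sub>R G x) \<longrightarrow>
    (\<forall>\<psi> \<Psi>. (\<forall>x\<in>\<Omega>. GDERIV \<psi> x :> \<Psi> x) \<longrightarrow> continuous_on \<Omega> \<Psi> \<longrightarrow> (\<forall>x\<in>\<Omega> - K. \<psi> x = 0) \<longrightarrow>
       (LINT x:K|lborel. (lam * exp (u x)) * (\<psi> x)\<^sup>2) \<le> (LINT x:K|lborel. (norm (\<Psi> x - \<psi> x *\<^sub>R (b x *\<^sub>R G x)))\<^sup>2)) \<longrightarrow>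
    (LINT x:K|lborel. exp ((2 * \<alpha> + 1) * u x)) \<le> C * measure lborel K"
proof -
  obtain F F' H H' :: "real \<Rightarrow> real" and \<kappa> C where
    F: "\<And>t. (F has_real_derivative F' t) (at t)" "continuous_on UNIV F'"
    and H: "\<And>t. (H has_real_derivative H' t) (at t)" "continuous_on UNIV H'"
    and FH0: "\<And>t. t \<le> 1 \<Longrightarrow> F t = 0" "\<And>t. t \<le> 1 \<Longrightarrow> H t = 0"
    and FH: "\<And>t b. (\<alpha> - b)\<^sup>2 + c \<le> 2 * \<alpha> - b \<Longrightarrow> 0 \<le> b \<Longrightarrow> (F' t - b * F t)\<^sup>2 \<le> H' t - b * H t"
    and \<kappa>: "\<kappa> > 0" and C: "C \<ge> 0" and low: "\<And>t. \<kappa> * exp (2 * \<alpha> * t) - C \<le> (F t)\<^sup>2 - H t"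
    using test_profiles[OF \<alpha> c] by metis
  \<comment> \<open>The cost of absorbing C e^t: either C \<le> \<kappa>/2 e^(2\<alpha>t), or e^t is
    at most (2C/\<kappa>)^(1/(2\<alpha>)).\<close>
  define D where "D = (2 * C / \<kappa>) powr (1 / (2 * \<alpha>)) * (2 * C / \<kappa>)"
  have D: "C * exp t \<le> \<kappa> / 2 * exp ((2 * \<alpha> + 1) * t) + \<kappa> / 2 * D" for t
  proof (cases "C \<le> \<kappa> / 2 * exp (2 * \<alpha> * t)")
    case True
    then have "C * exp t \<le> \<kappa> / 2 * exp (2 * \<alpha> * t) * exp t" by (intro mult_right_mono) auto
    also have "\<dots> = \<kappa> / 2 * exp ((2 * \<alpha> + 1) * t)" by (simp add: algebra_simps exp_add)
    finally show ?thesis using \<kappa> C by (simp add: D_def add_increasing2)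
  next
    case False
    then have "exp (2 * \<alpha> * t) \<le> 2 * C / \<kappa>" using \<kappa> by (simp add: field_simps)
    then have "exp (2 * \<alpha> * t) powr (1 / (2 * \<alpha>)) \<le> (2 * C / \<kappa>) powr (1 / (2 * \<alpha>))"
      using \<alpha> by (intro powr_mono2) auto
    moreover have "exp (2 * \<alpha> * t) powr (1 / (2 * \<alpha>)) = exp t" using \<alpha> by (simp add: powr_def)
    ultimately have "C * exp t \<le> C * (2 * C / \<kappa>) powr (1 / (2 * \<alpha>))" using C by (intro mult_left_mono) auto
    also have "\<dots> = \<kappa> / 2 * D" using \<kappa> by (simp add: D_def field_simps)
    finally show ?thesis using \<kappa> by (simp add: add_increasing)
  qed
  have D0: "D \<ge> 0" using \<kappa> C by (simp add: D_def)
  show ?thesis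
  proof (intro exI[of _ D] conjI allI impI D0)
    fix \<Omega> :: "'a set" and b lam u G L K
    assume \<Omega>: "open \<Omega>" and u: "gradient_laplacian_on \<Omega> u G L" and KD: "K = {x\<in>\<Omega>. u x \<ge> 1}"
      and K: "compact K" and lam: "lam > 0"
      and pde: "\<forall>x\<in>\<Omega>. - L x - b x * (norm (G x))\<^sup>2 = lam * exp (u x)"
      and b: "\<forall>x\<in>\<Omega>. 0 \<le> b x \<and> (\<alpha> - b x)\<^sup>2 + c \<le> 2 * \<alpha> - b x"
      and cbG: "continuous_on \<Omega> (\<lambda>x. b x *\<^sub>R G x)"
      and stab: "\<forall>\<psi> \<Psi>. (\<forall>x\<in>\<Omega>. GDERIV \<psi> x :> \<Psi> x) \<longrightarrow> continuous_on \<Omega> \<Psi> \<longrightarrow> (\<forall>x\<in>\<Omega> - K. \<psi> x = 0) \<longrightarrow>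
       (LINT x:K|lborel. (lam * exp (u x)) * (\<psi> x)\<^sup>2) \<le> (LINT x:K|lborel. (norm (\<Psi> x - \<psi> x *\<^sub>R (b x *\<^sub>R G x)))\<^sup>2)"
    note uD = gradient_laplacian_onD[OF u]
    have K\<Omega>: "K \<subseteq> \<Omega>" using KD by auto
    have comp: "continuous_on \<Omega> (\<lambda>x. f (u x))" if "continuous_on UNIV f" for f :: "real \<Rightarrow> real"
      by (rule continuous_on_compose2[OF that uD(2)]) simp
    have cF: "continuous_on UNIV F" and cH: "continuous_on UNIV H"
      by (rule DERIV_continuous_on[OF has_field_derivative_at_within[OF F(1)]])
         (rule DERIV_continuous_on[OF has_field_derivative_at_within[OF H(1)]])
    have iK: "set_integrable lborel K f" if "continuous_on \<Omega> f" for f :: "'a \<Rightarrow> real"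
      by (rule set_integrable_compact[OF K continuous_on_subset[OF that K\<Omega>]])
    have dF: "\<forall>x\<in>\<Omega>. GDERIV (\<lambda>x. F (u x)) x :> F' (u x) *\<^sub>R G x"
      by (intro ballI GDERIV_DERIV_compose[OF uD(1) F(1)])
    have dH: "GDERIV (\<lambda>x. H (u x)) x :> H' (u x) *\<^sub>R G x" if "x \<in> \<Omega>" for x
      using GDERIV_DERIV_compose[OF uD(1)[OF that] H(1)] .
    have c1: "continuous_on \<Omega> (\<lambda>x. F' (u x) *\<^sub>R G x)" "continuous_on \<Omega> (\<lambda>x. H' (u x) *\<^sub>R G x)"
      by (intro continuous_on_scaleR comp F(2) H(2) uD(3))+
    have off: "u x \<le> 1" if "x \<in> \<Omega> - K" for x using that KD by auto
    have "(LINT x:K|lborel. (lam * exp (u x)) * (F (u x))\<^sup>2)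
       \<le> (LINT x:K|lborel. (norm (F' (u x) *\<^sub>R G x - F (u x) *\<^sub>R (b x *\<^sub>R G x)))\<^sup>2)"
      using stab[THEN spec[of _ "\<lambda>x. F (u x)"], THEN spec[of _ "\<lambda>x. F' (u x) *\<^sub>R G x"],
          THEN mp, THEN mp, THEN mp, OF dF c1(1)] FH0(1) off by simp
    also have "\<dots> \<le> (LINT x:K|lborel. (H' (u x) *\<^sub>R G x) \<bullet> G x - H (u x) * ((b x *\<^sub>R G x) \<bullet> G x))"
    proof (rule set_integral_mono)
      show "set_integrable lborel K (\<lambda>x. (norm (F' (u x) *\<^sub>R G x - F (u x) *\<^sub>R (b x *\<^sub>R G x)))\<^sup>2)"
        by (intro iK continuous_on_power continuous_on_norm continuous_on_diff c1 continuous_on_scaleR[OF comp[OF cF] cbG])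
      show "set_integrable lborel K (\<lambda>x. (H' (u x) *\<^sub>R G x) \<bullet> G x - H (u x) * ((b x *\<^sub>R G x) \<bullet> G x))"
        by (intro iK continuous_on_diff continuous_on_mult continuous_on_inner comp[OF cH] cbG c1 uD(3))
      fix x assume "x \<in> K"
      then have bx: "0 \<le> b x" "(\<alpha> - b x)\<^sup>2 + c \<le> 2 * \<alpha> - b x" using b K\<Omega> by auto
      have "F' (u x) *\<^sub>R G x - F (u x) *\<^sub>R (b x *\<^sub>R G x) = (F' (u x) - b x * F (u x)) *\<^sub>R G x"
        by (simp add: algebra_simps)
      then have "(norm (F' (u x) *\<^sub>R G x - F (u x) *\<^sub>R (b x *\<^sub>R G x)))\<^sup>2 = (F' (u x) - b x * F (u x))\<^sup>2 * (norm (G x))\<^sup>2"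
        by (simp add: power_mult_distrib)
      also have "\<dots> \<le> (H' (u x) - b x * H (u x)) * (norm (G x))\<^sup>2"
        by (intro mult_right_mono FH bx) simp
      also have "\<dots> = (H' (u x) *\<^sub>R G x) \<bullet> G x - H (u x) * ((b x *\<^sub>R G x) \<bullet> G x)"
        by (simp add: power2_norm_eq_inner algebra_simps)
      finally show "(norm (F' (u x) *\<^sub>R G x - F (u x) *\<^sub>R (b x *\<^sub>R G x)))\<^sup>2
          \<le> (H' (u x) *\<^sub>R G x) \<bullet> G x - H (u x) * ((b x *\<^sub>R G x) \<bullet> G x)" .
    qed
    \<comment> \<open>The equation replaces b |\<nabla>u|^2 by -\<Delta>u - \<lambda> e^u; the terms
      with H' and with the Laplacian then form a divergence, which integrates to zero.\<close>
    also have "\<dots> = (LINT x:K|lborel. ((H' (u x) *\<^sub>R G x) \<bullet> G x + H (u x) * L x) + (lam * exp (u x)) * H (u x))"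
    proof (rule set_lebesgue_integral_cong)
      show "K \<in> sets lborel" using K borel_compact by simp
      show "\<forall>x. x \<in> K \<longrightarrow> (H' (u x) *\<^sub>R G x) \<bullet> G x - H (u x) * ((b x *\<^sub>R G x) \<bullet> G x)
         = ((H' (u x) *\<^sub>R G x) \<bullet> G x + H (u x) * L x) + (lam * exp (u x)) * H (u x)"
      proof (intro allI impI)
        fix x assume "x \<in> K"
        then have "lam * exp (u x) = - L x - b x * (norm (G x))\<^sup>2" using pde K\<Omega> by auto
        then have L: "L x = - (lam * exp (u x)) - b x * (G x \<bullet> G x)" by (simp add: power2_norm_eq_inner)
        show "(H' (u x) *\<^sub>R G x) \<bullet> G x - H (u x) * ((b x *\<^sub>R G x) \<bullet> G x)
         = ((H' (u x) *\<^sub>R G x) \<bullet> G x + H (u x) * L x) + (lam * exp (u x)) * H (u x)"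
          by (simp add: L algebra_simps)
      qed
    qed
    also have "\<dots> = 0 + (LINT x:K|lborel. (lam * exp (u x)) * H (u x))"
    proof (subst set_integral_add(2))
      show "set_integrable lborel K (\<lambda>x. (H' (u x) *\<^sub>R G x) \<bullet> G x + H (u x) * L x)"
        by (intro iK continuous_on_add continuous_on_inner continuous_on_mult c1 uD(3,4) comp[OF cH])
      show "set_integrable lborel K (\<lambda>x. (lam * exp (u x)) * H (u x))"
        by (intro iK continuous_on_mult continuous_on_const continuous_on_exp uD(2) comp[OF cH])
      show "(LINT x:K|lborel. (H' (u x) *\<^sub>R G x) \<bullet> G x + H (u x) * L x) + (LINT x:K|lborel. (lam * exp (u x)) * H (u x))
        = 0 + (LINT x:K|lborel. (lam * exp (u x)) * H (u x))"
        using green_laplacian[OF u \<Omega> K K\<Omega> dH c1(2)] FH0(2) off by simp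
    qed
    finally have "(LINT x:K|lborel. (lam * exp (u x)) * (F (u x))\<^sup>2) \<le> (LINT x:K|lborel. (lam * exp (u x)) * H (u x))" by simp
    then have "lam * (LINT x:K|lborel. exp (u x) * (F (u x))\<^sup>2) \<le> lam * (LINT x:K|lborel. exp (u x) * H (u x))"
      by (simp add: mult.assoc)
    then have le: "(LINT x:K|lborel. exp (u x) * (F (u x))\<^sup>2) \<le> (LINT x:K|lborel. exp (u x) * H (u x))"
      using lam by simp
    have iF: "set_integrable lborel K (\<lambda>x. exp (u x) * (F (u x))\<^sup>2)"
      by (intro iK continuous_on_mult continuous_on_exp uD(2) continuous_on_power comp[OF cF])
    have iH: "set_integrable lborel K (\<lambda>x. exp (u x) * H (u x))"
      by (intro iK continuous_on_mult continuous_on_exp uD(2) comp[OF cH])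
    have iE: "set_integrable lborel K (\<lambda>x. exp ((2 * \<alpha> + 1) * u x))"
      by (intro iK continuous_intros uD(2))
    have i1: "set_integrable lborel K (\<lambda>x. D)" by (intro iK continuous_intros)
    have "(LINT x:K|lborel. exp ((2 * \<alpha> + 1) * u x) - D) \<le> (LINT x:K|lborel. (2 / \<kappa>) * (exp (u x) * (F (u x))\<^sup>2 - exp (u x) * H (u x)))"
    proof (rule set_integral_mono)
      fix x
      let ?E = "exp ((2 * \<alpha> + 1) * u x)"
      have E: "exp (u x) * exp (2 * \<alpha> * u x) = ?E" by (simp add: algebra_simps exp_add)
      have "exp (u x) * (\<kappa> * exp (2 * \<alpha> * u x) - C) \<le> exp (u x) * ((F (u x))\<^sup>2 - H (u x))"
        by (intro mult_left_mono low) simp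
      then have "\<kappa> * (exp (u x) * exp (2 * \<alpha> * u x)) - C * exp (u x) \<le> exp (u x) * (F (u x))\<^sup>2 - exp (u x) * H (u x)"
        by (simp only: right_diff_distrib mult.left_commute[of "exp (u x)" \<kappa>] mult.commute[of "exp (u x)" C])
      then have "\<kappa> * ?E - C * exp (u x) \<le> exp (u x) * (F (u x))\<^sup>2 - exp (u x) * H (u x)"
        by (simp only: E)
      moreover have "\<kappa> / 2 * (?E - D) = \<kappa> / 2 * ?E - \<kappa> / 2 * D" by (rule right_diff_distrib)
      ultimately have "\<kappa> / 2 * (?E - D) \<le> exp (u x) * (F (u x))\<^sup>2 - exp (u x) * H (u x)"
        using D[of "u x"] by linarith
      then have "(2 / \<kappa>) * (\<kappa> / 2 * (?E - D)) \<le> (2 / \<kappa>) * (exp (u x) * (F (u x))\<^sup>2 - exp (u x) * H (u x))"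
        using \<kappa> by (intro mult_left_mono) auto
      moreover have "(2 / \<kappa>) * (\<kappa> / 2 * (?E - D)) = ?E - D" using \<kappa> by simp
      ultimately show "?E - D \<le> (2 / \<kappa>) * (exp (u x) * (F (u x))\<^sup>2 - exp (u x) * H (u x))" by (simp only:)
    qed (intro set_integral_diff(1) set_integrable_mult_right iE i1 iF iH)+
    also have "\<dots> = (2 / \<kappa>) * ((LINT x:K|lborel. exp (u x) * (F (u x))\<^sup>2) - (LINT x:K|lborel. exp (u x) * H (u x)))"
      by (simp only: set_integral_mult_right set_integral_diff(2)[OF iF iH])
    also have "\<dots> \<le> 0" using le \<kappa> by (intro mult_nonneg_nonpos) auto
    finally have "(LINT x:K|lborel. exp ((2 * \<alpha> + 1) * u x)) \<le> (LINT x:K|lborel. D)"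
      using set_integral_diff(2)[OF iE i1] by simp
    also have "\<dots> = D * measure lborel K" by (simp add: set_lebesgue_integral_def mult.commute)
    finally show "(LINT x:K|lborel. exp ((2 * \<alpha> + 1) * u x)) \<le> D * measure lborel K" .
  qed
qed

section \<open>The supremum bound\<close>

text \<open>\<open>\<delta>\<^sup>2 + \<eta>\<^sup>2 \<le> 1\<close> enters through \<open>\<eta>\<^sup>2 (x + q)\<^sup>2 \<le> x\<^sup>2 + (\<eta>\<^sup>2/\<delta>\<^sup>2) q\<^sup>2\<close>, with \<open>\<alpha> - b = x + q\<close> and \<open>q = bu - b\<close>.\<close>

lemma exponent_choice:
  fixes bl bu \<delta> \<eta> n :: real
  assumes bl: "0 \<le> bl" "bl \<le> bu" and \<delta>: "\<delta> > 0" and \<eta>: "\<eta> > 0" and \<delta>\<eta>: "\<delta>\<^sup>2 + \<eta>\<^sup>2 \<le> 1"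
    and h1: "bu - bl < \<delta>\<^sup>2 / \<eta>\<^sup>2 * (\<eta>\<^sup>2 - bu / 8)"
    and h2: "n < 2 + 4 * \<eta>\<^sup>2 + 4 * bu + 4 * sqrt (\<eta>\<^sup>2 * (\<eta>\<^sup>2 + bu) - 2 * bu * (bu - bl) * (\<eta>\<^sup>2 / \<delta>\<^sup>2))"
  obtains \<alpha> c where "\<alpha> > 0" "c > 0" "c \<le> 2 * \<alpha>" "n < 2 * (2 * \<alpha> + 1)"
    "\<And>b. bl \<le> b \<Longrightarrow> b \<le> bu \<Longrightarrow> (\<alpha> - b)\<^sup>2 + c \<le> 2 * \<alpha> - b"
proof -
  define e where "e = \<eta>\<^sup>2"
  define d where "d = \<delta>\<^sup>2"
  have e: "e > 0" and d: "d > 0" and de: "d + e \<le> 1" using \<delta> \<eta> \<delta>\<eta> by (auto simp: e_def d_def)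
  define D where "D = e * (e + bu) - 2 * bu * (bu - bl) * (e / d)"
  have bu: "bu \<ge> 0" using bl by simp
  \<comment> \<open>For bu > 0 the smallness hypothesis puts D above the perfect square (\<eta>^2 -
    bu/2)^2; the fraction 1/8 is calibrated for this.\<close>
  have D: "D > 0"
  proof (cases "bu = 0")
    case True
    then show ?thesis using e by (simp add: D_def)
  next
    case False
    have "(bu - bl) * (e / d) < (d / e * (e - bu / 8)) * (e / d)"
      using h1 e d unfolding e_def[symmetric] d_def[symmetric] by (intro mult_strict_right_mono) auto
    also have "\<dots> = e - bu / 8" using e d by simp
    finally have "2 * bu * ((bu - bl) * (e / d)) < 2 * bu * (e - bu / 8)"
      using False bu by (intro mult_strict_left_mono) auto
    moreover have "0 \<le> (e - bu / 2)\<^sup>2" by simp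
    moreover have "(e - bu / 2)\<^sup>2 = e * (e + bu) - 2 * bu * (e - bu / 8)"
      by (simp add: power2_eq_square algebra_simps)
    moreover have "2 * bu * ((bu - bl) * (e / d)) = 2 * bu * (bu - bl) * (e / d)" by simp
    ultimately show ?thesis unfolding D_def by linarith
  qed
  have "n / 4 - 1 / 2 - e - bu < sqrt D"
    using h2 unfolding e_def[symmetric] d_def[symmetric] D_def[symmetric] by linarith
  moreover have "0 < sqrt D" using D by simp
  ultimately have "max 0 (n / 4 - 1 / 2 - e - bu) < sqrt D" by simp
  \<comment> \<open>At s = sqrt D the exponent \<alpha> = \<eta>^2 + bu + s would reproduce the
    dimension bound of the hypothesis, but with c = 0. A slightly smaller s keeps n < 2 + 4\<alpha>
    and gains c = (D - s^2)/\<eta>^2 > 0.\<close>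
  then obtain s where s1: "max 0 (n / 4 - 1 / 2 - e - bu) < s" and s2: "s < sqrt D" using dense by blast
  then have s: "s > 0" "n / 4 - 1 / 2 - e - bu < s" by simp_all
  have "s\<^sup>2 < (sqrt D)\<^sup>2" using s2 s by (intro power_strict_mono) auto
  then have sD: "s\<^sup>2 < D" using D by simp
  define \<alpha> where "\<alpha> = e + bu + s"
  define c where "c = (D - s\<^sup>2) / e"
  have c: "c > 0" using sD e by (simp add: c_def)
  have ineq: "(\<alpha> - b)\<^sup>2 + c \<le> 2 * \<alpha> - b" if b: "bl \<le> b" "b \<le> bu" for b
  proof -
    define q where "q = bu - b"
    define x where "x = e + s"
    have q: "0 \<le> q" "q \<le> bu - bl" "q \<le> bu" using b bl by (auto simp: q_def)
    have "e * (x + q)\<^sup>2 \<le> x\<^sup>2 + e / d * q\<^sup>2"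
    proof -
      have "0 \<le> (d * x - e * q)\<^sup>2 / d" using d by simp
      also have "\<dots> = d * x\<^sup>2 - 2 * e * x * q + e * e / d * q\<^sup>2"
        using d by (simp add: power2_eq_square field_simps)
      also have "\<dots> \<le> (1 - e) * x\<^sup>2 - 2 * e * x * q + e * (1 - d) / d * q\<^sup>2"
      proof -
        have "d * x\<^sup>2 \<le> (1 - e) * x\<^sup>2" using de by (intro mult_right_mono) auto
        moreover have "e * e / d \<le> e * (1 - d) / d" using de d e by (intro divide_right_mono mult_left_mono) auto
        then have "e * e / d * q\<^sup>2 \<le> e * (1 - d) / d * q\<^sup>2" by (rule mult_right_mono) simp
        ultimately show ?thesis by linarith
      qed
      also have "e * (1 - d) / d * q\<^sup>2 = e / d * q\<^sup>2 - e * q\<^sup>2" using d by (simp add: field_simps)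
      finally show ?thesis by (simp add: power2_eq_square algebra_simps)
    qed
    moreover have "e / d * q\<^sup>2 \<le> 2 * bu * (bu - bl) * (e / d)"
    proof -
      have "q\<^sup>2 \<le> bu * (bu - bl)" unfolding power2_eq_square using q bu by (intro mult_mono) auto
      also have "\<dots> \<le> 2 * bu * (bu - bl)" using bu bl by simp
      finally have "e / d * q\<^sup>2 \<le> e / d * (2 * bu * (bu - bl))" using e d by (intro mult_left_mono) auto
      then show ?thesis by (simp add: mult.commute)
    qed
    moreover have "x\<^sup>2 + 2 * bu * (bu - bl) * (e / d) = e * (2 * e + 2 * s + bu) - (D - s\<^sup>2)"
      by (simp add: D_def x_def power2_eq_square algebra_simps)
    moreover have "e * (2 * e + 2 * s + bu) \<le> e * (2 * \<alpha> - b)"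
      using e b by (intro mult_left_mono) (auto simp: \<alpha>_def)
    moreover have "\<alpha> - b = x + q" by (simp add: \<alpha>_def x_def q_def)
    ultimately have "e * (\<alpha> - b)\<^sup>2 + (D - s\<^sup>2) \<le> e * (2 * \<alpha> - b)" by simp
    moreover have "D - s\<^sup>2 = e * c" using e by (simp add: c_def)
    ultimately have "e * ((\<alpha> - b)\<^sup>2 + c) \<le> e * (2 * \<alpha> - b)" by (simp add: distrib_left)
    then show ?thesis using e by simp
  qed
  show ?thesis
  proof (rule that[OF _ c])
    show "\<alpha> > 0" using e bu s by (simp add: \<alpha>_def)
    show "n < 2 * (2 * \<alpha> + 1)" using s(2) by (simp add: \<alpha>_def)
    have "0 \<le> (\<alpha> - bl)\<^sup>2" by simp
    then show "c \<le> 2 * \<alpha>" using ineq[of bl] bl by linarith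
  qed (rule ineq)
qed

text \<open>The second derivative is arranged as a nonnegative term plus \<beta> times the first
  derivative: for \<beta> \<ge> b this dominates b times the first derivative and absorbs the
  gradient term of the equation.\<close>

lemma exp_transform_derivatives:
  fixes \<beta> :: real
  defines "v \<equiv> \<lambda>t. max 0 (exp (\<beta> * t) - exp \<beta>)"
  shows "((\<lambda>t. v t ^ 3) has_real_derivative 3 * (v t)\<^sup>2 * (\<beta> * exp (\<beta> * t))) (at t)"
    and "((\<lambda>t. 3 * (v t)\<^sup>2 * (\<beta> * exp (\<beta> * t))) has_real_derivative
       6 * v t * (\<beta> * exp (\<beta> * t))\<^sup>2 + \<beta> * (3 * (v t)\<^sup>2 * (\<beta> * exp (\<beta> * t)))) (at t)"
proof -
  have d: "((\<lambda>t. exp (\<beta> * t) - exp \<beta>) has_real_derivative \<beta> * exp (\<beta> * t)) (at t)"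
    by (auto intro!: derivative_eq_intros)
  have 3: "((\<lambda>t. v t ^ Suc n) has_real_derivative real (Suc n) * v t ^ n * (\<beta> * exp (\<beta> * t))) (at t)" if "n \<ge> 1" for n
    using DERIV_chain2[OF DERIV_pos_part_power[OF that] d] unfolding v_def .
  show "((\<lambda>t. v t ^ 3) has_real_derivative 3 * (v t)\<^sup>2 * (\<beta> * exp (\<beta> * t))) (at t)"
    using 3[of 2] by (simp add: eval_nat_numeral)
  have "((\<lambda>t. (v t)\<^sup>2) has_real_derivative 2 * v t * (\<beta> * exp (\<beta> * t))) (at t)"
    using 3[of 1] by (simp add: numeral_2_eq_2)
  moreover have "((\<lambda>t. \<beta> * exp (\<beta> * t)) has_real_derivative \<beta> * (\<beta> * exp (\<beta> * t))) (at t)"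
    by (auto intro!: derivative_eq_intros)
  ultimately have "((\<lambda>t. 3 * ((v t)\<^sup>2 * (\<beta> * exp (\<beta> * t)))) has_real_derivative
     3 * ((2 * v t * (\<beta> * exp (\<beta> * t))) * (\<beta> * exp (\<beta> * t)) + (\<beta> * (\<beta> * exp (\<beta> * t))) * (v t)\<^sup>2)) (at t)"
    by (rule DERIV_cmult[OF DERIV_mult])
  then show "((\<lambda>t. 3 * (v t)\<^sup>2 * (\<beta> * exp (\<beta> * t))) has_real_derivative
       6 * v t * (\<beta> * exp (\<beta> * t))\<^sup>2 + \<beta> * (3 * (v t)\<^sup>2 * (\<beta> * exp (\<beta> * t)))) (at t)"
    by (simp add: power2_eq_square algebra_simps)
qed

text \<open>Every constant is extracted before \<lambda> and \<open>u\<close> are introduced, which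
  makes the bound uniform in both. The gain \<tau> lies in the gap between the available exponent
  \<open>p\<close> and the exponent \<open>p1\<close> used in the potential estimate.\<close>

lemma stable_solution_sup_bound:
  fixes \<Omega> :: "(real^'n::finite) set" and b :: "real^'n \<Rightarrow> real"
  assumes \<Omega>: "open \<Omega>" "bounded \<Omega>" "\<Omega> \<noteq> {}"
    and \<alpha>: "\<alpha> > 0" and c: "c > 0" "c \<le> 2 * \<alpha>" and n: "real CARD('n) < 2 * (2 * \<alpha> + 1)"
    and b: "\<And>x. x \<in> \<Omega> \<Longrightarrow> 0 \<le> b x" "\<And>x. x \<in> \<Omega> \<Longrightarrow> b x \<le> B"
      "\<And>x. x \<in> \<Omega> \<Longrightarrow> (\<alpha> - b x)\<^sup>2 + c \<le> 2 * \<alpha> - b x"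
  shows "\<exists>C. \<forall>lam u. lam > 0 \<longrightarrow> stable_solution \<Omega> b lam exp u \<longrightarrow> (\<forall>x\<in>\<Omega>. u x > 0) \<longrightarrow> (\<forall>x\<in>\<Omega>. u x \<le> C)"
proof -
  define p where "p = 2 * \<alpha> + 1"
  have B: "B \<ge> 0" using b(1,2) \<Omega>(3) by (meson all_not_in_conv order_trans)
  have "max 1 (real CARD('n) / 2) < p" using n \<alpha> by (simp add: p_def)
  then obtain p1 where "max 1 (real CARD('n) / 2) < p1" and p1p: "p1 < p" using dense by blast
  then have p1: "p1 > 1" "2 * p1 > real DIM(real^'n)" by simp_all
  \<comment> \<open>At least \<open>B\<close>, to absorb b |\<nabla>u|^2, and at least
    \<open>p\<close>, to keep 3\<beta> - \<tau> nonnegative.\<close>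
  define \<beta> where "\<beta> = B + p"
  have \<beta>: "\<beta> > 0" "B \<le> \<beta>" "p \<le> \<beta>" using B \<alpha> by (auto simp: \<beta>_def p_def)
  \<comment> \<open>Chosen so that p1 (1 + 3\<beta>) = p1 (3\<beta> - \<tau>) + p: in F^p1 the
    factor e^(pu) is controlled by the energy, and the remaining exponential is bounded by its
    maximum.\<close>
  define \<tau> where "\<tau> = p / p1 - 1"
  have \<tau>: "\<tau> > 0" using p1 p1p by (simp add: \<tau>_def)
  define R where "R = diameter \<Omega> + 1"
  have R: "R > 0" using diameter_ge_0[OF \<Omega>(2)] by (simp add: R_def)
  have \<Omega>R: "\<Omega> \<subseteq> cball x R" if "x \<in> \<Omega>" for x
    using diameter_bounded_bound[OF \<Omega>(2) that] by (fastforce simp: R_def)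
  obtain C1 where C1: "C1 \<ge> 0" and C1': "\<forall>(\<Omega>::(real^'n) set) K w G L F Y x0. open \<Omega> \<longrightarrow> compact K \<longrightarrow> K \<subseteq> \<Omega> \<longrightarrow> K \<subseteq> cball x0 R \<longrightarrow>
    gradient_laplacian_on \<Omega> w G L \<longrightarrow> (\<forall>x\<in>\<Omega>. w x \<ge> 0) \<longrightarrow> (\<forall>x\<in>\<Omega> - K. w x = 0 \<and> G x = 0) \<longrightarrow>
    (\<forall>x\<in>K. - L x \<le> F x \<and> F x > 0) \<longrightarrow> continuous_on K F \<longrightarrow> Y > 0 \<longrightarrow> x0 \<in> \<Omega> \<longrightarrow>
    w x0 \<le> C1 * Y * (1 + Y powr (- p1) * (LINT x:K|lborel. F x powr p1))"
    using subsolution_sup_bound[OF p1 R] by (elim exE conjE)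
  obtain \<Lambda> where \<Lambda>: "\<Lambda> \<ge> 0" and \<Lambda>': "\<forall>u G L lam. gradient_laplacian_on \<Omega> u G L \<longrightarrow> (\<forall>x\<in>\<Omega>. u x > 0 \<and> - L x \<ge> lam * u x) \<longrightarrow> lam \<le> \<Lambda>"
    using lambda_bound[OF \<Omega>(1,3)] by (elim exE conjE)
  obtain C2 where C2: "C2 \<ge> 0" and C2': "\<forall>(\<Omega>::(real^'n) set) b lam u G L K. open \<Omega> \<longrightarrow> gradient_laplacian_on \<Omega> u G L \<longrightarrow>
    K = {x\<in>\<Omega>. u x \<ge> 1} \<longrightarrow> compact K \<longrightarrow> lam > 0 \<longrightarrow>
    (\<forall>x\<in>\<Omega>. - L x - b x * (norm (G x))\<^sup>2 = lam * exp (u x)) \<longrightarrow>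
    (\<forall>x\<in>\<Omega>. 0 \<le> b x \<and> (\<alpha> - b x)\<^sup>2 + c \<le> 2 * \<alpha> - b x) \<longrightarrow> continuous_on \<Omega> (\<lambda>x. b x *\<^sub>R G x) \<longrightarrow>
    (\<forall>\<psi> \<Psi>. (\<forall>x\<in>\<Omega>. GDERIV \<psi> x :> \<Psi> x) \<longrightarrow> continuous_on \<Omega> \<Psi> \<longrightarrow> (\<forall>x\<in>\<Omega> - K. \<psi> x = 0) \<longrightarrow>
       (LINT x:K|lborel. (lam * exp (u x)) * (\<psi> x)\<^sup>2) \<le> (LINT x:K|lborel. (norm (\<Psi> x - \<psi> x *\<^sub>R (b x *\<^sub>R G x)))\<^sup>2)) \<longrightarrow>
    (LINT x:K|lborel. exp ((2 * \<alpha> + 1) * u x)) \<le> C2 * measure lborel K"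
    using energy_bound[OF \<alpha> c, where 'a = "real^'n"] by (elim exE conjE)
  define S where "S = (3 * \<beta> * \<Lambda>) powr p1 * (C2 * measure lborel \<Omega>)"
  have S: "S \<ge> 0" using C2 by (simp add: S_def)
  \<comment> \<open>For M > 2 the truncation costs only a factor: e^(\<beta>M) - e^\<beta> \<ge> (1
    - e^(-\<beta>)) e^(\<beta>M), which is then cubed.\<close>
  define \<rho> where "\<rho> = (1 - exp (- \<beta>)) ^ 3"
  have \<rho>: "\<rho> > 0" using \<beta> by (simp add: \<rho>_def)
  define Z where "Z = C1 * (1 + S) / \<rho>"
  define C where "C = max 2 (Z / \<tau>)"
  show ?thesis
  proof (intro exI[of _ C] allI impI ballI)
    fix lam u x
    assume lam: "lam > 0" and st: "stable_solution \<Omega> b lam exp u" and upos: "\<forall>x\<in>\<Omega>. u x > 0" and x: "x \<in> \<Omega>"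
    have cl: "classical_solution \<Omega> b lam exp u" using st by (simp add: stable_solution_def)
    then have Ck: "Ck_on 2 \<Omega> u" and cu: "continuous_on (closure \<Omega>) u"
      and pde: "\<forall>x\<in>\<Omega>. - laplacian u x - b x * (norm (grad u x))\<^sup>2 = lam * exp (u x)"
      and bd: "\<forall>x\<in>frontier \<Omega>. u x = 0" by (auto simp: classical_solution_def)
    have u: "gradient_laplacian_on \<Omega> u (grad u) (laplacian u)" by (rule gradient_laplacian_on_Ck[OF \<Omega>(1) Ck])
    note uD = gradient_laplacian_onD[OF u]
    have cc: "compact (closure \<Omega>)" using \<Omega>(2) by (simp add: compact_closure)
    have cl\<Omega>: "closure \<Omega> = \<Omega> \<union> frontier \<Omega>" by (rule closure_Un_frontier)
    obtain x0 where x0: "x0 \<in> closure \<Omega>" "\<And>y. y \<in> closure \<Omega> \<Longrightarrow> u y \<le> u x0"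
      using continuous_attains_sup[OF cc _ cu] \<Omega>(3) by auto
    define M where "M = u x0"
    have uM: "u y \<le> M" if "y \<in> \<Omega>" for y using x0(2) that closure_subset by (auto simp: M_def)
    define K where "K = {x\<in>\<Omega>. u x \<ge> 1}"
    have K\<Omega>: "K \<subseteq> \<Omega>" by (auto simp: K_def)
    \<comment> \<open>The boundary value 0 lies below the level 1, so passing to the closure adds no
      points and \<open>K\<close> is closed.\<close>
    have "K = closure \<Omega> \<inter> u -` {1..}" using bd by (auto simp: K_def cl\<Omega>)
    moreover have "closed (closure \<Omega> \<inter> u -` {1..})" by (intro continuous_closed_preimage cu) auto
    ultimately have K: "compact K"
      using compact_Int_closed[OF cc, of K] by (metis Int_absorb1 Int_lower1)
    have cbG: "continuous_on \<Omega> (\<lambda>x. b x *\<^sub>R grad u x)"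
    proof (rule continuous_on_scaled_gradient[OF \<Omega>(1) uD(3)])
      show "\<bar>b x\<bar> \<le> B" if "x \<in> \<Omega>" for x using b(1,2)[OF that] by simp
      have "continuous_on \<Omega> (\<lambda>x. - laplacian u x - lam * exp (u x))"
        by (intro continuous_intros uD(2,4))
      then show "continuous_on \<Omega> (\<lambda>x. b x * (norm (grad u x))\<^sup>2)"
        by (rule continuous_on_eq) (use pde in \<open>auto simp: algebra_simps\<close>)
    qed
    have stab: "\<forall>\<psi> \<Psi>. (\<forall>x\<in>\<Omega>. GDERIV \<psi> x :> \<Psi> x) \<longrightarrow> continuous_on \<Omega> \<Psi> \<longrightarrow> (\<forall>x\<in>\<Omega> - K. \<psi> x = 0) \<longrightarrow>
       (LINT x:K|lborel. (lam * exp (u x)) * (\<psi> x)\<^sup>2) \<le> (LINT x:K|lborel. (norm (\<Psi> x - \<psi> x *\<^sub>R (b x *\<^sub>R grad u x)))\<^sup>2)"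
    proof (intro allI impI)
      fix \<psi> \<Psi> assume \<psi>: "\<forall>x\<in>\<Omega>. GDERIV \<psi> x :> \<Psi> x" "continuous_on \<Omega> \<Psi>" "\<forall>x\<in>\<Omega> - K. \<psi> x = 0"
      obtain q \<phi> G H where q: "q > real CARD('n)" and W: "W2p_with_derivs \<Omega> q \<phi> G H"
        and \<phi>: "continuous_on (closure \<Omega>) \<phi>" "\<forall>x\<in>closure \<Omega>. \<phi> x > 0"
        and AE: "AE x in lebesgue_on \<Omega>. - trace (H x) - 2 * b x * (grad u x \<bullet> G x) \<ge> lam * deriv exp (u x) * \<phi> x"
        using st unfolding stable_solution_def by blast
      have "real CARD('n) \<ge> 1" by (simp add: Suc_leI)
      then have q1: "q \<ge> 1" using q by linarith
      have "deriv exp (t::real) = exp t" for t by (rule DERIV_imp_deriv) (rule DERIV_exp)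
      then have AE': "AE x in lebesgue_on \<Omega>. - trace (H x) - 2 * ((b x *\<^sub>R grad u x) \<bullet> G x) \<ge> (lam * exp (u x)) * \<phi> x"
        using AE by (simp add: mult.assoc)
      show "(LINT x:K|lborel. (lam * exp (u x)) * (\<psi> x)\<^sup>2) \<le> (LINT x:K|lborel. (norm (\<Psi> x - \<psi> x *\<^sub>R (b x *\<^sub>R grad u x)))\<^sup>2)"
        using \<phi> \<psi> by (intro stability_inequality[OF \<Omega>(1,2) K K\<Omega> q1 W \<phi>(1) _ AE' cbG] continuous_intros uD(2)) auto
    qed
    have energy: "(LINT x:K|lborel. exp (p * u x)) \<le> C2 * measure lborel \<Omega>"
    proof -
      have "(LINT x:K|lborel. exp ((2 * \<alpha> + 1) * u x)) \<le> C2 * measure lborel K"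
        by (rule C2'[THEN spec, THEN spec, THEN spec, THEN spec, THEN spec, THEN spec, THEN spec,
          THEN mp, THEN mp, THEN mp, THEN mp, THEN mp, THEN mp, THEN mp, THEN mp, THEN mp, OF \<Omega>(1) u K_def K lam pde _ cbG stab]) (use b in blast)
      also have "measure lborel K \<le> measure lborel \<Omega>"
      proof (rule measure_mono_fmeasurable[OF K\<Omega>])
        show "K \<in> sets lborel" using K borel_compact by simp
        show "\<Omega> \<in> fmeasurable lborel"
          using \<Omega>(1) emeasure_bounded_finite[OF \<Omega>(2)] by (auto simp: fmeasurable_def borel_open)
      qed
      finally show ?thesis using C2 by (simp add: p_def mult_left_mono)
    qed
    have lam\<Lambda>: "lam \<le> \<Lambda>"
    proof (rule \<Lambda>'[rule_format, OF u], intro ballI conjI)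
      fix x assume x: "x \<in> \<Omega>"
      show "u x > 0" using upos x by blast
      have "u x \<le> exp (u x)" using exp_ge_add_one_self[of "u x"] by linarith
      then have "lam * u x \<le> lam * exp (u x)" using lam by (intro mult_left_mono) auto
      moreover have "0 \<le> b x * (norm (grad u x))\<^sup>2" using b(1)[OF x] by simp
      moreover have "- laplacian u x - b x * (norm (grad u x))\<^sup>2 = lam * exp (u x)" using pde x by blast
      ultimately show "lam * u x \<le> - laplacian u x" by linarith
    qed
    have "M \<le> C"
    proof (cases "M \<le> 2")
      case False
      then have M2: "M > 2" by simp
      have x0\<Omega>: "x0 \<in> \<Omega>" using x0(1) bd M2 by (auto simp: cl\<Omega> M_def)
      define v where "v = (\<lambda>t. max 0 (exp (\<beta> * t) - exp \<beta>))"
      define P1 where "P1 = (\<lambda>t. 3 * (v t)\<^sup>2 * (\<beta> * exp (\<beta> * t)))"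
      define P2 where "P2 = (\<lambda>t. 6 * v t * (\<beta> * exp (\<beta> * t))\<^sup>2 + \<beta> * P1 t)"
      let ?w = "\<lambda>x. v (u x) ^ 3"
      let ?L = "\<lambda>x. P2 (u x) * (norm (grad u x))\<^sup>2 + P1 (u x) * laplacian u x"
      have v0: "v t \<ge> 0" "v t \<le> exp (\<beta> * t)" for t by (auto simp: v_def)
      have vz: "v t = 0" if "t \<le> 1" for t
      proof -
        have "\<beta> * t \<le> \<beta> * 1" using that \<beta> by (intro mult_left_mono) auto
        then show ?thesis by (simp add: v_def)
      qed
      have P1_0: "P1 t \<ge> 0" for t using \<beta> by (simp add: P1_def)
      have w: "gradient_laplacian_on \<Omega> ?w (\<lambda>x. P1 (u x) *\<^sub>R grad u x) ?L"
      proof (rule gradient_laplacian_on_compose[OF u])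
        show "((\<lambda>t. v t ^ 3) has_real_derivative P1 (u x)) (at (u x))" for x
          unfolding v_def P1_def by (rule exp_transform_derivatives(1))
        show "(P1 has_real_derivative P2 (u x)) (at (u x))" for x
          unfolding v_def P1_def P2_def by (rule exp_transform_derivatives(2))
        show "continuous_on \<Omega> (\<lambda>x. P2 (u x))"
          unfolding P2_def P1_def v_def by (intro continuous_intros uD(2))
      qed
      define F where "F = (\<lambda>x. (3 * \<beta> * lam) * exp ((1 + 3 * \<beta>) * u x))"
      \<comment> \<open>The maximum of the exponential factor left over by the energy, so that
        Y^(-p1) \<integral> F^p1 is bounded by \<open>S\<close> independently of M.\<close>
      define Y where "Y = exp ((3 * \<beta> - \<tau>) * M)"
      have wF: "\<forall>x\<in>K. - ?L x \<le> F x \<and> F x > 0"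
      proof (intro ballI conjI)
        fix x assume "x \<in> K"
        then have x: "x \<in> \<Omega>" using K\<Omega> by blast
        show "F x > 0" using \<beta> lam by (simp add: F_def)
        have "b x * P1 (u x) \<le> P2 (u x)"
        proof -
          have "b x * P1 (u x) \<le> \<beta> * P1 (u x)" using b(2)[OF x] \<beta> P1_0 by (intro mult_right_mono) auto
          also have "\<dots> \<le> P2 (u x)" using v0 by (simp add: P2_def)
          finally show ?thesis .
        qed
        then have "b x * P1 (u x) * (norm (grad u x))\<^sup>2 \<le> P2 (u x) * (norm (grad u x))\<^sup>2" by (rule mult_right_mono) simp
        moreover have "- laplacian u x = lam * exp (u x) + b x * (norm (grad u x))\<^sup>2" using pde x by force
        then have "P1 (u x) * - laplacian u x = P1 (u x) * (lam * exp (u x)) + b x * P1 (u x) * (norm (grad u x))\<^sup>2"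
          by (simp add: algebra_simps)
        ultimately have "- ?L x \<le> P1 (u x) * (lam * exp (u x))" by simp
        also have "\<dots> \<le> (3 * (exp (\<beta> * u x))\<^sup>2 * (\<beta> * exp (\<beta> * u x))) * (lam * exp (u x))"
          unfolding P1_def using v0 \<beta> lam by (intro mult_right_mono mult_left_mono power_mono) auto
        also have "\<dots> = F x"
          by (simp add: F_def power2_eq_square algebra_simps flip: exp_add)
        finally show "- ?L x \<le> F x" .
      qed
      have cF: "continuous_on K F"
        unfolding F_def by (intro continuous_intros continuous_on_subset[OF uD(2) K\<Omega>])
      have "?w x0 \<le> C1 * Y * (1 + Y powr (- p1) * (LINT x:K|lborel. F x powr p1))"
      proof (rule C1'[THEN spec, THEN spec, THEN spec, THEN spec, THEN spec, THEN spec, THEN spec, THEN spec,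
          THEN mp, THEN mp, THEN mp, THEN mp, THEN mp, THEN mp, THEN mp, THEN mp, THEN mp, THEN mp, THEN mp, OF \<Omega>(1) K K\<Omega> _ w _ _ wF cF _ x0\<Omega>])
        show "K \<subseteq> cball x0 R" using \<Omega>R[OF x0\<Omega>] K\<Omega> by blast
        show "\<forall>x\<in>\<Omega>. v (u x) ^ 3 \<ge> 0" using v0 by simp
        have "v (u x) = 0" if "x \<in> \<Omega> - K" for x using that by (intro vz) (auto simp: K_def)
        then show "\<forall>x\<in>\<Omega> - K. v (u x) ^ 3 = 0 \<and> P1 (u x) *\<^sub>R grad u x = 0" by (simp add: P1_def)
        show "Y > 0" by (simp add: Y_def)
      qed
      also have "Y powr (- p1) * (LINT x:K|lborel. F x powr p1) \<le> S"
      proof -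
        have "(LINT x:K|lborel. F x powr p1) \<le> (LINT x:K|lborel. ((3 * \<beta> * lam) powr p1 * Y powr p1) * exp (p * u x))"
        proof (rule set_integral_mono)
          show "set_integrable lborel K (\<lambda>x. F x powr p1)"
            using wF by (intro set_integrable_compact K continuous_intros cF) force+
          show "set_integrable lborel K (\<lambda>x. ((3 * \<beta> * lam) powr p1 * Y powr p1) * exp (p * u x))"
            by (intro set_integrable_compact K continuous_intros continuous_on_subset[OF uD(2) K\<Omega>])
          fix x assume "x \<in> K"
          then have ux: "u x \<le> M" using uM K\<Omega> by blast
          have "F x powr p1 = (3 * \<beta> * lam) powr p1 * exp (p1 * ((1 + 3 * \<beta>) * u x))"
            using \<beta> lam by (simp add: F_def powr_mult exp_powr_real mult.commute)
          also have "p1 * ((1 + 3 * \<beta>) * u x) = (p1 * (3 * \<beta> - \<tau>)) * u x + p * u x"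
            using p1 by (simp add: \<tau>_def field_simps)
          also have "exp \<dots> \<le> exp ((p1 * (3 * \<beta> - \<tau>)) * M + p * u x)"
          proof -
            have "p / p1 \<le> p" using p1 p1p by (simp add: field_simps)
            then have "0 \<le> 3 * \<beta> - \<tau>" using \<beta> unfolding \<tau>_def by linarith
            then have "(p1 * (3 * \<beta> - \<tau>)) * u x \<le> (p1 * (3 * \<beta> - \<tau>)) * M"
              using p1 ux by (intro mult_left_mono) auto
            then show ?thesis by simp
          qed
          also have "\<dots> = Y powr p1 * exp (p * u x)"
            by (simp add: Y_def exp_powr_real exp_add mult_ac)
          finally show "F x powr p1 \<le> ((3 * \<beta> * lam) powr p1 * Y powr p1) * exp (p * u x)"
            by (simp add: mult.assoc mult_left_mono)
        qed
        also have "\<dots> = ((3 * \<beta> * lam) powr p1 * Y powr p1) * (LINT x:K|lborel. exp (p * u x))" by simp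
        also have "\<dots> \<le> ((3 * \<beta> * \<Lambda>) powr p1 * Y powr p1) * (C2 * measure lborel \<Omega>)"
        proof (rule mult_mono[OF _ energy])
          show "(3 * \<beta> * lam) powr p1 * Y powr p1 \<le> (3 * \<beta> * \<Lambda>) powr p1 * Y powr p1"
            using lam\<Lambda> lam \<beta> p1 by (intro mult_right_mono powr_mono2) auto
          show "0 \<le> (LINT x:K|lborel. exp (p * u x))"
            unfolding set_lebesgue_integral_def by (intro integral_nonneg_AE AE_I2) simp
        qed simp
        finally have "Y powr (- p1) * (LINT x:K|lborel. F x powr p1) \<le> Y powr (- p1) * (((3 * \<beta> * \<Lambda>) powr p1 * Y powr p1) * (C2 * measure lborel \<Omega>))"
          by (rule mult_left_mono) simp
        also have "\<dots> = (Y powr (- p1) * Y powr p1) * S" by (simp add: S_def)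
        also have "Y powr (- p1) * Y powr p1 = 1"
        proof -
          have "Y > 0" by (simp add: Y_def)
          then show ?thesis by (simp flip: powr_add)
        qed
        finally show ?thesis by simp
      qed
      finally have up: "?w x0 \<le> C1 * Y * (1 + S)"
        using C1 by (simp add: Y_def mult_left_mono)
      have lo: "\<rho> * exp (3 * \<beta> * M) \<le> ?w x0"
      proof -
        have "\<beta> \<le> - \<beta> + \<beta> * M" using \<beta> M2 mult_left_mono[of 2 M \<beta>] by simp
        then have "exp \<beta> \<le> exp (- \<beta>) * exp (\<beta> * M)" by (simp flip: exp_add)
        then have "(1 - exp (- \<beta>)) * exp (\<beta> * M) \<le> exp (\<beta> * M) - exp \<beta>" by (simp add: algebra_simps)
        also have "\<dots> \<le> v M" by (simp add: v_def)
        finally have "((1 - exp (- \<beta>)) * exp (\<beta> * M)) ^ 3 \<le> v M ^ 3" using \<beta> by (intro power_mono) auto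
        moreover have "exp (\<beta> * M) ^ 3 = exp (3 * \<beta> * M)" by (simp flip: exp_of_nat_mult)
        ultimately show ?thesis by (simp add: \<rho>_def power_mult_distrib M_def)
      qed
      \<comment> \<open>Dividing both bounds for the value at the maximum point by \<open>Y\<close>
        isolates e^(\<tau>M), which is thereby bounded.\<close>
      have "exp (3 * \<beta> * M) = Y * exp (\<tau> * M)" by (simp add: Y_def algebra_simps flip: exp_add)
      then have "Y * (\<rho> * exp (\<tau> * M)) \<le> Y * (C1 * (1 + S))" using lo up by (simp add: mult_ac)
      moreover have "Y > 0" by (simp add: Y_def)
      ultimately have "\<rho> * exp (\<tau> * M) \<le> C1 * (1 + S)" by simp
      then have "exp (\<tau> * M) \<le> Z" using \<rho> by (simp add: Z_def field_simps)
      moreover have "\<tau> * M \<le> exp (\<tau> * M)" using exp_ge_add_one_self[of "\<tau> * M"] by linarith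
      ultimately have "M \<le> Z / \<tau>" using \<tau> by (simp add: field_simps)
      then show ?thesis by (simp add: C_def)
    qed (simp add: C_def)
    then show "u x \<le> C" using uM[OF x] by linarith
  qed
qed

theorem proposition5p1:
  fixes \<Omega> :: "(real^'n::finite) set" and b :: "real^'n \<Rightarrow> real"
  assumes "smooth_bounded_domain \<Omega>"
  shows "\<exists>C::real. \<forall>(bl::real) (bu::real) (lam::real) (u::real^'n \<Rightarrow> real) (\<delta>::real) (\<eta>::real).
    0 \<le> bl \<longrightarrow> (\<forall>x\<in>\<Omega>. bl \<le> b x \<and> b x \<le> bu) \<longrightarrow>
    lam > 0 \<longrightarrow>
    stable_solution \<Omega> b lam exp u \<longrightarrow> (\<forall>x\<in>\<Omega>. u x > 0) \<longrightarrow>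
    \<delta> > 0 \<longrightarrow> \<eta> > 0 \<longrightarrow> \<delta>\<^sup>2 + \<eta>\<^sup>2 \<le> 1 \<longrightarrow>
    bu - bl < \<delta>\<^sup>2 / \<eta>\<^sup>2 * (\<eta>\<^sup>2 - bu / 8) \<longrightarrow>
    real CARD('n) < 2 + 4 * \<eta>\<^sup>2 + 4 * bu
      + 4 * sqrt (\<eta>\<^sup>2 * (\<eta>\<^sup>2 + bu) - 2 * bu * (bu - bl) * (\<eta>\<^sup>2 / \<delta>\<^sup>2)) \<longrightarrow>
    Linf_norm \<Omega> u \<le> ereal C"
proof -
  have \<Omega>: "open \<Omega>" "bounded \<Omega>" "\<Omega> \<noteq> {}" using assms by (auto simp: smooth_bounded_domain_def)
  define adm where "adm = (\<lambda>bl bu \<delta> \<eta>. 0 \<le> bl \<and> (\<forall>x\<in>\<Omega>. bl \<le> b x \<and> b x \<le> bu) \<and> \<delta> > 0 \<and> \<eta> > 0 \<and>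
    \<delta>\<^sup>2 + \<eta>\<^sup>2 \<le> 1 \<and> bu - bl < \<delta>\<^sup>2 / \<eta>\<^sup>2 * (\<eta>\<^sup>2 - bu / 8) \<and>
    real CARD('n) < 2 + 4 * \<eta>\<^sup>2 + 4 * bu
      + 4 * sqrt (\<eta>\<^sup>2 * (\<eta>\<^sup>2 + bu) - 2 * bu * (bu - bl) * (\<eta>\<^sup>2 / \<delta>\<^sup>2)))"
  \<comment> \<open>The constant may not depend on the parameters; but admissibility of a tuple only involves \<open>\<Omega>\<close>
    and \<open>b\<close>, so the bound obtained from one admissible tuple serves for all of them.\<close>
  have "\<exists>C. \<forall>bl bu lam u \<delta> \<eta>. adm bl bu \<delta> \<eta> \<longrightarrow> lam > 0 \<longrightarrow> stable_solution \<Omega> b lam exp u \<longrightarrow>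
      (\<forall>x\<in>\<Omega>. u x > 0) \<longrightarrow> (\<forall>x\<in>\<Omega>. u x \<le> C)"
  proof (cases "\<exists>bl bu \<delta> \<eta>. adm bl bu \<delta> \<eta>")
    case True
    then obtain bl bu \<delta> \<eta> where bl: "0 \<le> bl" and b: "\<And>x. x \<in> \<Omega> \<Longrightarrow> bl \<le> b x" "\<And>x. x \<in> \<Omega> \<Longrightarrow> b x \<le> bu"
      and h: "\<delta> > 0" "\<eta> > 0" "\<delta>\<^sup>2 + \<eta>\<^sup>2 \<le> 1" "bu - bl < \<delta>\<^sup>2 / \<eta>\<^sup>2 * (\<eta>\<^sup>2 - bu / 8)"
        "real CARD('n) < 2 + 4 * \<eta>\<^sup>2 + 4 * bu
          + 4 * sqrt (\<eta>\<^sup>2 * (\<eta>\<^sup>2 + bu) - 2 * bu * (bu - bl) * (\<eta>\<^sup>2 / \<delta>\<^sup>2))"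
      unfolding adm_def by blast
    have "bl \<le> bu" using b \<Omega>(3) by (meson all_not_in_conv order_trans)
    from exponent_choice[OF bl this h] obtain \<alpha> c where \<alpha>: "\<alpha> > 0" "c > 0" "c \<le> 2 * \<alpha>"
      "real CARD('n) < 2 * (2 * \<alpha> + 1)"
      and ineq: "\<And>t. bl \<le> t \<Longrightarrow> t \<le> bu \<Longrightarrow> (\<alpha> - t)\<^sup>2 + c \<le> 2 * \<alpha> - t" by metis
    have "\<exists>C. \<forall>lam u. lam > 0 \<longrightarrow> stable_solution \<Omega> b lam exp u \<longrightarrow> (\<forall>x\<in>\<Omega>. u x > 0) \<longrightarrow> (\<forall>x\<in>\<Omega>. u x \<le> C)"
      by (rule stable_solution_sup_bound[OF \<Omega> \<alpha> order_trans[OF bl b(1)] b(2) ineq[OF b]])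
    then show ?thesis by (elim exE, intro exI) blast
  qed blast
  then obtain C where C: "\<And>bl bu lam u \<delta> \<eta> x. adm bl bu \<delta> \<eta> \<Longrightarrow> lam > 0 \<Longrightarrow> stable_solution \<Omega> b lam exp u \<Longrightarrow>
      (\<forall>x\<in>\<Omega>. u x > 0) \<Longrightarrow> x \<in> \<Omega> \<Longrightarrow> u x \<le> C" by blast
  show ?thesis
  proof (intro exI[of _ C] allI impI)
    fix bl bu lam u \<delta> \<eta>
    assume h: "0 \<le> bl" "\<forall>x\<in>\<Omega>. bl \<le> b x \<and> b x \<le> bu" "lam > 0" "stable_solution \<Omega> b lam exp u" "\<forall>x\<in>\<Omega>. u x > 0"
      "\<delta> > 0" "\<eta> > 0" "\<delta>\<^sup>2 + \<eta>\<^sup>2 \<le> 1" "bu - bl < \<delta>\<^sup>2 / \<eta>\<^sup>2 * (\<eta>\<^sup>2 - bu / 8)"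
      "real CARD('n) < 2 + 4 * \<eta>\<^sup>2 + 4 * bu
        + 4 * sqrt (\<eta>\<^sup>2 * (\<eta>\<^sup>2 + bu) - 2 * bu * (bu - bl) * (\<eta>\<^sup>2 / \<delta>\<^sup>2))"
    have "adm bl bu \<delta> \<eta>" using h by (simp add: adm_def)
    then have uC: "u x \<le> C" if "x \<in> \<Omega>" for x using C h(3-5) that by blast
    have "continuous_on \<Omega> u"
      using h(4) continuous_on_subset closure_subset unfolding stable_solution_def classical_solution_def by blast
    then have "u \<in> borel_measurable (lebesgue_on \<Omega>)"
      using \<Omega>(1) by (intro continuous_imp_measurable_on_sets_lebesgue) (auto simp: borel_open)
    then have "(\<lambda>x. ereal \<bar>u x\<bar>) \<in> borel_measurable (lebesgue_on \<Omega>)" by measurable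
    \<comment> \<open>Positivity of \<open>u\<close> removes the absolute value, so the one-sided
      bound suffices.\<close>
    moreover have "AE x in lebesgue_on \<Omega>. ereal \<bar>u x\<bar> \<le> ereal C"
      using uC h(5) by (intro AE_I2) (auto simp: space_restrict_space)
    ultimately show "Linf_norm \<Omega> u \<le> ereal C"
      unfolding Linf_norm_def by (rule esssup_I)
  qed
qed

end
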